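(* Let $k$ be an uncountable algebraically closed field and let $R$ be an affine prime Goldie non-simple non-PI $k$-algebra with $\operatorname{GKdim}(R)<3$. If $R$ has an element $x$ which is not algebraic over $k$ and such that $x+P\in R/P$ is algebraic over $k$ for every prime ideal $P$ of $R$ with $\operatorname{GKdim}(R/P)=1$, then $R$ is primitive.
   Context: All algebras are associative with 1. A $k$-algebra is affine if it is finitely generated as a $k$-algebra. $\operatorname{GKdim}$ is Gelfand--Kirillov dimension over $k$. PI means satisfying a (nontrivial) polynomial identity. An element is algebraic over $k$ if it is a root of a nonzero polynomial in $k[t]$. Primitive means left primitive (having a faithful simple left module). Goldie means left and right Goldie. *)

theory Defs
  imports
    "Jordan_Normal_Form.Missing_VectorSpace"
    "HOL-Algebra.Algebraic_Closure"
    "HOL-Algebra.Ideal_Product"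
    "HOL-Library.Extended_Real"
    "HOL-Library.Liminf_Limsup"
    "HOL-Library.Countable_Set"
begin

section \<open>Algebras over a field\<close>

text \<open>The library locale \<open>algebra\<close> is restricted to commutative algebras.\<close>

locale k_algebra = V: vectorspace K R + R: ring R
  for K :: "('k, 'c) ring_scheme" (structure) and R :: "('k, 'a, 'b) module_scheme" (structure) +
  assumes smult_mult_left:
      "\<lbrakk>c \<in> carrier K; x \<in> carrier R; y \<in> carrier R\<rbrakk>
        \<Longrightarrow> (c \<odot>\<^bsub>R\<^esub> x) \<otimes>\<^bsub>R\<^esub> y = c \<odot>\<^bsub>R\<^esub> (x \<otimes>\<^bsub>R\<^esub> y)"
    and smult_mult_right:
      "\<lbrakk>c \<in> carrier K; x \<in> carrier R; y \<in> carrier R\<rbrakk>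
        \<Longrightarrow> x \<otimes>\<^bsub>R\<^esub> (c \<odot>\<^bsub>R\<^esub> y) = c \<odot>\<^bsub>R\<^esub> (x \<otimes>\<^bsub>R\<^esub> y)"

definition affine_algebra :: "('k, 'c) ring_scheme \<Rightarrow> ('k, 'a, 'b) module_scheme \<Rightarrow> bool" where
  "affine_algebra K R \<longleftrightarrow>
    (\<exists>S. finite S \<and> S \<subseteq> carrier R \<and>
      (\<forall>B. subring B R \<and> (\<forall>c\<in>carrier K. \<forall>b\<in>B. c \<odot>\<^bsub>R\<^esub> b \<in> B) \<and> S \<subseteq> B
            \<longrightarrow> B = carrier R))"

text \<open>The ring \<open>R Quot P\<close>, equipped with the scalar action \<open>c (x + P) = c x + P\<close>.\<close>

definition quotient_algebra ::
  "('k, 'a, 'b) module_scheme \<Rightarrow> 'a set \<Rightarrow> ('k, 'a set) module" where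
  "quotient_algebra R P =
    \<lparr>carrier = carrier (R Quot P), monoid.mult = monoid.mult (R Quot P), one = one (R Quot P),
     zero = zero (R Quot P), add = add (R Quot P),
     smult = (\<lambda>c C. \<Union>x\<in>C. P +>\<^bsub>R\<^esub> (c \<odot>\<^bsub>R\<^esub> x))\<rparr>"

text \<open>In \<open>poly_ring\<close> a polynomial is the list of its coefficients, leading one first, so mapping
  \<open>c \<mapsto> c \<cdot> 1\<close> over it and evaluating in \<open>R\<close> gives \<open>p(x)\<close>.\<close>

definition algebraic_element ::
  "('k, 'c) ring_scheme \<Rightarrow> ('k, 'a, 'b) module_scheme \<Rightarrow> 'a \<Rightarrow> bool" where
  "algebraic_element K R x \<longleftrightarrow>
    (\<exists>p\<in>carrier (poly_ring K). p \<noteq> \<zero>\<^bsub>poly_ring K\<^esub> \<and>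
      ring.eval R (map (\<lambda>c. c \<odot>\<^bsub>R\<^esub> \<one>\<^bsub>R\<^esub>) p) x = \<zero>\<^bsub>R\<^esub>)"

definition word_value :: "('a, 'b) ring_scheme \<Rightarrow> 'a list \<Rightarrow> 'a" where
  "word_value R xs = foldr (monoid.mult R) xs \<one>\<^bsub>R\<^esub>"

text \<open>An element of the free algebra \<open>K\<langle>X\<^sub>0, X\<^sub>1, \<dots>\<rangle>\<close> is a finitely supported
  coefficient function on words \<open>w :: nat list\<close> in the indices of the variables.\<close>

definition PI_algebra :: "('k, 'c) ring_scheme \<Rightarrow> ('k, 'a, 'b) module_scheme \<Rightarrow> bool" where
  "PI_algebra K R \<longleftrightarrow>
    (\<exists>f :: nat list \<Rightarrow> 'k. range f \<subseteq> carrier K \<and>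
      finite {w. f w \<noteq> \<zero>\<^bsub>K\<^esub>} \<and> {w. f w \<noteq> \<zero>\<^bsub>K\<^esub>} \<noteq> {} \<and>
      (\<forall>\<rho>. range \<rho> \<subseteq> carrier R \<longrightarrow>
        (\<Oplus>\<^bsub>R\<^esub>w\<in>{w. f w \<noteq> \<zero>\<^bsub>K\<^esub>}. f w \<odot>\<^bsub>R\<^esub> word_value R (map \<rho> w)) = \<zero>\<^bsub>R\<^esub>))"


section \<open>Gelfand--Kirillov dimension\<close>

text \<open>\<open>growth K R V n = dim (K + V + V\<^sup>2 + \<dots> + V\<^sup>n)\<close>; the empty word contributes \<open>K\<close>.\<close>

definition growth ::
  "('k, 'c) ring_scheme \<Rightarrow> ('k, 'a, 'b) module_scheme \<Rightarrow> 'a set \<Rightarrow> nat \<Rightarrow> nat" where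
  "growth K R V n = vectorspace.dim K
    (R\<lparr>carrier := LinearCombinations.module.span K R
        {word_value R xs | xs. set xs \<subseteq> V \<and> length xs \<le> n}\<rparr>)"

text \<open>The supremum is over all finite-dimensional subspaces \<open>V\<close> of \<open>R\<close>. The junk values of
  the quotient at \<open>n = 0, 1\<close> do not affect the limit superior.\<close>

definition GKdim :: "('k, 'c) ring_scheme \<Rightarrow> ('k, 'a, 'b) module_scheme \<Rightarrow> ereal" where
  "GKdim K R =
    (SUP V\<in>{LinearCombinations.module.span K R S | S. finite S \<and> S \<subseteq> carrier R}.
      limsup (\<lambda>n. ereal (ln (real (growth K R V n)) / ln (real n))))"


section \<open>Noncommutative rings\<close>

text \<open>The library's \<open>primeideal\<close> is the commutative (completely prime) notion.\<close>

definition prime_ideal :: "'a set \<Rightarrow> ('a, 'b) ring_scheme \<Rightarrow> bool" where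
  "prime_ideal P R \<longleftrightarrow> ideal P R \<and> P \<noteq> carrier R \<and>
    (\<forall>I J. ideal I R \<and> ideal J R \<and> ideal_prod R I J \<subseteq> P \<longrightarrow> I \<subseteq> P \<or> J \<subseteq> P)"

definition prime_ring :: "('a, 'b) ring_scheme \<Rightarrow> bool" where
  "prime_ring R \<longleftrightarrow> prime_ideal {\<zero>\<^bsub>R\<^esub>} R"

definition simple_ring :: "('a, 'b) ring_scheme \<Rightarrow> bool" where
  "simple_ring R \<longleftrightarrow> carrier R \<noteq> {\<zero>\<^bsub>R\<^esub>} \<and>
    (\<forall>I. ideal I R \<longrightarrow> I = {\<zero>\<^bsub>R\<^esub>} \<or> I = carrier R)"

definition left_ideal :: "'a set \<Rightarrow> ('a, 'b) ring_scheme \<Rightarrow> bool" where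
  "left_ideal L R \<longleftrightarrow> additive_subgroup L R \<and>
    (\<forall>r\<in>carrier R. \<forall>x\<in>L. r \<otimes>\<^bsub>R\<^esub> x \<in> L)"

definition left_annihilator :: "('a, 'b) ring_scheme \<Rightarrow> 'a set \<Rightarrow> 'a set" where
  "left_annihilator R S = {r \<in> carrier R. \<forall>s\<in>S. r \<otimes>\<^bsub>R\<^esub> s = \<zero>\<^bsub>R\<^esub>}"

definition independent_sequence :: "('a, 'b) ring_scheme \<Rightarrow> (nat \<Rightarrow> 'a set) \<Rightarrow> bool" where
  "independent_sequence R L \<longleftrightarrow>
    (\<forall>n. \<forall>f. (\<forall>i\<le>n. f i \<in> L i) \<and> (\<Oplus>\<^bsub>R\<^esub>i\<in>{..n}. f i) = \<zero>\<^bsub>R\<^esub>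
        \<longrightarrow> (\<forall>i\<le>n. f i = \<zero>\<^bsub>R\<^esub>))"

text \<open>Ascending chain condition on left annihilators, and no infinite direct sum of nonzero
  left ideals.\<close>

definition left_goldie :: "('a, 'b) ring_scheme \<Rightarrow> bool" where
  "left_goldie R \<longleftrightarrow>
    (\<forall>A :: nat \<Rightarrow> 'a set.
      (\<forall>n. \<exists>S\<subseteq>carrier R. A n = left_annihilator R S) \<and> (\<forall>n. A n \<subseteq> A (Suc n))
        \<longrightarrow> (\<exists>N. \<forall>n\<ge>N. A n = A N)) \<and>
    \<not> (\<exists>L :: nat \<Rightarrow> 'a set.
        (\<forall>n. left_ideal (L n) R \<and> L n \<noteq> {\<zero>\<^bsub>R\<^esub>}) \<and> independent_sequence R L)"

definition opposite_ring :: "('a, 'b) ring_scheme \<Rightarrow> ('a, 'b) ring_scheme" where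
  "opposite_ring R = R\<lparr>monoid.mult := \<lambda>x y. y \<otimes>\<^bsub>R\<^esub> x\<rparr>"

definition goldie :: "('a, 'b) ring_scheme \<Rightarrow> bool" where
  "goldie R \<longleftrightarrow> left_goldie R \<and> left_goldie (opposite_ring R)"


section \<open>Left modules and primitivity\<close>

text \<open>The library locale \<open>module\<close> requires a commutative ring of scalars.\<close>

locale left_module = R?: ring R + M?: abelian_group M
  for R :: "('a, 'b) ring_scheme" (structure) and M :: "('a, 'm, 'c) module_scheme" (structure) +
  assumes act_closed: "\<lbrakk>r \<in> carrier R; m \<in> carrier M\<rbrakk> \<Longrightarrow> r \<odot>\<^bsub>M\<^esub> m \<in> carrier M"
    and act_l_distr: "\<lbrakk>r \<in> carrier R; s \<in> carrier R; m \<in> carrier M\<rbrakk>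
      \<Longrightarrow> (r \<oplus>\<^bsub>R\<^esub> s) \<odot>\<^bsub>M\<^esub> m = r \<odot>\<^bsub>M\<^esub> m \<oplus>\<^bsub>M\<^esub> s \<odot>\<^bsub>M\<^esub> m"
    and act_r_distr: "\<lbrakk>r \<in> carrier R; m \<in> carrier M; n \<in> carrier M\<rbrakk>
      \<Longrightarrow> r \<odot>\<^bsub>M\<^esub> (m \<oplus>\<^bsub>M\<^esub> n) = r \<odot>\<^bsub>M\<^esub> m \<oplus>\<^bsub>M\<^esub> r \<odot>\<^bsub>M\<^esub> n"
    and act_assoc: "\<lbrakk>r \<in> carrier R; s \<in> carrier R; m \<in> carrier M\<rbrakk>
      \<Longrightarrow> (r \<otimes>\<^bsub>R\<^esub> s) \<odot>\<^bsub>M\<^esub> m = r \<odot>\<^bsub>M\<^esub> (s \<odot>\<^bsub>M\<^esub> m)"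
    and act_one: "m \<in> carrier M \<Longrightarrow> \<one>\<^bsub>R\<^esub> \<odot>\<^bsub>M\<^esub> m = m"

definition simple_left_module ::
  "('a, 'b) ring_scheme \<Rightarrow> ('a, 'm, 'c) module_scheme \<Rightarrow> bool" where
  "simple_left_module R M \<longleftrightarrow> left_module R M \<and> carrier M \<noteq> {\<zero>\<^bsub>M\<^esub>} \<and>
    (\<forall>N. additive_subgroup N M \<and> (\<forall>r\<in>carrier R. \<forall>m\<in>N. r \<odot>\<^bsub>M\<^esub> m \<in> N)
        \<longrightarrow> N = {\<zero>\<^bsub>M\<^esub>} \<or> N = carrier M)"

definition faithful_left_module ::
  "('a, 'b) ring_scheme \<Rightarrow> ('a, 'm, 'c) module_scheme \<Rightarrow> bool" where
  "faithful_left_module R M \<longleftrightarrow> left_module R M \<and>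
    (\<forall>r\<in>carrier R. (\<forall>m\<in>carrier M. r \<odot>\<^bsub>M\<^esub> m = \<zero>\<^bsub>M\<^esub>) \<longrightarrow> r = \<zero>\<^bsub>R\<^esub>)"

text \<open>HOL cannot quantify over types inside a definition, so the module is taken with elements
  in \<open>'a set\<close>. This loses nothing: every simple left \<open>R\<close>-module is isomorphic to \<open>R / L\<close> for
  a maximal left ideal \<open>L\<close>, and the elements of \<open>R / L\<close> are cosets, i.e. sets over \<open>'a\<close>.\<close>

definition left_primitive :: "('a, 'b) ring_scheme \<Rightarrow> bool" where
  "left_primitive R \<longleftrightarrow>
    (\<exists>M :: ('a, 'a set) module. simple_left_module R M \<and> faithful_left_module R M)"

end

(*
  Suppose R is not primitive. A nonzero ideal M contains an element c with zero left annihilator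
  (Goldie), and the blocks V^n c^i for i <= n then show that the growth of R/M is smaller than
  quadratic, hence linear by Bergman's gap theorem. Consequently a primitive quotient R/M is finite
  dimensional: density and End = K turn infinitely many dimensions of the simple module into growth
  faster than every linear function. Since K is uncountable and x is not algebraic, uncountably many
  x - l are not left invertible, so each lies in a maximal left ideal, whose annihilator in R we
  call M_l. For some d, infinitely many of the R/M_l have dimension at most d; their intersection is nonzero
  because R does not satisfy the standard identity of degree d + 1. A prime P containing this
  intersection, all of whose elements lie in infinitely many M_l, satisfies GKdim(R/P) = 1 or
  dim(R/P) finite, so q(x) lies in P for some polynomial q <> 0. Then q(l) = 0 for infinitely many l.
*)

theory Submission
  imports Defs "HOL-Real_Asymp.Real_Asymp" "HOL-Combinatorics.Permutations"
begin

section \<open>Independence modulo a subspace\<close>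

text \<open>The intersection of the M_l need not be prime, while the hypothesis on x speaks only of
  primes, and a prime above the intersection may contain elements that lie in few of the M_l. Hence
  P comes from Zorn's lemma, as a maximal ideal among those all of whose finite subsets lie in
  infinitely many M_l; a condition on finite subsets passes to unions of chains. To prove P prime,
  finitely many products must test a R b \<subseteq> M_l for all l at once. This is the second use
  of the common bound d: the words of length at most d span R modulo every M_l.

  The element x - l lies in a maximal left ideal L_l, not necessarily in its two-sided core M_l.
  This is enough, because q(x) = s(x)(x - l) + q(l), so q(x) in M_l \<subseteq> L_l forces q(l) = 0.

  The element c comes from an incomplete Goldie theorem: if every element of M has a nonzero left
  annihilator, one constructs an infinite direct sum of left ideals. Dimensions of quotients are
  measured inside R throughout, by lists independent modulo a subspace U.\<close>

context k_algebra
begin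

abbreviation sp :: "'a set \<Rightarrow> 'a set" where
  "sp \<equiv> LinearCombinations.module.span K R"

lemma submoduleI:
  assumes "N \<subseteq> carrier R" "\<zero>\<^bsub>R\<^esub> \<in> N"
    and "\<And>v w. v \<in> N \<Longrightarrow> w \<in> N \<Longrightarrow> v \<oplus>\<^bsub>R\<^esub> w \<in> N"
    and "\<And>c v. c \<in> carrier K \<Longrightarrow> v \<in> N \<Longrightarrow> c \<odot>\<^bsub>R\<^esub> v \<in> N"
  shows "submodule K N R"
  using assms by (simp add: submodule_def V.module_axioms)

lemma span_minimal: "S \<subseteq> N \<Longrightarrow> submodule K N R \<Longrightarrow> sp S \<subseteq> N"
  by (rule V.span_is_subset)

lemma span_closed: "S \<subseteq> carrier R \<Longrightarrow> v \<in> sp S \<Longrightarrow> v \<in> carrier R"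
  using V.span_is_subset2 by blast

lemma span_base: "S \<subseteq> carrier R \<Longrightarrow> x \<in> S \<Longrightarrow> x \<in> sp S"
  using V.in_own_span by blast

lemma span_zero: "S \<subseteq> carrier R \<Longrightarrow> \<zero>\<^bsub>R\<^esub> \<in> sp S"
  by (rule submodule.zero_closed[OF V.span_is_submodule])

lemma span_add:
  "S \<subseteq> carrier R \<Longrightarrow> u \<in> sp S \<Longrightarrow> v \<in> sp S \<Longrightarrow> u \<oplus>\<^bsub>R\<^esub> v \<in> sp S"
  by (rule submodule.m_closed[OF V.span_is_submodule])

lemma span_smult:
  "S \<subseteq> carrier R \<Longrightarrow> c \<in> carrier K \<Longrightarrow> v \<in> sp S \<Longrightarrow> c \<odot>\<^bsub>R\<^esub> v \<in> sp S"
  by (rule submodule.smult_closed[OF V.span_is_submodule])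

lemma smult_neg_one: "v \<in> carrier R \<Longrightarrow> (\<ominus>\<^bsub>K\<^esub> \<one>\<^bsub>K\<^esub>) \<odot>\<^bsub>R\<^esub> v = \<ominus>\<^bsub>R\<^esub> v"
  by (simp add: V.smult_l_minus)

lemma submodule_neg:
  assumes "submodule K N R" "v \<in> N" shows "\<ominus>\<^bsub>R\<^esub> v \<in> N"
proof -
  have "v \<in> carrier R" using assms submodule.subset by blast
  then show ?thesis
    using submodule.smult_closed[OF assms(1) _ assms(2), of "\<ominus>\<^bsub>K\<^esub> \<one>\<^bsub>K\<^esub>"] smult_neg_one by simp
qed

lemma submodule_minus:
  "submodule K N R \<Longrightarrow> u \<in> N \<Longrightarrow> v \<in> N \<Longrightarrow> u \<ominus>\<^bsub>R\<^esub> v \<in> N"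
  by (simp add: a_minus_def submodule_neg submodule.m_closed)

lemma span_mono: "S \<subseteq> Y \<Longrightarrow> sp S \<subseteq> sp Y"
  by (rule V.span_is_monotone)

lemma span_subsetI: "S \<subseteq> sp Y \<Longrightarrow> Y \<subseteq> carrier R \<Longrightarrow> sp S \<subseteq> sp Y"
  by (intro span_minimal V.span_is_submodule)

lemma span_of_submodule: "submodule K U R \<Longrightarrow> sp U = U"
  by (meson span_minimal V.in_own_span order_refl submodule.subset subset_antisym)

lemma span_insertE:
  assumes "v \<in> sp (insert w S)" "w \<in> carrier R" "S \<subseteq> carrier R"
  obtains c u where "c \<in> carrier K" "u \<in> sp S" "v = c \<odot>\<^bsub>R\<^esub> w \<oplus>\<^bsub>R\<^esub> u"
proof -
  let ?N = "{c \<odot>\<^bsub>R\<^esub> w \<oplus>\<^bsub>R\<^esub> u |c u. c \<in> carrier K \<and> u \<in> sp S}"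
  have cl: "sp S \<subseteq> carrier R" using assms(3) by (rule V.span_is_subset2)
  have "submodule K ?N R"
  proof (rule submoduleI)
    show "?N \<subseteq> carrier R" using cl assms(2) by auto
    have "\<zero>\<^bsub>R\<^esub> = \<zero>\<^bsub>K\<^esub> \<odot>\<^bsub>R\<^esub> w \<oplus>\<^bsub>R\<^esub> \<zero>\<^bsub>R\<^esub>" using assms(2) by simp
    then show "\<zero>\<^bsub>R\<^esub> \<in> ?N" using span_zero[OF assms(3)] by blast
  next
    fix a b assume "a \<in> ?N" "b \<in> ?N"
    then obtain c u d t where *: "c \<in> carrier K" "u \<in> sp S" "d \<in> carrier K" "t \<in> sp S"
      "a = c \<odot>\<^bsub>R\<^esub> w \<oplus>\<^bsub>R\<^esub> u" "b = d \<odot>\<^bsub>R\<^esub> w \<oplus>\<^bsub>R\<^esub> t" by blast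
    have "u \<in> carrier R" "t \<in> carrier R" using * cl by auto
    then have "a \<oplus>\<^bsub>R\<^esub> b = (c \<oplus>\<^bsub>K\<^esub> d) \<odot>\<^bsub>R\<^esub> w \<oplus>\<^bsub>R\<^esub> (u \<oplus>\<^bsub>R\<^esub> t)"
      using * assms(2) by (simp add: V.smult_l_distr V.M.a_assoc V.M.a_comm V.M.a_lcomm)
    then show "a \<oplus>\<^bsub>R\<^esub> b \<in> ?N" using * span_add[OF assms(3)] by blast
  next
    fix e a assume "e \<in> carrier K" "a \<in> ?N"
    then obtain c u where *: "c \<in> carrier K" "u \<in> sp S" "a = c \<odot>\<^bsub>R\<^esub> w \<oplus>\<^bsub>R\<^esub> u" by blast
    have "u \<in> carrier R" using * cl by auto
    then have "e \<odot>\<^bsub>R\<^esub> a = (e \<otimes>\<^bsub>K\<^esub> c) \<odot>\<^bsub>R\<^esub> w \<oplus>\<^bsub>R\<^esub> e \<odot>\<^bsub>R\<^esub> u"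
      using * assms(2) \<open>e \<in> carrier K\<close> by (simp add: V.smult_r_distr V.smult_assoc1)
    then show "e \<odot>\<^bsub>R\<^esub> a \<in> ?N" using * \<open>e \<in> carrier K\<close> span_smult[OF assms(3)] by blast
  qed
  moreover have "insert w S \<subseteq> ?N"
  proof -
    have "w = \<one>\<^bsub>K\<^esub> \<odot>\<^bsub>R\<^esub> w \<oplus>\<^bsub>R\<^esub> \<zero>\<^bsub>R\<^esub>" using assms(2) by simp
    then have "w \<in> ?N" using span_zero[OF assms(3)] by blast
    moreover have "x \<in> ?N" if "x \<in> S" for x
    proof -
      have "x = \<zero>\<^bsub>K\<^esub> \<odot>\<^bsub>R\<^esub> w \<oplus>\<^bsub>R\<^esub> x" using assms(2,3) that by auto
      then show ?thesis using span_base[OF assms(3) that] by blast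
    qed
    ultimately show ?thesis by blast
  qed
  ultimately have "v \<in> ?N" using span_minimal assms(1) by blast
  then show ?thesis using that by blast
qed

text \<open>The coefficient of \<open>w\<close> in \<open>v\<close> is nonzero, since otherwise
  \<open>v\<close> would lie in \<open>sp S\<close>; dividing by it solves for
  \<open>w\<close>.\<close>

lemma span_exchange:
  assumes v: "v \<in> sp (insert w S)" "v \<notin> sp S" and w: "w \<in> carrier R" and S: "S \<subseteq> carrier R"
  shows "w \<in> sp (insert v S)"
proof -
  obtain c u where *: "c \<in> carrier K" "u \<in> sp S" "v = c \<odot>\<^bsub>R\<^esub> w \<oplus>\<^bsub>R\<^esub> u"
    using span_insertE[OF v(1) w S] by metis
  have u: "u \<in> carrier R" using span_closed[OF S *(2)] .
  have "c \<noteq> \<zero>\<^bsub>K\<^esub>"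
  proof
    assume "c = \<zero>\<^bsub>K\<^esub>"
    then have "v = u" using * w u by simp
    then show False using * v by blast
  qed
  then have c: "inv\<^bsub>K\<^esub> c \<in> carrier K" "inv\<^bsub>K\<^esub> c \<otimes>\<^bsub>K\<^esub> c = \<one>\<^bsub>K\<^esub>"
    using * V.field_Units by auto
  have v': "v \<in> carrier R" using * w u by auto
  have vX: "insert v S \<subseteq> carrier R" using v' S by auto
  have "c \<odot>\<^bsub>R\<^esub> w = v \<ominus>\<^bsub>R\<^esub> u"
    using * w u by (simp add: a_minus_def V.M.a_assoc V.M.r_neg)
  then have "w = inv\<^bsub>K\<^esub> c \<odot>\<^bsub>R\<^esub> (v \<ominus>\<^bsub>R\<^esub> u)"
    using w c * by (metis V.smult_assoc1 V.smult_one)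
  moreover have "v \<ominus>\<^bsub>R\<^esub> u \<in> sp (insert v S)"
    using submodule_minus[OF V.span_is_submodule[OF vX]] span_base[OF vX] *(2)
      span_mono[of S "insert v S"] by blast
  ultimately show ?thesis using span_smult[OF vX c(1)] by simp
qed

text \<open>Linear independence modulo the span of \<open>U\<close>, encoded triangularly so that no coefficients occur.\<close>

fun indep :: "'a set \<Rightarrow> 'a list \<Rightarrow> bool" where
  "indep U [] \<longleftrightarrow> True"
| "indep U (f # fs) \<longleftrightarrow> f \<notin> sp U \<and> indep (insert f U) fs"

lemma indep_append: "indep U (fs @ gs) \<longleftrightarrow> indep U fs \<and> indep (U \<union> set fs) gs"
  by (induction fs arbitrary: U) auto

text \<open>Steinitz exchange relative to \<open>U\<close>, by induction on \<open>G\<close>: either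
  \<open>f\<close> is already in the span without the new generator and an earlier one is exchanged,
  or \<open>f\<close> involves the new generator and replaces it.\<close>

lemma span_exchange_set:
  assumes "finite G" "f \<in> sp (U \<union> G)" "f \<notin> sp U" "U \<subseteq> carrier R" "G \<subseteq> carrier R"
  shows "\<exists>g\<in>G. sp (U \<union> G) \<subseteq> sp (insert f U \<union> (G - {g}))"
  using assms
proof (induction G rule: finite_induct)
  case (insert g G)
  let ?S = "U \<union> G"
  have S: "?S \<subseteq> carrier R" and g: "g \<in> carrier R" using insert.prems by auto
  have f: "f \<in> carrier R" using insert.prems span_closed[of "U \<union> insert g G" f] by auto
  show ?case
  proof (cases "f \<in> sp ?S")
    case True
    then obtain h where h: "h \<in> G" "sp (U \<union> G) \<subseteq> sp (insert f U \<union> (G - {h}))"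
      using insert by auto
    let ?Y = "insert f U \<union> (insert g G - {h})"
    have Y: "?Y \<subseteq> carrier R" using S g f by auto
    have "h \<noteq> g" using h insert.hyps by blast
    have "U \<union> insert g G \<subseteq> sp ?Y"
    proof -
      have "?S \<subseteq> sp ?Y"
        using V.in_own_span[OF S] h(2) span_mono[of "insert f U \<union> (G - {h})" ?Y] by blast
      moreover have "g \<in> sp ?Y" using span_base[OF Y] \<open>h \<noteq> g\<close> by blast
      ultimately show ?thesis by blast
    qed
    then show ?thesis using span_subsetI[OF _ Y] h(1) by blast
  next
    case False
    have "f \<in> sp (insert g ?S)" using insert.prems by simp
    then have "g \<in> sp (insert f ?S)" using span_exchange[OF _ False g S] by blast
    moreover have "?S \<subseteq> sp (insert f ?S)" using S f span_base[of "insert f ?S"] by auto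
    ultimately have "U \<union> insert g G \<subseteq> sp (insert f ?S)" by blast
    then have "sp (U \<union> insert g G) \<subseteq> sp (insert f ?S)" using span_subsetI S f by simp
    moreover have "insert f ?S = insert f U \<union> (insert g G - {g})" using insert.hyps by auto
    ultimately show ?thesis by auto
  qed
qed auto

text \<open>Each entry of \<open>fs\<close> moves into \<open>U\<close> and displaces one element of
  \<open>G\<close>. The triangular form of \<open>indep\<close> is what lets the induction continue
  with \<open>insert f U\<close>.\<close>

theorem indep_length_le:
  assumes "finite G" "set fs \<subseteq> sp (U \<union> G)" "indep U fs" "U \<subseteq> carrier R" "G \<subseteq> carrier R"
  shows "length fs \<le> card G"
  using assms
proof (induction fs arbitrary: U G)
  case (Cons f fs)
  obtain g where g: "g \<in> G" "sp (U \<union> G) \<subseteq> sp (insert f U \<union> (G - {g}))"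
    using span_exchange_set[of G f U] Cons.prems by auto
  have "f \<in> carrier R" using Cons.prems span_closed[of "U \<union> G" f] by auto
  then have "length fs \<le> card (G - {g})"
    using Cons.IH[of "G - {g}" "insert f U"] Cons.prems g by auto
  then show ?case using g(1) Cons.prems(1)
    by (metis Suc_le_mono card_Suc_Diff1 length_Cons)
qed simp

lemma not_indepE:
  assumes "\<not> indep U fs"
  obtains as f bs where "fs = as @ f # bs" "f \<in> sp (U \<union> set as)" "indep U as"
proof -
  have "\<exists>as f bs. fs = as @ f # bs \<and> f \<in> sp (U \<union> set as) \<and> indep U as"
    using assms
  proof (induction fs arbitrary: U)
    case (Cons f fs)
    show ?case
    proof (cases "f \<in> sp U")
      case True
      then show ?thesis by (intro exI[of _ "[]"]) auto
    next
      case False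
      then have "\<not> indep (insert f U) fs" using Cons.prems by simp
      then obtain as g bs where "fs = as @ g # bs" "g \<in> sp (insert f U \<union> set as)"
        "indep (insert f U) as"
        using Cons.IH by blast
      then show ?thesis using False by (intro exI[of _ "f # as"] exI[of _ g] exI[of _ bs]) auto
    qed
  qed simp
  then show ?thesis using that by blast
qed

text \<open>Independent lists in \<open>A\<close> have length at most \<open>card F\<close>, so a
  longest one exists; if it failed to span, one more entry could be appended.\<close>

lemma indep_maximal:
  assumes "finite F" "F \<subseteq> carrier R" "U \<subseteq> carrier R" "A \<subseteq> sp (U \<union> F)"
  shows "\<exists>fs. set fs \<subseteq> A \<and> indep U fs \<and> A \<subseteq> sp (U \<union> set fs)"
proof -
  let ?P = "\<lambda>fs. set fs \<subseteq> A \<and> indep U fs"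
  have "?P []" by simp
  moreover have "length fs < card F + 1" if "?P fs" for fs
  proof -
    have "set fs \<subseteq> sp (U \<union> F)" using that assms(4) by blast
    then show ?thesis using indep_length_le[of F fs U] that assms by simp
  qed
  ultimately obtain fs where fs: "?P fs" and max: "\<And>gs. ?P gs \<Longrightarrow> length gs \<le> length fs"
    using ex_has_greatest_nat[of ?P "[]" length "card F + 1"] by blast
  have "A \<subseteq> sp (U \<union> set fs)"
  proof (rule ccontr)
    assume "\<not> ?thesis"
    then obtain a where "a \<in> A" "a \<notin> sp (U \<union> set fs)" by blast
    then have "?P (fs @ [a])" using fs by (auto simp: indep_append)
    then show False using max[of "fs @ [a]"] by simp
  qed
  then show ?thesis using fs by blast
qed

lemma indep_antimono:
  assumes "indep W fs" "U \<subseteq> sp W" "W \<subseteq> carrier R" "set fs \<subseteq> carrier R"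
  shows "indep U fs"
  using assms
proof (induction fs arbitrary: U W)
  case (Cons f fs)
  have c: "insert f W \<subseteq> carrier R" using Cons.prems by auto
  have "insert f U \<subseteq> sp (insert f W)"
    using span_base[OF c] Cons.prems(2) span_mono[of W "insert f W"] by blast
  moreover have "sp U \<subseteq> sp W" using span_subsetI Cons.prems by auto
  ultimately show ?case using Cons.IH[of "insert f W" "insert f U"] Cons.prems c by auto
qed simp

section \<open>Independent lists and \<open>vectorspace.dim\<close>\<close>

lemma span_in_vs:
  assumes "submodule K N R" "S \<subseteq> N"
  shows "LinearCombinations.module.span K (R\<lparr>carrier := N\<rparr>) S = sp S"
  using V.span_li_not_depend(1)[OF assms(2,1)] .

text \<open>\<open>vectorspace.dim\<close> is the least size of a finite spanning set, so any such
  set bounds it from above.\<close>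

lemma dim_span_le:
  assumes "S \<subseteq> carrier R" "finite G" "G \<subseteq> carrier R" "sp S = sp G"
  shows "vectorspace.dim K (R\<lparr>carrier := sp S\<rparr>) \<le> card G"
proof -
  have sm: "submodule K (sp S) R" using V.span_is_submodule assms(1) .
  have vs: "vectorspace K (R\<lparr>carrier := sp S\<rparr>)"
    using V.subspace_is_vs[OF V.span_is_subspace[OF assms(1)]] .
  have "G \<subseteq> sp S" using V.in_own_span[OF assms(3)] assms(4) by simp
  then have "LinearCombinations.module.span K (R\<lparr>carrier := sp S\<rparr>) G = sp S"
    using span_in_vs[OF sm] assms(4) by simp
  then show ?thesis unfolding vectorspace.dim_def[OF vs]
    using \<open>G \<subseteq> sp S\<close> assms(2) by (intro Least_le) auto
qed

text \<open>The finite set \<open>G\<close> ensures that the least element defining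
  \<open>vectorspace.dim\<close> is attained; a spanning set \<open>A\<close> of that size then
  bounds every independent list by exchange.\<close>

lemma dim_span_ge:
  assumes "S \<subseteq> carrier R" "finite G" "G \<subseteq> carrier R" "sp S = sp G"
    and "set fs \<subseteq> sp S" "indep {} fs"
  shows "length fs \<le> vectorspace.dim K (R\<lparr>carrier := sp S\<rparr>)"
proof -
  let ?W = "R\<lparr>carrier := sp S\<rparr>"
  have sm: "submodule K (sp S) R" using V.span_is_submodule assms(1) .
  have vs: "vectorspace K ?W"
    using V.subspace_is_vs[OF V.span_is_subspace[OF assms(1)]] .
  let ?P = "\<lambda>n. \<exists>A. finite A \<and> card A = n \<and> A \<subseteq> carrier ?W \<and>
      LinearCombinations.module.span K ?W A = carrier ?W"
  have "G \<subseteq> sp S" using V.in_own_span[OF assms(3)] assms(4) by simp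
  then have "?P (card G)"
    using span_in_vs[OF sm] assms by auto
  then have "?P (vectorspace.dim K ?W)"
    unfolding vectorspace.dim_def[OF vs] by (rule LeastI)
  then obtain A where A: "finite A" "card A = vectorspace.dim K ?W" "A \<subseteq> sp S"
    "LinearCombinations.module.span K ?W A = sp S" by auto
  then have "sp A = sp S" using span_in_vs[OF sm] by simp
  moreover have "A \<subseteq> carrier R" using A span_closed[OF assms(1)] by blast
  ultimately show ?thesis using indep_length_le[of A fs "{}"] A assms by auto
qed

end

section \<open>Words with few factors\<close>

text \<open>The word is a total function with a cut-off \<open>N\<close>, so that the induction in
  \<open>middle_periodic\<close> can shorten the prefix without changing the word.\<close>

definition word_factors :: "(nat \<Rightarrow> 'x) \<Rightarrow> nat \<Rightarrow> nat \<Rightarrow> 'x list set" where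
  "word_factors w N d = (\<lambda>i. map w [i..<i + d]) ` {i. i + d \<le> N}"

lemma finite_word_factors: "finite (word_factors w N d)"
proof -
  have "{i. i + d \<le> N} \<subseteq> {..N}" by auto
  then show ?thesis unfolding word_factors_def using finite_subset by blast
qed

lemma word_factorsI: "i + d \<le> N \<Longrightarrow> map w [i..<i + d] \<in> word_factors w N d"
  unfolding word_factors_def by blast

lemma map_upt_eq_iff:
  "map w [i..<i + d] = map w [j..<j + d] \<longleftrightarrow> (\<forall>m<d. w (i + m) = w (j + m))"
  by (simp add: list_eq_iff_nth_eq)

text \<open>Dropping the last letter either leaves at most \<open>d\<close> factors of length \<open>d\<close>, or every factor of
  length \<open>d\<close> determines the letter following it; in the latter case the first repetition forces a
  period.\<close>

lemma middle_periodic: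
  assumes "d \<ge> 1" "card (word_factors w N d) \<le> d"
  shows "\<exists>p\<in>{1..d}. \<forall>i. d \<le> i \<and> i + p + d < N \<longrightarrow> w i = w (i + p)"
  using assms
proof (induction d arbitrary: N rule: nat_induct_at_least)
  case base
  have "w i = w (Suc i)" if "i + 1 + 1 < N" for i
  proof -
    have "map w [i..<i + 1] \<in> word_factors w N 1" "map w [i + 1..<i + 1 + 1] \<in> word_factors w N 1"
      by (rule word_factorsI; use that in simp)+
    then have "map w [i..<i + 1] = map w [i + 1..<i + 1 + 1]"
      using base finite_word_factors by (metis One_nat_def card_le_Suc0_iff_eq)
    then show ?thesis by simp
  qed
  then show ?case by auto
next
  case (Suc d)
  let ?F = "word_factors w N (Suc d)" and ?F' = "word_factors w (N - 1) d"
  show ?case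
  proof (cases "card ?F' \<le> d")
    \<comment> \<open>The margins grow from \<open>d\<close> to \<open>Suc d\<close>, which absorbs
      the letter lost in passing from \<open>N\<close> to \<open>N - 1\<close>; the period is
      kept.\<close>
    case True
    then obtain p where "p \<in> {1..d}" "\<forall>i. d \<le> i \<and> i + p + d < N - 1 \<longrightarrow> w i = w (i + p)"
      using Suc.IH by blast
    then show ?thesis by (intro bexI[of _ p]) auto
  next
    case False
    show ?thesis
    \<comment> \<open>For smaller \<open>N\<close>, two margins of \<open>Suc d\<close> and a period
      of at least 1 leave no position to check.\<close>
    proof (cases "N \<ge> 2 * d + 3")
      case N: True
      have tk: "take d (map w [i..<i + Suc d]) = map w [i..<i + d]" for i
        by (simp add: take_map)
      have "?F' = take d ` ?F"
        unfolding word_factors_def image_image tk using N by (intro image_cong) auto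
      moreover have "card (take d ` ?F) \<le> card ?F"
        by (rule card_image_le[OF finite_word_factors])
      \<comment> \<open>\<open>?F'\<close> has more than \<open>d\<close> elements and
        \<open>?F\<close> at most \<open>Suc d\<close>, so truncation is a bijection: a window of
        length \<open>d\<close> has only one continuation.\<close>
      ultimately have "card (take d ` ?F) = card ?F" and cF': "card ?F' \<le> Suc d"
        using False Suc.prems by auto
      then have inj: "inj_on (take d) ?F"
        using eq_card_imp_inj_on finite_word_factors by blast
      have next_letter: "w (i + d) = w (j + d)"
        if "map w [i..<i + d] = map w [j..<j + d]" "i + Suc d \<le> N" "j + Suc d \<le> N" for i j
      proof -
        have "map w [i..<i + Suc d] \<in> ?F" "map w [j..<j + Suc d] \<in> ?F"
          by (rule word_factorsI, fact that)+
        moreover have "take d (map w [i..<i + Suc d]) = take d (map w [j..<j + Suc d])"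
          by (simp only: tk that(1))
        ultimately have "map w [i..<i + Suc d] = map w [j..<j + Suc d]"
          by (rule inj_onD[OF inj, rotated])
        then show ?thesis unfolding map_upt_eq_iff by simp
      qed
      \<comment> \<open>There are \<open>d + 2\<close> starting positions but at most
        \<open>d + 1\<close> factors, so two windows agree.\<close>
      have "(\<lambda>i. map w [i..<i + d]) ` {0..Suc d} \<subseteq> ?F'"
        unfolding word_factors_def using N by (intro image_mono) auto
      then have "card ((\<lambda>i. map w [i..<i + d]) ` {0..Suc d}) \<le> Suc d"
        by (rule le_trans[OF card_mono[OF finite_word_factors] cF'])
      then have "\<not> inj_on (\<lambda>i. map w [i..<i + d]) {0..Suc d}"
        using pigeonhole[of "\<lambda>i. map w [i..<i + d]" "{0..Suc d}"] by simp
      then obtain i j where ij: "i < j" "j \<le> Suc d" "map w [i..<i + d] = map w [j..<j + d]"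
        unfolding inj_on_def by (metis (no_types, lifting) atLeastAtMost_iff linorder_neqE_nat)
      \<comment> \<open>A window determines its next letter, so the coincidence at \<open>i\<close>
        and \<open>j\<close> persists under shifting, and \<open>j - i\<close> becomes a
        period.\<close>
      have rep: "map w [i + m..<i + m + d] = map w [j + m..<j + m + d]" if "j + m + d \<le> N" for m
        using that
      proof (induction m)
        case 0
        then show ?case using ij by simp
      next
        case (Suc m)
        then have eq: "map w [i + m..<i + m + d] = map w [j + m..<j + m + d]" by simp
        then have "w (i + m + d) = w (j + m + d)"
          using next_letter[of "i + m" "j + m"] Suc.prems ij by simp
        then have *: "w (i + m + l) = w (j + m + l)" if "l < Suc d" for l
          using eq that unfolding map_upt_eq_iff less_Suc_eq by auto
        have "w (i + Suc m + l) = w (j + Suc m + l)" if "l < d" for l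
          using *[of "Suc l"] that by simp
        then show ?case unfolding map_upt_eq_iff by blast
      qed
      have "w t = w (t + (j - i))" if "Suc d \<le> t" "t + (j - i) + Suc d < N" for t
      proof -
        have "i \<le> t" using ij that by simp
        have "\<forall>l<d. w (i + (t - i) + l) = w (j + (t - i) + l)"
          using rep[of "t - i"] that ij \<open>i \<le> t\<close> unfolding map_upt_eq_iff by simp
        from this[rule_format, of 0] have "w (i + (t - i)) = w (j + (t - i))"
          using Suc.hyps by simp
        then show ?thesis using ij \<open>i \<le> t\<close> by (simp add: algebra_simps)
      qed
      then show ?thesis using ij by (intro bexI[of _ "j - i"]) auto
    qed auto
  qed
qed

text \<open>A word of a factorial language with at most \<open>d\<close> words of length \<open>d\<close> is determined by its
  period and a bounded number of letters at both ends.\<close>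

lemma factorial_language_bounded:
  fixes W :: "'x list set"
  assumes fin: "finite A" and alph: "\<And>w. w \<in> W \<Longrightarrow> set w \<subseteq> A"
    and fact: "\<And>u v t. u @ v @ t \<in> W \<Longrightarrow> v \<in> W"
    and d: "d \<ge> 1" "card {w \<in> W. length w = d} \<le> d"
  shows "\<exists>B. \<forall>n. card {w \<in> W. length w = n} \<le> B"
proof -
  let ?L = "{l. set l \<subseteq> A \<and> length l \<le> 2 * d}"
  let ?E = "{1..d} \<times> ?L \<times> ?L"
  have finL: "finite ?L" using finite_lists_length_le[OF fin] by simp
  have finW: "finite {w \<in> W. length w = d}"
    by (rule finite_subset[OF _ finite_lists_length_le[OF fin, of d]]) (use alph in auto)
  let ?per = "\<lambda>(w :: 'x list) p. p \<in> {1..d} \<and> (\<forall>i. d \<le> i \<and> i + p + d < length w \<longrightarrow> w ! i = w ! (i + p))"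
  have per: "\<exists>p. ?per w p" if w: "w \<in> W" for w
  proof -
    have "word_factors (\<lambda>i. w ! i) (length w) d \<subseteq> {w \<in> W. length w = d}"
    proof
      fix v assume "v \<in> word_factors (\<lambda>i. w ! i) (length w) d"
      then obtain i where i: "i + d \<le> length w" "v = map ((!) w) [i..<i + d]"
        unfolding word_factors_def by auto
      then have "v = take d (drop i w)"
        by (intro nth_equalityI) auto
      then have "w = take i w @ v @ drop d (drop i w)" by (simp only: append_take_drop_id)
      then have "v \<in> W" using fact w by metis
      then show "v \<in> {w \<in> W. length w = d}" using i by simp
    qed
    then have "card (word_factors (\<lambda>i. w ! i) (length w) d) \<le> d"
      by (rule le_trans[OF card_mono[OF finW] d(2)])
    then show ?thesis using middle_periodic[OF d(1)] by blast
  qed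
  define p where "p = (\<lambda>w. SOME p. ?per w p)"
  have p: "?per w (p w)" if "w \<in> W" for w
    using someI_ex[OF per[OF that]] unfolding p_def .
  have "card {w \<in> W. length w = n} \<le> card ?E" for n
  proof -
    \<comment> \<open>From position \<open>2 * d\<close> on, stepping back by a period of at most
      \<open>d\<close> stays at indices where the period is known to apply. The last
      \<open>d\<close> letters are beyond its reach and are recorded separately.\<close>
    let ?f = "\<lambda>w. (p w, take (2 * d) w, drop (n - d) w)"
    have "inj_on ?f {w \<in> W. length w = n}"
    proof (rule inj_onI)
      fix u v assume u: "u \<in> {w \<in> W. length w = n}" and v: "v \<in> {w \<in> W. length w = n}"
        and e: "?f u = ?f v"
      have pu: "?per u (p u)" and pv: "?per v (p u)" using p[of u] p[of v] u v e by auto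
      have "u ! j = v ! j" if "j < n" for j
        using that
      proof (induction j rule: less_induct)
        case (less j)
        consider "j < 2 * d" | "n \<le> j + d" | "2 * d \<le> j" "j + d < n" by linarith
        then show ?case
        proof cases
          case 1
          then have "take (2 * d) u ! j = u ! j" "take (2 * d) v ! j = v ! j" by auto
          then show ?thesis using e by simp
        next
          case 2
          then have "drop (n - d) u ! (j - (n - d)) = u ! j" "drop (n - d) v ! (j - (n - d)) = v ! j"
            using u v less.prems by auto
          then show ?thesis using e by simp
        next
          case 3
          let ?i = "j - p u"
          have pd: "p u \<ge> 1" "p u \<le> d" using pu by auto
          have "d \<le> ?i \<and> ?i + p u + d < n" using 3 pd by auto
          then have "u ! ?i = u ! (?i + p u)" "v ! ?i = v ! (?i + p u)"
            using pu pv u v by auto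
          moreover have "?i + p u = j" "?i < j" using pd 3 by auto
          ultimately show ?thesis using less.IH[of ?i] less.prems by auto
        qed
      qed
      then show "u = v" using u v by (intro nth_equalityI) auto
    qed
    moreover have "?f ` {w \<in> W. length w = n} \<subseteq> ?E"
    proof (rule image_subsetI)
      fix w assume w: "w \<in> {w \<in> W. length w = n}"
      then have "set w \<subseteq> A" using alph by auto
      moreover have "set (take (2 * d) w) \<subseteq> set w" "set (drop (n - d) w) \<subseteq> set w"
        by (rule set_take_subset set_drop_subset)+
      ultimately show "?f w \<in> ?E" using p[of w] w by auto
    qed
    moreover have "finite ?E" using finL by simp
    ultimately show ?thesis by (rule card_inj_on_le)
  qed
  then show ?thesis by blast
qed

section \<open>Words in a generating set\<close>

definition words :: "('a, 'b) ring_scheme \<Rightarrow> 'a set \<Rightarrow> nat \<Rightarrow> 'a set" where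
  "words R S n = {word_value R xs | xs. set xs \<subseteq> S \<and> length xs \<le> n}"

lemma words_mono: "S \<subseteq> T \<Longrightarrow> m \<le> n \<Longrightarrow> words R S m \<subseteq> words R T n"
  unfolding words_def by fastforce

lemma finite_words: "finite S \<Longrightarrow> finite (words R S n)"
proof -
  assume "finite S"
  have "words R S n = word_value R ` {xs. set xs \<subseteq> S \<and> length xs \<le> n}"
    unfolding words_def by blast
  then show ?thesis using finite_lists_length_le[OF \<open>finite S\<close>] by simp
qed

context k_algebra
begin

lemma word_value_closed: "set xs \<subseteq> carrier R \<Longrightarrow> word_value R xs \<in> carrier R"
  unfolding word_value_def by (induction xs) auto

lemma word_value_Nil [simp]: "word_value R [] = \<one>\<^bsub>R\<^esub>"
  by (simp add: word_value_def)

lemma word_value_Cons [simp]: "word_value R (x # xs) = x \<otimes>\<^bsub>R\<^esub> word_value R xs"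
  by (simp add: word_value_def)

lemma word_value_append:
  "set xs \<subseteq> carrier R \<Longrightarrow> set ys \<subseteq> carrier R \<Longrightarrow>
    word_value R (xs @ ys) = word_value R xs \<otimes>\<^bsub>R\<^esub> word_value R ys"
  by (induction xs) (auto simp: word_value_closed R.m_assoc)

lemma words_closed: "S \<subseteq> carrier R \<Longrightarrow> words R S n \<subseteq> carrier R"
  unfolding words_def using word_value_closed by blast

lemma one_in_words: "\<one>\<^bsub>R\<^esub> \<in> words R S n"
  unfolding words_def by (intro CollectI exI[of _ "[]"]) simp

lemma letter_in_words:
  assumes "S \<subseteq> carrier R" "s \<in> S" "1 \<le> n" shows "s \<in> words R S n"
proof -
  have "word_value R [s] = s" using assms by auto
  then show ?thesis unfolding words_def using assms by (intro CollectI exI[of _ "[s]"]) auto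
qed

lemma words_mult:
  assumes "S \<subseteq> carrier R" "u \<in> words R S m" "v \<in> words R S n"
  shows "u \<otimes>\<^bsub>R\<^esub> v \<in> words R S (m + n)"
proof -
  obtain xs ys where "set xs \<subseteq> S" "length xs \<le> m" "u = word_value R xs"
    "set ys \<subseteq> S" "length ys \<le> n" "v = word_value R ys"
    using assms unfolding words_def by blast
  then show ?thesis using assms(1) word_value_append[of xs ys] unfolding words_def
    by (intro CollectI exI[of _ "xs @ ys"]) auto
qed

section \<open>Multiplication and spans\<close>

lemma submodule_vimage_rmult:
  assumes "submodule K N R" "a \<in> carrier R"
  shows "submodule K {x \<in> carrier R. x \<otimes>\<^bsub>R\<^esub> a \<in> N} R"
proof (rule submoduleI)
  show "\<zero>\<^bsub>R\<^esub> \<in> {x \<in> carrier R. x \<otimes>\<^bsub>R\<^esub> a \<in> N}"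
    using assms submodule.zero_closed by fastforce
qed (use assms in \<open>auto simp: R.l_distr smult_mult_left submodule.m_closed submodule.smult_closed\<close>)

lemma submodule_vimage_lmult:
  assumes "submodule K N R" "a \<in> carrier R"
  shows "submodule K {x \<in> carrier R. a \<otimes>\<^bsub>R\<^esub> x \<in> N} R"
proof (rule submoduleI)
  show "\<zero>\<^bsub>R\<^esub> \<in> {x \<in> carrier R. a \<otimes>\<^bsub>R\<^esub> x \<in> N}"
    using assms submodule.zero_closed by fastforce
qed (use assms in \<open>auto simp: R.r_distr smult_mult_right submodule.m_closed submodule.smult_closed\<close>)

lemma submodule_image_rmult:
  assumes N: "submodule K N R" and a: "a \<in> carrier R"
  shows "submodule K ((\<lambda>u. u \<otimes>\<^bsub>R\<^esub> a) ` N) R"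
proof (rule submoduleI)
  let ?f = "\<lambda>u. u \<otimes>\<^bsub>R\<^esub> a"
  have c: "N \<subseteq> carrier R" using N submodule.subset by blast
  show "?f ` N \<subseteq> carrier R" using c a by auto
  have "\<zero>\<^bsub>R\<^esub> = ?f \<zero>\<^bsub>R\<^esub>" using a by simp
  then show "\<zero>\<^bsub>R\<^esub> \<in> ?f ` N" using submodule.zero_closed[OF N] by (rule image_eqI)
  show "v \<oplus>\<^bsub>R\<^esub> w \<in> ?f ` N" if vw: "v \<in> ?f ` N" "w \<in> ?f ` N" for v w
  proof -
    from vw obtain x y where xy: "x \<in> N" "y \<in> N" "v = ?f x" "w = ?f y" by blast
    then have "x \<in> carrier R" "y \<in> carrier R" using c by auto
    then have "v \<oplus>\<^bsub>R\<^esub> w = ?f (x \<oplus>\<^bsub>R\<^esub> y)" using a xy by (simp add: R.l_distr)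
    then show ?thesis using submodule.m_closed[OF N xy(1,2)] by (rule image_eqI)
  qed
  show "d \<odot>\<^bsub>R\<^esub> v \<in> ?f ` N" if d: "d \<in> carrier K" and v: "v \<in> ?f ` N" for d v
  proof -
    from v obtain x where x: "x \<in> N" "v = ?f x" by blast
    then have "d \<odot>\<^bsub>R\<^esub> v = ?f (d \<odot>\<^bsub>R\<^esub> x)" using a c d smult_mult_left[of d x a] by auto
    then show ?thesis using submodule.smult_closed[OF N d x(1)] by (rule image_eqI)
  qed
qed

text \<open>The preimage of \<open>N\<close> under right multiplication by \<open>a\<close> is a
  subspace, so it suffices to test spanning elements. This replaces computation with linear
  combinations.\<close>

lemma span_rmult:
  assumes "x \<in> sp A" "A \<subseteq> carrier R" "a \<in> carrier R" "submodule K N R"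
    and "\<And>y. y \<in> A \<Longrightarrow> y \<otimes>\<^bsub>R\<^esub> a \<in> N"
  shows "x \<otimes>\<^bsub>R\<^esub> a \<in> N"
  using span_minimal[OF _ submodule_vimage_rmult[OF assms(4,3)], of A] assms by blast

lemma span_lmult:
  assumes "x \<in> sp A" "A \<subseteq> carrier R" "a \<in> carrier R" "submodule K N R"
    and "\<And>y. y \<in> A \<Longrightarrow> a \<otimes>\<^bsub>R\<^esub> y \<in> N"
  shows "a \<otimes>\<^bsub>R\<^esub> x \<in> N"
  using span_minimal[OF _ submodule_vimage_lmult[OF assms(4,3)], of A] assms by blast

lemma span_words_mult:
  assumes S: "S \<subseteq> carrier R" and x: "x \<in> sp (words R S m)" and y: "y \<in> sp (words R S n)"
  shows "x \<otimes>\<^bsub>R\<^esub> y \<in> sp (words R S (m + n))"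
proof (rule span_rmult[OF x words_closed[OF S]])
  show "y \<in> carrier R" using span_closed[OF words_closed[OF S] y] .
  show sm: "submodule K (sp (words R S (m + n))) R"
    by (rule V.span_is_submodule[OF words_closed[OF S]])
  fix u assume u: "u \<in> words R S m"
  show "u \<otimes>\<^bsub>R\<^esub> y \<in> sp (words R S (m + n))"
  proof (rule span_lmult[OF y words_closed[OF S] _ sm])
    show "u \<in> carrier R" using u words_closed[OF S] by blast
    show "u \<otimes>\<^bsub>R\<^esub> v \<in> sp (words R S (m + n))" if "v \<in> words R S n" for v
      using words_mult[OF S u that] span_base[OF words_closed[OF S]] by blast
  qed
qed

text \<open>A product of \<open>n\<close> combinations of words of length at most \<open>r\<close>
  expands into words of length at most \<open>r * n\<close>. Hence a change of generators only
  rescales the length.\<close>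

lemma words_of_span:
  assumes S: "S \<subseteq> carrier R" and T: "T \<subseteq> sp (words R S r)"
  shows "words R T n \<subseteq> sp (words R S (r * n))"
proof -
  have "word_value R xs \<in> sp (words R S (r * length xs))" if "set xs \<subseteq> T" for xs
    using that
  proof (induction xs)
    case Nil
    then show ?case using one_in_words span_base[OF words_closed[OF S]] by simp
  next
    case (Cons x xs)
    then have "x \<otimes>\<^bsub>R\<^esub> word_value R xs \<in> sp (words R S (r + r * length xs))"
      using span_words_mult[OF S] T by auto
    then show ?case by simp
  qed
  moreover have "sp (words R S (r * m)) \<subseteq> sp (words R S (r * n))" if "m \<le> n" for m
    using that by (intro span_mono words_mono) auto
  ultimately show ?thesis unfolding words_def by blast
qed

lemma sp_subset_words:
  assumes "S \<subseteq> carrier R" shows "sp S \<subseteq> sp (words R S 1)"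
  using letter_in_words[OF assms] by (intro span_mono) auto

text \<open>\<open>GKdim\<close> takes words in a whole subspace, in general an infinite alphabet;
  multilinearity reduces them to words in a finite spanning set.\<close>

lemma span_words_sp:
  assumes S: "S \<subseteq> carrier R"
  shows "sp (words R (sp S) n) = sp (words R S n)"
proof
  show "sp (words R (sp S) n) \<subseteq> sp (words R S n)"
    using words_of_span[OF S sp_subset_words[OF S], of n] span_subsetI[OF _ words_closed[OF S]]
    by simp
  show "sp (words R S n) \<subseteq> sp (words R (sp S) n)"
    using V.in_own_span[OF S] by (intro span_mono words_mono) auto
qed

lemma growth_alt: "growth K R V n = vectorspace.dim K (R\<lparr>carrier := sp (words R V n)\<rparr>)"
  unfolding growth_def words_def ..

lemma growth_ge:
  assumes "S \<subseteq> carrier R" "finite S" "set fs \<subseteq> sp (words R S n)" "indep {} fs"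
  shows "length fs \<le> growth K R (sp S) n"
  unfolding growth_alt span_words_sp[OF assms(1)]
  using assms finite_words words_closed by (intro dim_span_ge[of _ "words R S n"]) auto

text \<open>\<open>G\<close> may span more than the words do, whereas \<open>dim_span_le\<close>
  wants equal spans. A maximal independent list of words mediates between the two.\<close>

lemma growth_le:
  assumes "S \<subseteq> carrier R" "finite S" "words R S n \<subseteq> sp G" "finite G" "G \<subseteq> carrier R"
  shows "growth K R (sp S) n \<le> card G"
proof -
  let ?W = "words R S n"
  have W: "?W \<subseteq> carrier R" "finite ?W" using words_closed finite_words assms by auto
  obtain fs where fs: "set fs \<subseteq> ?W" "indep {} fs" "?W \<subseteq> sp ({} \<union> set fs)"
    using indep_maximal[of ?W "{}" ?W] W V.in_own_span[OF W(1)] by auto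
  have "sp ?W = sp (set fs)"
    using fs W span_mono[OF fs(1)] span_subsetI[of ?W "set fs"] by auto
  then have "vectorspace.dim K (R\<lparr>carrier := sp ?W\<rparr>) \<le> card (set fs)"
    using fs W by (intro dim_span_le) auto
  also have "\<dots> \<le> length fs" by (rule card_length)
  also have "\<dots> \<le> card G"
    using indep_length_le[of G fs "{}"] fs assms by auto
  finally show ?thesis unfolding growth_alt span_words_sp[OF assms(1)] .
qed

definition generates :: "'a set \<Rightarrow> bool" where
  "generates S \<longleftrightarrow> finite S \<and> S \<subseteq> carrier R \<and> (\<forall>x\<in>carrier R. \<exists>n. x \<in> sp (words R S n))"

text \<open>The spans of words form an increasing multiplicative filtration, so their union is a
  subalgebra containing \<open>S\<close> and hence is everything.\<close>

lemma affine_generates: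
  assumes "affine_algebra K R" shows "\<exists>S. generates S"
proof -
  obtain S where S: "finite S" "S \<subseteq> carrier R" and gen: "\<And>B. subring B R \<Longrightarrow>
      (\<forall>c\<in>carrier K. \<forall>b\<in>B. c \<odot>\<^bsub>R\<^esub> b \<in> B) \<Longrightarrow> S \<subseteq> B \<Longrightarrow> B = carrier R"
    using assms unfolding affine_algebra_def by metis
  let ?B = "\<Union>n. sp (words R S n)"
  have W: "words R S n \<subseteq> carrier R" for n using words_closed[OF S(2)] .
  have sm: "submodule K (sp (words R S n)) R" for n using V.span_is_submodule[OF W] .
  have mono: "x \<in> sp (words R S (m + n))" if "x \<in> sp (words R S m) \<or> x \<in> sp (words R S n)" for m n x
    using that span_mono[OF words_mono[OF order_refl, of _ "m + n"]] le_add1 le_add2 by blast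
  have "?B = carrier R"
  proof (rule gen)
    show "subring ?B R"
    proof (rule R.subringI)
      show "?B \<subseteq> carrier R" using span_closed[OF W] by blast
      show "\<one>\<^bsub>R\<^esub> \<in> ?B" using span_base[OF W one_in_words] by blast
      show "\<ominus>\<^bsub>R\<^esub> h \<in> ?B" if "h \<in> ?B" for h using that submodule_neg[OF sm] by blast
      fix h1 h2 assume "h1 \<in> ?B" "h2 \<in> ?B"
      then obtain m n where mn: "h1 \<in> sp (words R S m)" "h2 \<in> sp (words R S n)" by blast
      show "h1 \<otimes>\<^bsub>R\<^esub> h2 \<in> ?B" using span_words_mult[OF S(2) mn] by blast
      have "h1 \<oplus>\<^bsub>R\<^esub> h2 \<in> sp (words R S (m + n))" using mono mn span_add[OF W] by blast
      then show "h1 \<oplus>\<^bsub>R\<^esub> h2 \<in> ?B" by blast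
    qed
    show "\<forall>c\<in>carrier K. \<forall>b\<in>?B. c \<odot>\<^bsub>R\<^esub> b \<in> ?B" using span_smult[OF W] by blast
    show "S \<subseteq> ?B" using letter_in_words[OF S(2)] span_base[OF W] by blast
  qed
  then show ?thesis unfolding generates_def using S by blast
qed

lemma generates_subset_words:
  assumes "generates S" "finite F" "F \<subseteq> carrier R"
  shows "\<exists>r. F \<subseteq> sp (words R S r)"
  using assms(2,3)
proof (induction F rule: finite_induct)
  case (insert x F)
  then obtain r where r: "F \<subseteq> sp (words R S r)" by auto
  obtain n where n: "x \<in> sp (words R S n)" using assms(1) insert.prems unfolding generates_def by auto
  have "sp (words R S r) \<subseteq> sp (words R S (r + n))" "sp (words R S n) \<subseteq> sp (words R S (r + n))"
    by (intro span_mono words_mono; simp)+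
  then show ?case using r n by blast
qed auto

section \<open>Bergman's gap\<close>

lemma one_smult_mult:
  assumes "c \<in> carrier K" "x \<in> carrier R"
  shows "c \<odot>\<^bsub>R\<^esub> x = (c \<odot>\<^bsub>R\<^esub> \<one>\<^bsub>R\<^esub>) \<otimes>\<^bsub>R\<^esub> x"
  using assms by (simp add: smult_mult_left)

lemma left_ideal_closed:
  assumes "left_ideal L R"
  shows "L \<subseteq> carrier R" "\<zero>\<^bsub>R\<^esub> \<in> L"
    and "\<And>x y. x \<in> L \<Longrightarrow> y \<in> L \<Longrightarrow> x \<oplus>\<^bsub>R\<^esub> y \<in> L"
    and "\<And>r x. r \<in> carrier R \<Longrightarrow> x \<in> L \<Longrightarrow> r \<otimes>\<^bsub>R\<^esub> x \<in> L"
  using assms unfolding left_ideal_def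
  by (auto simp: additive_subgroup.a_subset additive_subgroup.zero_closed additive_subgroup.a_closed)

lemma left_ideal_submodule:
  assumes "left_ideal L R" shows "submodule K L R"
proof (rule submoduleI)
  show "c \<odot>\<^bsub>R\<^esub> v \<in> L" if "c \<in> carrier K" "v \<in> L" for c v
    using that left_ideal_closed[OF assms] one_smult_mult[of c v] by auto
qed (use left_ideal_closed[OF assms] in auto)

lemma ideal_left_ideal: "ideal I R \<Longrightarrow> left_ideal I R"
  unfolding left_ideal_def using ideal.I_l_closed by (simp add: ideal.axioms(1) ideal.I_l_closed)

lemma ideal_carrier: "ideal I R \<Longrightarrow> I \<subseteq> carrier R"
  by (rule left_ideal_closed(1)[OF ideal_left_ideal])

lemma ideal_submodule: "ideal I R \<Longrightarrow> submodule K I R"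
  by (rule left_ideal_submodule[OF ideal_left_ideal])

section \<open>Normal words of \<open>R / U\<close> in the degree-lexicographic order\<close>

context
  fixes g :: "nat \<Rightarrow> 'a" and k :: nat and U :: "'a set"
  assumes g: "g ` {..<k} \<subseteq> carrier R" and U: "ideal U R"
begin

text \<open>Words are written in the indices of the generators, because \<open>lenlex\<close> needs
  an order on the letters.\<close>

definition val :: "nat list \<Rightarrow> 'a" where
  "val w = word_value R (map g w)"

definition smaller :: "nat list \<Rightarrow> nat list set" where
  "smaller w = {v. (v, w) \<in> lenlex less_than \<and> set v \<subseteq> {..<k}}"

text \<open>These are the irreducible words of noncommutative Groebner theory; modulo
  \<open>U\<close> their values form a basis of the span of all words.\<close>

definition normal :: "nat list set" where
  "normal = {w. set w \<subseteq> {..<k} \<and> val w \<notin> sp (U \<union> val ` smaller w)}"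

lemma val_closed: "set w \<subseteq> {..<k} \<Longrightarrow> val w \<in> carrier R"
  unfolding val_def by (rule word_value_closed) (use g in auto)

lemma val_append:
  assumes "set u \<subseteq> {..<k}" "set v \<subseteq> {..<k}"
  shows "val (u @ v) = val u \<otimes>\<^bsub>R\<^esub> val v"
proof -
  have *: "set (map g w) \<subseteq> carrier R" if "set w \<subseteq> {..<k}" for w using that g by auto
  show ?thesis unfolding val_def map_append
    by (rule word_value_append[OF *[OF assms(1)] *[OF assms(2)]])
qed

lemma U_carrier: "U \<subseteq> carrier R"
  by (rule ideal_carrier[OF U])

lemma U_val_carrier: "A \<subseteq> {w. set w \<subseteq> {..<k}} \<Longrightarrow> U \<union> val ` A \<subseteq> carrier R"
  using U_carrier val_closed by blast

lemma smaller_words: "smaller w \<subseteq> {w. set w \<subseteq> {..<k}}"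
  unfolding smaller_def by blast

lemma lenlex_context:
  assumes "(v', v) \<in> lenlex less_than" shows "(u @ v' @ t, u @ v @ t) \<in> lenlex less_than"
proof -
  have "irrefl less_than" by (simp add: irrefl_def)
  then show ?thesis using lenlex_append1[OF assms, of t t] by simp
qed

text \<open>A reduction of \<open>v\<close> can be multiplied by \<open>u\<close> and
  \<open>t\<close>, since the order respects concatenation on both sides and \<open>U\<close> is
  two-sided. So the normal words form a factorial language, to which
  \<open>factorial_language_bounded\<close> applies.\<close>

lemma normal_factor:
  assumes "u @ v @ t \<in> normal" shows "v \<in> normal"
proof (rule ccontr)
  assume nv: "v \<notin> normal"
  let ?w = "u @ v @ t"
  have sets: "set u \<subseteq> {..<k}" "set v \<subseteq> {..<k}" "set t \<subseteq> {..<k}"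
    using assms unfolding normal_def by auto
  then have v: "val v \<in> sp (U \<union> val ` smaller v)" using nv unfolding normal_def by auto
  let ?N = "sp (U \<union> val ` smaller ?w)"
  have Nc: "U \<union> val ` smaller ?w \<subseteq> carrier R" using U_val_carrier smaller_words by blast
  have N: "submodule K ?N R" using V.span_is_submodule[OF Nc] .
  let ?N' = "{x \<in> carrier R. x \<otimes>\<^bsub>R\<^esub> val t \<in> ?N}"
  have N': "submodule K ?N' R" using submodule_vimage_rmult[OF N] val_closed sets by blast
  have "val u \<otimes>\<^bsub>R\<^esub> val v \<in> ?N'"
  proof (rule span_lmult[OF v _ _ N'])
    show "U \<union> val ` smaller v \<subseteq> carrier R" using U_val_carrier smaller_words by blast
    show "val u \<in> carrier R" using val_closed sets by blast
    fix y assume "y \<in> U \<union> val ` smaller v"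
    then show "val u \<otimes>\<^bsub>R\<^esub> y \<in> ?N'"
    proof
      assume y: "y \<in> U"
      then have "val u \<otimes>\<^bsub>R\<^esub> y \<in> U" "val u \<otimes>\<^bsub>R\<^esub> y \<otimes>\<^bsub>R\<^esub> val t \<in> U"
        using U val_closed sets by (simp_all add: ideal.I_l_closed ideal.I_r_closed)
      then show ?thesis using U_carrier span_base[OF Nc] by blast
    next
      assume "y \<in> val ` smaller v"
      then obtain v' where v': "y = val v'" "(v', v) \<in> lenlex less_than" "set v' \<subseteq> {..<k}"
        unfolding smaller_def by blast
      then have "u @ v' @ t \<in> smaller ?w" unfolding smaller_def using lenlex_context sets by auto
      then have "val (u @ v' @ t) \<in> ?N" using span_base[OF Nc] by blast
      then have "val u \<otimes>\<^bsub>R\<^esub> y \<otimes>\<^bsub>R\<^esub> val t \<in> ?N"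
        using val_append sets v' val_closed by (simp add: R.m_assoc)
      then show ?thesis using val_closed sets v' by simp
    qed
  qed
  then have "val ?w \<in> ?N" using val_append sets val_closed by (simp add: R.m_assoc)
  then show False using assms unfolding normal_def by blast
qed

text \<open>Well-founded rewriting of words that are not normal by smaller ones. The order compares
  lengths first, so the length bound survives.\<close>

lemma val_in_span_normal:
  assumes "set w \<subseteq> {..<k}"
  shows "val w \<in> sp (U \<union> val ` {v \<in> normal. length v \<le> length w})"
  using assms
proof (induction w rule: wf_induct_rule[OF wf_lenlex[OF wf_less_than]])
  case (1 w)
  let ?G = "U \<union> val ` {v \<in> normal. length v \<le> length w}"
  have Gc: "?G \<subseteq> carrier R" by (rule U_val_carrier) (auto simp: normal_def)
  show ?case
  proof (cases "w \<in> normal")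
    case True
    then show ?thesis using span_base[OF Gc] by blast
  next
    case False
    have "val v \<in> sp ?G" if v: "v \<in> smaller w" for v
    proof -
      have "val v \<in> sp (U \<union> val ` {u \<in> normal. length u \<le> length v})"
        using 1(1)[of v] v unfolding smaller_def by blast
      moreover have "length v \<le> length w" using v lenlex_length unfolding smaller_def by blast
      ultimately show ?thesis
        using span_mono[of "U \<union> val ` {u \<in> normal. length u \<le> length v}" ?G] by force
    qed
    then have "sp (U \<union> val ` smaller w) \<subseteq> sp ?G"
      using span_base[OF Gc] by (intro span_subsetI[OF _ Gc]) blast
    then show ?thesis using False 1(2) unfolding normal_def by blast
  qed
qed

text \<open>Listing the words in increasing order gives the triangular form directly: each value
  avoids the span of \<open>U\<close> and of all smaller values.\<close>

lemma normal_indep: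
  assumes "finite Z" "Z \<subseteq> normal"
  shows "\<exists>fs. set fs = val ` Z \<and> length fs = card Z \<and> indep U fs"
  using assms
proof (induction "card Z" arbitrary: Z)
  case 0
  then show ?case by (intro exI[of _ "[]"]) auto
next
  case (Suc m)
  have tr: "transp_on Z (\<lambda>x y. (x, y) \<in> lenlex less_than)"
    by (intro transp_onI) (meson lenlex_trans trans_less_than transD)
  have tot: "totalp_on Z (\<lambda>x y. (x, y) \<in> lenlex less_than)"
    using total_lenlex[OF total_less_than] by (intro totalp_onI) (auto simp: total_on_def)
  have "Z \<noteq> {}" using Suc.hyps(2) by auto
  then obtain w where w: "w \<in> Z" "\<And>v. v \<in> Z \<Longrightarrow> v \<noteq> w \<Longrightarrow> (v, w) \<in> lenlex less_than"
    using Finite_Set.bex_greatest_element[OF Suc.prems(1) _ tr tot] by blast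
  have "card (Z - {w}) = m" using Suc w by simp
  then obtain fs where fs: "set fs = val ` (Z - {w})" "length fs = m" "indep U fs"
    using Suc.hyps(1)[of "Z - {w}"] Suc.prems by auto
  have "Z - {w} \<subseteq> smaller w" using w Suc.prems unfolding smaller_def normal_def by blast
  then have "sp (U \<union> set fs) \<subseteq> sp (U \<union> val ` smaller w)"
    unfolding fs by (intro span_mono) blast
  moreover have "val w \<notin> sp (U \<union> val ` smaller w)" using w Suc.prems unfolding normal_def by blast
  ultimately have "indep U (fs @ [val w])" using fs by (auto simp: indep_append)
  moreover have "set (fs @ [val w]) = val ` Z" using fs w by auto
  ultimately show ?case using fs Suc.hyps(2) by (intro exI[of _ "fs @ [val w]"]) auto
qed

lemma words_eq_val: "words R (g ` {..<k}) n = val ` {w. set w \<subseteq> {..<k} \<and> length w \<le> n}"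
proof
  show "words R (g ` {..<k}) n \<subseteq> val ` {w. set w \<subseteq> {..<k} \<and> length w \<le> n}"
  proof
    fix x assume "x \<in> words R (g ` {..<k}) n"
    then obtain xs where xs: "x = word_value R xs" "set xs \<subseteq> g ` {..<k}" "length xs \<le> n"
      unfolding words_def by blast
    then have "xs \<in> lists (g ` {..<k})" by (auto simp: in_lists_conv_set)
    then have "xs \<in> map g ` lists {..<k}" by (simp only: lists_image)
    then show "x \<in> val ` {w. set w \<subseteq> {..<k} \<and> length w \<le> n}"
      using xs unfolding val_def lists_eq_set by auto
  qed
  show "val ` {w. set w \<subseteq> {..<k} \<and> length w \<le> n} \<subseteq> words R (g ` {..<k}) n"
    unfolding val_def words_def by fastforce
qed

lemma finite_normal: "finite {w \<in> normal. length w \<le> n}"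
  by (rule finite_subset[OF _ finite_lists_length_le[of "{..<k}" n]]) (auto simp: normal_def)

text \<open>The dividing line is whether some length \<open>d \<ge> 1\<close> has at most
  \<open>d\<close> normal words. If so, the number per length is bounded; if not, summing at least
  \<open>d + 1\<close> over all lengths is quadratic.\<close>

lemma normal_gap:
  "(\<exists>B. \<forall>n. card {w \<in> normal. length w \<le> n} \<le> B * (n + 1)) \<or>
   (\<forall>n. n * n \<le> 2 * card {w \<in> normal. length w \<le> n})"
proof -
  let ?c = "\<lambda>n. card {w \<in> normal. length w \<le> n}" and ?e = "\<lambda>n. card {w \<in> normal. length w = n}"
  have fe: "finite {w \<in> normal. length w = n}" for n
    by (rule finite_subset[OF _ finite_normal[of n]]) auto
  have c_Suc: "?c (Suc n) = ?c n + ?e (Suc n)" for n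
  proof -
    have "{w \<in> normal. length w \<le> Suc n}
        = {w \<in> normal. length w \<le> n} \<union> {w \<in> normal. length w = Suc n}" by auto
    moreover have "{w \<in> normal. length w \<le> n} \<inter> {w \<in> normal. length w = Suc n} = {}" by auto
    ultimately show ?thesis using card_Un_disjoint[OF finite_normal fe] by simp
  qed
  show ?thesis
  proof (cases "\<exists>d\<ge>1. ?e d \<le> d")
    case True
    then obtain d where "d \<ge> 1" "?e d \<le> d" by blast
    have "\<exists>B. \<forall>n. ?e n \<le> B"
    proof (rule factorial_language_bounded)
      show "set w \<subseteq> {..<k}" if "w \<in> normal" for w using that unfolding normal_def by blast
    qed (fact normal_factor \<open>d \<ge> 1\<close> \<open>?e d \<le> d\<close> | simp)+
    then obtain B where B: "\<And>n. ?e n \<le> B" by blast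
    have "?c n \<le> B * (n + 1)" for n
    proof (induction n)
      case 0
      then show ?case using B[of 0] by simp
    next
      case (Suc n)
      then show ?case using B[of "Suc n"] c_Suc[of n] by simp
    qed
    then show ?thesis by blast
  next
    case False
    then have e: "?e d \<ge> d + 1" if "d \<ge> 1" for d using that by fastforce
    have "n * n \<le> 2 * ?c n" for n
    proof (induction n)
      case (Suc n)
      then show ?case using e[of "Suc n"] c_Suc[of n] by (simp add: algebra_simps)
    qed simp
    then show ?thesis by blast
  qed
qed

end

text \<open>Bergman's gap for \<open>R / U\<close>: modulo \<open>U\<close>, the values of normal
  words of length at most \<open>n\<close> are a basis of the span of all words of that length, so
  counting normal words measures the growth.\<close>

theorem growth_gap:
  assumes S: "finite S" "S \<subseteq> carrier R" and U: "ideal U R"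
  shows "(\<exists>B. \<forall>n. \<exists>G. finite G \<and> G \<subseteq> words R S n \<and> card G \<le> B * (n + 1) \<and> words R S n \<subseteq> sp (U \<union> G)) \<or>
    (\<forall>n. \<exists>fs. set fs \<subseteq> words R S n \<and> indep U fs \<and> n * n \<le> 2 * length fs)"
proof -
  obtain g where gS: "S = g ` {..<card S}"
    using ex_bij_betw_nat_finite[OF S(1)] unfolding bij_betw_def atLeast0LessThan by metis
  define k where "k = card S"
  have g: "g ` {..<k} \<subseteq> carrier R" using S gS k_def by simp
  have W: "words R S n = val g ` {w. set w \<subseteq> {..<k} \<and> length w \<le> n}" for n
    using words_eq_val[OF g U, of n] gS k_def by simp
  let ?Z = "\<lambda>n. {w \<in> normal g k U. length w \<le> n}"
  have Z: "val g ` ?Z n \<subseteq> words R S n" for n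
    unfolding W by (intro image_mono) (auto simp: normal_def[OF g U])
  have sub: "words R S n \<subseteq> sp (U \<union> val g ` ?Z n)" for n
  proof
    fix x assume "x \<in> words R S n"
    then obtain w where w: "x = val g w" "set w \<subseteq> {..<k}" "length w \<le> n" unfolding W by blast
    have "x \<in> sp (U \<union> val g ` ?Z (length w))" using val_in_span_normal[OF g U w(2)] w(1) by simp
    moreover have "sp (U \<union> val g ` ?Z (length w)) \<subseteq> sp (U \<union> val g ` ?Z n)"
      using w(3) by (intro span_mono) force
    ultimately show "x \<in> sp (U \<union> val g ` ?Z n)" by blast
  qed
  show ?thesis using normal_gap[OF g U]
  proof
    assume "\<exists>B. \<forall>n. card (?Z n) \<le> B * (n + 1)"
    then obtain B where B: "\<And>n. card (?Z n) \<le> B * (n + 1)" by blast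
    have "card (val g ` ?Z n) \<le> B * (n + 1)" for n
      using card_image_le[OF finite_normal[OF g U], of "val g" n] B[of n] by linarith
    then have "\<exists>G. finite G \<and> G \<subseteq> words R S n \<and> card G \<le> B * (n + 1) \<and> words R S n \<subseteq> sp (U \<union> G)" for n
      using Z[of n] sub[of n] finite_normal[OF g U, of n] by (intro exI[of _ "val g ` ?Z n"]) simp
    then show ?thesis by blast
  next
    assume q: "\<forall>n. n * n \<le> 2 * card (?Z n)"
    have "\<exists>fs. set fs \<subseteq> words R S n \<and> indep U fs \<and> n * n \<le> 2 * length fs" for n
    proof -
      obtain fs where "set fs = val g ` ?Z n" "length fs = card (?Z n)" "indep U fs"
        using normal_indep[OF g U finite_normal[OF g U], of n] by auto
      then show ?thesis using Z[of n] q by (intro exI[of _ fs]) auto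
    qed
    then show ?thesis by blast
  qed
qed

text \<open>Every element of \<open>sp W\<close> has the form \<open>u a\<close> with
  \<open>u\<close> in \<open>sp U\<close>, so cancelling \<open>a\<close> turns a relation among the
  images into one among \<open>fs\<close> modulo \<open>U\<close>.\<close>

lemma indep_map_rmult:
  assumes "indep U fs" "set fs \<subseteq> carrier R" "U \<subseteq> carrier R" "a \<in> carrier R"
    and "W \<subseteq> (\<lambda>u. u \<otimes>\<^bsub>R\<^esub> a) ` sp U"
    and inj: "\<And>r. r \<in> carrier R \<Longrightarrow> r \<otimes>\<^bsub>R\<^esub> a = \<zero>\<^bsub>R\<^esub> \<Longrightarrow> r = \<zero>\<^bsub>R\<^esub>"
  shows "indep W (map (\<lambda>f. f \<otimes>\<^bsub>R\<^esub> a) fs)"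
  using assms(1-5)
proof (induction fs arbitrary: U W)
  case (Cons f fs)
  let ?N = "(\<lambda>u. u \<otimes>\<^bsub>R\<^esub> a) ` sp U"
  have c: "sp U \<subseteq> carrier R" using V.span_is_subset2 Cons.prems by blast
  have "submodule K ?N R"
    using submodule_image_rmult[OF V.span_is_submodule] Cons.prems(3,4) by blast
  then have spW: "sp W \<subseteq> ?N" using span_minimal Cons.prems by blast
  have f: "f \<in> carrier R" "f \<notin> sp U" using Cons.prems by auto
  have "f \<otimes>\<^bsub>R\<^esub> a \<notin> sp W"
  proof
    assume "f \<otimes>\<^bsub>R\<^esub> a \<in> sp W"
    then obtain u where u: "u \<in> sp U" "f \<otimes>\<^bsub>R\<^esub> a = u \<otimes>\<^bsub>R\<^esub> a" using spW by blast
    then have "u \<in> carrier R" using c by blast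
    then have "(f \<ominus>\<^bsub>R\<^esub> u) \<otimes>\<^bsub>R\<^esub> a = \<zero>\<^bsub>R\<^esub>"
      using u f Cons.prems by (simp add: a_minus_def R.l_distr R.l_minus V.M.r_neg)
    then have "f = u" using inj[of "f \<ominus>\<^bsub>R\<^esub> u"] f \<open>u \<in> carrier R\<close> by simp
    then show False using f u by simp
  qed
  moreover have "indep (insert (f \<otimes>\<^bsub>R\<^esub> a) W) (map (\<lambda>f. f \<otimes>\<^bsub>R\<^esub> a) fs)"
  proof (rule Cons.IH)
    have fU: "insert f U \<subseteq> carrier R" using f Cons.prems by auto
    have "sp U \<subseteq> sp (insert f U)" by (intro span_mono) auto
    show "insert (f \<otimes>\<^bsub>R\<^esub> a) W \<subseteq> (\<lambda>u. u \<otimes>\<^bsub>R\<^esub> a) ` sp (insert f U)"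
    proof (rule insert_subsetI)
      show "f \<otimes>\<^bsub>R\<^esub> a \<in> (\<lambda>u. u \<otimes>\<^bsub>R\<^esub> a) ` sp (insert f U)"
        by (rule imageI) (simp add: span_base[OF fU])
      show "W \<subseteq> (\<lambda>u. u \<otimes>\<^bsub>R\<^esub> a) ` sp (insert f U)"
        using Cons.prems(5) \<open>sp U \<subseteq> sp (insert f U)\<close> by (meson image_mono order_trans)
    qed
  qed (use Cons.prems in auto)
  ultimately show ?case by simp
qed simp

text \<open>Each factor of \<open>R \<supseteq> R c \<supseteq> R c\<^sup>2 \<supseteq> \<dots>\<close> surjects onto \<open>R / U\<close>.\<close>

lemma indep_power_blocks:
  assumes S: "S \<subseteq> carrier R" "c \<in> S" and U: "ideal U R" "c \<in> U"
    and reg: "\<And>r. r \<in> carrier R \<Longrightarrow> r \<otimes>\<^bsub>R\<^esub> c = \<zero>\<^bsub>R\<^esub> \<Longrightarrow> r = \<zero>\<^bsub>R\<^esub>"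
    and fs: "indep U fs" "set fs \<subseteq> words R S n"
  shows "\<exists>hs. set hs \<subseteq> words R S (2 * n) \<and> indep {} hs \<and> length hs = (n + 1) * length fs"
proof -
  have c: "c \<in> carrier R" using S by auto
  have fsc: "set fs \<subseteq> carrier R" using fs words_closed[OF S(1)] by blast
  have Uc: "U \<subseteq> carrier R" using ideal_carrier[OF U(1)] .
  let ?L = "\<lambda>i::nat. (\<lambda>r. r \<otimes>\<^bsub>R\<^esub> c [^]\<^bsub>R\<^esub> i) ` carrier R"
  have reg_pow: "r = \<zero>\<^bsub>R\<^esub>" if "r \<in> carrier R" "r \<otimes>\<^bsub>R\<^esub> c [^]\<^bsub>R\<^esub> i = \<zero>\<^bsub>R\<^esub>" for r and i :: nat
    using that
  proof (induction i)
    case (Suc i)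
    then have "(r \<otimes>\<^bsub>R\<^esub> c [^]\<^bsub>R\<^esub> i) \<otimes>\<^bsub>R\<^esub> c = \<zero>\<^bsub>R\<^esub>" using c by (simp add: R.m_assoc)
    then have "r \<otimes>\<^bsub>R\<^esub> c [^]\<^bsub>R\<^esub> i = \<zero>\<^bsub>R\<^esub>"
      by (rule reg[rotated]) (use Suc.prems(1) c in simp)
    then show ?case by (rule Suc.IH[OF Suc.prems(1)])
  qed simp
  have cw: "c [^]\<^bsub>R\<^esub> i \<in> words R S i" for i :: nat
  proof (induction i)
    case (Suc i)
    show ?case using words_mult[OF S(1) Suc.IH letter_in_words[OF S, of 1]] by simp
  qed (simp add: one_in_words)
  have L_Suc: "?L (Suc i) \<subseteq> (\<lambda>u. u \<otimes>\<^bsub>R\<^esub> c [^]\<^bsub>R\<^esub> i) ` sp U" for i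
  proof
    fix y assume "y \<in> ?L (Suc i)"
    then obtain r where r: "r \<in> carrier R" "y = r \<otimes>\<^bsub>R\<^esub> c [^]\<^bsub>R\<^esub> Suc i" by blast
    have "c [^]\<^bsub>R\<^esub> Suc i = c \<otimes>\<^bsub>R\<^esub> c [^]\<^bsub>R\<^esub> i" using R.nat_pow_Suc2 c by blast
    then have "y = (r \<otimes>\<^bsub>R\<^esub> c) \<otimes>\<^bsub>R\<^esub> c [^]\<^bsub>R\<^esub> i" using r c by (simp add: R.m_assoc)
    moreover have "r \<otimes>\<^bsub>R\<^esub> c \<in> sp U" using U r span_base[OF Uc] by (simp add: ideal.I_l_closed)
    ultimately show "y \<in> (\<lambda>u. u \<otimes>\<^bsub>R\<^esub> c [^]\<^bsub>R\<^esub> i) ` sp U" by blast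
  qed
  \<comment> \<open>The blocks \<open>fs c^i\<close> are adjoined from \<open>i = n\<close> down to
    \<open>i = 0\<close>. All earlier blocks lie in \<open>R c^(i+1)\<close>, which is contained in
    \<open>U c^i\<close> because \<open>c\<close> is in \<open>U\<close>; modulo
    \<open>U c^i\<close> the new block is independent because \<open>fs\<close> is so modulo
    \<open>U\<close>.\<close>
  have "\<exists>hs. set hs \<subseteq> ?L (n + 1 - j) \<and> set hs \<subseteq> words R S (2 * n) \<and> indep {} hs \<and> length hs = j * length fs"
    if "j \<le> n + 1" for j
    using that
  proof (induction j)
    case 0
    show ?case by (intro exI[of _ "[]"]) auto
  next
    case (Suc j)
    define i where "i = n - j"
    have i: "n + 1 - j = Suc i" "n + 1 - Suc j = i" "i \<le> n" using Suc.prems i_def by auto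
    obtain hs where hs: "set hs \<subseteq> ?L (Suc i)" "set hs \<subseteq> words R S (2 * n)" "indep {} hs"
      "length hs = j * length fs"
      using Suc.IH[OF Suc_leD[OF Suc.prems]] unfolding i by blast
    let ?b = "map (\<lambda>f. f \<otimes>\<^bsub>R\<^esub> c [^]\<^bsub>R\<^esub> i) fs"
    have "indep (set hs) ?b"
    proof (rule indep_map_rmult[OF fs(1) fsc Uc])
      show "set hs \<subseteq> (\<lambda>u. u \<otimes>\<^bsub>R\<^esub> c [^]\<^bsub>R\<^esub> i) ` sp U"
        using hs(1) L_Suc[of i] by (rule order_trans)
      show "c [^]\<^bsub>R\<^esub> i \<in> carrier R" using c by simp
    qed (rule reg_pow)
    then have "indep {} (hs @ ?b)" using hs by (simp add: indep_append)
    moreover have "set ?b \<subseteq> words R S (2 * n)"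
    proof -
      have "f \<otimes>\<^bsub>R\<^esub> c [^]\<^bsub>R\<^esub> i \<in> words R S (n + i)" if "f \<in> set fs" for f
        using words_mult[OF S(1) _ cw] fs(2) that by blast
      moreover have "words R S (n + i) \<subseteq> words R S (2 * n)" using i by (intro words_mono) auto
      ultimately show ?thesis by auto
    qed
    moreover have "set ?b \<subseteq> ?L i" using fsc by auto
    moreover have "?L (Suc i) \<subseteq> ?L i"
      by (rule order_trans[OF L_Suc[of i] image_mono[OF V.span_is_subset2[OF Uc]]])
    ultimately show ?case using hs unfolding i by (intro exI[of _ "hs @ ?b"]) auto
  qed
  from this[of "n + 1"] show ?thesis by auto
qed

end

text \<open>A subsequence suffices for a lower bound on a limit superior, and the factor 2 in the
  argument disappears in the quotient of logarithms.\<close>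

lemma limsup_cubic:
  assumes "\<And>n. (n + 1) * (n * n) \<le> 2 * f (2 * n)"
  shows "3 \<le> limsup (\<lambda>n. ereal (ln (real (f n)) / ln (real n)))"
proof -
  let ?X = "\<lambda>n. ereal (ln (real (f n)) / ln (real n))"
  let ?Y = "\<lambda>n::nat. ln ((real n + 1) * (real n * real n) / 2) / ln (2 * real n)"
  have "?Y \<longlonglongrightarrow> 3" by real_asymp
  then have "limsup (\<lambda>n. ereal (?Y n)) = ereal 3"
    by (intro lim_imp_Limsup) auto
  moreover have "limsup (\<lambda>n. ereal (?Y n)) \<le> limsup (?X \<circ> (\<lambda>n. 2 * n))"
  proof (rule Limsup_mono)
    show "\<forall>\<^sub>F n in sequentially. ereal (?Y n) \<le> (?X \<circ> (\<lambda>n. 2 * n)) n"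
      using eventually_gt_at_top[of 0]
    proof eventually_elim
      case (elim n)
      have "real ((n + 1) * (n * n)) \<le> real (2 * f (2 * n))" using assms of_nat_le_iff by blast
      then have "(real n + 1) * (real n * real n) / 2 \<le> real (f (2 * n))"
        by (simp add: algebra_simps)
      moreover have "0 < (real n + 1) * (real n * real n) / 2" using elim by simp
      ultimately have "ln ((real n + 1) * (real n * real n) / 2) \<le> ln (real (f (2 * n)))" by simp
      then show ?case using elim by (simp add: divide_right_mono)
    qed
  qed
  moreover have "limsup (?X \<circ> (\<lambda>n. 2 * n)) \<le> limsup ?X"
    by (rule limsup_subseq_mono) (simp add: strict_mono_def)
  ultimately show ?thesis by simp
qed

context k_algebra
begin

text \<open>This is linear growth of \<open>R / U\<close> stated inside \<open>R\<close>, so that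
  the quotient algebra has to be formed only where the hypothesis on \<open>x\<close> is
  applied.\<close>

definition linear_growth :: "'a set \<Rightarrow> 'a set \<Rightarrow> bool" where
  "linear_growth U S \<longleftrightarrow> (\<exists>B. \<forall>n. \<exists>G. finite G \<and> G \<subseteq> words R S n \<and> card G \<le> B * (n + 1)
      \<and> words R S n \<subseteq> sp (U \<union> G))"

text \<open>Adjoining \<open>c\<close> to the alphabet makes \<open>c^i\<close> a word of length
  \<open>i\<close>, so all blocks count within length \<open>2 * n\<close>. If \<open>R / U\<close>
  grew quadratically, \<open>n + 1\<close> such blocks would make the growth of \<open>R\<close>
  cubic.\<close>

lemma linear_growth_mod_regular:
  assumes GK: "GKdim K R < 3" and S: "finite S" "S \<subseteq> carrier R" and U: "ideal U R" "c \<in> U"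
    and reg: "\<And>r. r \<in> carrier R \<Longrightarrow> r \<otimes>\<^bsub>R\<^esub> c = \<zero>\<^bsub>R\<^esub> \<Longrightarrow> r = \<zero>\<^bsub>R\<^esub>"
  shows "linear_growth U (insert c S)"
proof (rule ccontr)
  let ?S = "insert c S"
  have S': "finite ?S" "?S \<subseteq> carrier R" using S U ideal_carrier[OF U(1)] by auto
  assume "\<not> linear_growth U ?S"
  then have q: "\<exists>fs. set fs \<subseteq> words R ?S n \<and> indep U fs \<and> n * n \<le> 2 * length fs" for n
    using growth_gap[OF S' U(1)] unfolding linear_growth_def by blast
  have "(n + 1) * (n * n) \<le> 2 * growth K R (sp ?S) (2 * n)" for n
  proof -
    obtain fs where fs: "set fs \<subseteq> words R ?S n" "indep U fs" "n * n \<le> 2 * length fs"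
      using q by blast
    obtain hs where hs: "set hs \<subseteq> words R ?S (2 * n)" "indep {} hs" "length hs = (n + 1) * length fs"
      using indep_power_blocks[OF S'(2) insertI1 U reg fs(2,1)] by blast
    have "set hs \<subseteq> sp (words R ?S (2 * n))"
      using hs(1) V.in_own_span[OF words_closed[OF S'(2)]] by blast
    then have "(n + 1) * length fs \<le> growth K R (sp ?S) (2 * n)"
      using growth_ge[OF S'(2,1) _ hs(2)] hs(3) by simp
    moreover have "(n + 1) * (n * n) \<le> (n + 1) * (2 * length fs)" using fs(3) by (rule mult_le_mono2)
    ultimately show ?thesis by simp
  qed
  then have "3 \<le> limsup (\<lambda>n. ereal (ln (real (growth K R (sp ?S) n)) / ln (real n)))"
    by (rule limsup_cubic)
  also have "\<dots> \<le> GKdim K R" unfolding GKdim_def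
    by (rule SUP_upper) (use S' in blast)
  finally show False using GK by simp
qed

end

section \<open>Regular elements in prime Goldie rings\<close>

context ring
begin

text \<open>Passage from ideals to elements: \<open>I\<close> consists of all \<open>x\<close> with
  \<open>x R b = 0\<close> and contains \<open>a\<close>, its right annihilator \<open>J\<close>
  contains \<open>b\<close>, and \<open>I J = 0\<close>.\<close>

lemma prime_ringD:
  assumes "prime_ring R" "a \<in> carrier R" "b \<in> carrier R"
    and "\<And>r. r \<in> carrier R \<Longrightarrow> a \<otimes> r \<otimes> b = \<zero>"
  shows "a = \<zero> \<or> b = \<zero>"
proof -
  define I where "I = {x \<in> carrier R. \<forall>r\<in>carrier R. x \<otimes> r \<otimes> b = \<zero>}"
  define J where "J = {y \<in> carrier R. \<forall>x\<in>I. x \<otimes> y = \<zero>}"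
  have I: "ideal I R"
  proof (rule idealI[OF ring_axioms])
    show "subgroup I (add_monoid R)"
      unfolding I_def using assms(3) by (intro add.subgroupI) (auto simp: l_distr l_minus)
    show "x \<otimes> y \<in> I" if "y \<in> I" "x \<in> carrier R" for x y
      using that assms(3) unfolding I_def by (auto simp: m_assoc)
    show "y \<otimes> x \<in> I" if "y \<in> I" "x \<in> carrier R" for x y
    proof -
      have "y \<otimes> x \<otimes> r \<otimes> b = y \<otimes> (x \<otimes> r) \<otimes> b" if "r \<in> carrier R" for r
        using \<open>y \<in> I\<close> \<open>x \<in> carrier R\<close> that unfolding I_def by (simp add: m_assoc)
      then show ?thesis using that unfolding I_def by auto
    qed
  qed
  have I_sub: "I \<subseteq> carrier R" unfolding I_def by blast
  have J: "ideal J R"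
  proof (rule idealI[OF ring_axioms])
    show "subgroup J (add_monoid R)"
      unfolding J_def using I_sub by (intro add.subgroupI) (auto simp: r_distr r_minus subset_iff)
    show "x \<otimes> y \<in> J" if y: "y \<in> J" and x: "x \<in> carrier R" for x y
    proof -
      have "z \<otimes> (x \<otimes> y) = \<zero>" if z: "z \<in> I" for z
      proof -
        have "z \<otimes> x \<in> I" using ideal.I_r_closed[OF I z x] .
        then have "(z \<otimes> x) \<otimes> y = \<zero>" using y unfolding J_def by blast
        moreover have "z \<in> carrier R" "y \<in> carrier R" using y z I_sub unfolding J_def by auto
        ultimately show ?thesis using x by (simp add: m_assoc)
      qed
      then show ?thesis using x y unfolding J_def by auto
    qed
    show "y \<otimes> x \<in> J" if "y \<in> J" and "x \<in> carrier R" for x y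
      using that I_sub unfolding J_def by (auto simp: m_assoc[symmetric] subset_iff)
  qed
  have "ideal_prod R I J \<subseteq> {\<zero>}"
  proof
    fix s assume "s \<in> ideal_prod R I J"
    then show "s \<in> {\<zero>}" by (induction rule: ideal_prod.induct) (auto simp: J_def)
  qed
  then have "I \<subseteq> {\<zero>} \<or> J \<subseteq> {\<zero>}"
    using assms(1) I J unfolding prime_ring_def prime_ideal_def by blast
  moreover have "a \<in> I" using assms unfolding I_def by blast
  moreover have "b \<in> J"
  proof -
    have "x \<otimes> b = \<zero>" if "x \<in> I" for x
    proof -
      have "x \<otimes> \<one> \<otimes> b = \<zero>" "x \<in> carrier R" using that one_closed unfolding I_def by blast+
      then show ?thesis by simp
    qed
    then show ?thesis using assms(3) unfolding J_def by simp
  qed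
  ultimately show ?thesis by blast
qed

section \<open>Chains of annihilators and nilpotent elements\<close>

lemma left_goldie_acc:
  assumes "left_goldie R" "\<And>n. S n \<subseteq> carrier R"
    and "\<And>n. left_annihilator R (S n) \<subseteq> left_annihilator R (S (Suc n))"
  shows "\<exists>N. \<forall>n\<ge>N. left_annihilator R (S n) = left_annihilator R (S N)"
proof -
  have "\<exists>T\<subseteq>carrier R. left_annihilator R (S n) = left_annihilator R T" for n
    using assms(2)[of n] by (intro exI[of _ "S n"]) simp
  then show ?thesis
    using conjunct1[OF assms(1)[unfolded left_goldie_def], rule_format, of "\<lambda>n. left_annihilator R (S n)"]
      assms(3) by simp
qed

lemma left_annihilator_mult_right:
  assumes "x \<in> carrier R" "t \<in> carrier R"
  shows "left_annihilator R {x} \<subseteq> left_annihilator R {x \<otimes> t}"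
  using assms unfolding left_annihilator_def by (auto simp: m_assoc[symmetric])

text \<open>Shifting brackets; it transfers nilpotence from \<open>r a\<close> to
  \<open>a r\<close>, hence from the left ideal \<open>R a\<close> to the right ideal
  \<open>a R\<close>.\<close>

lemma pow_mult_swap:
  assumes "a \<in> carrier R" "r \<in> carrier R"
  shows "(a \<otimes> r) [^] Suc n = a \<otimes> (r \<otimes> a) [^] n \<otimes> r"
proof (induction n)
  case (Suc n)
  have "(a \<otimes> r) [^] Suc (Suc n) = a \<otimes> (r \<otimes> a) [^] n \<otimes> r \<otimes> (a \<otimes> r)"
    using Suc by simp
  then show ?case using assms by (simp add: m_assoc)
qed (use assms in simp)

text \<open>Levitzki's argument: if \<open>R a\<close> is nil, an element \<open>u\<close> of \<open>a R\<close> with maximal left annihilator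
  satisfies \<open>u R u = 0\<close>.\<close>

lemma ex_not_nilpotent:
  assumes pr: "prime_ring R" and go: "left_goldie R" and a: "a \<in> carrier R" "a \<noteq> \<zero>"
  shows "\<exists>r\<in>carrier R. \<forall>n::nat. (r \<otimes> a) [^] n \<noteq> \<zero>"
proof (rule ccontr)
  assume "\<not> ?thesis"
  then have nil': "\<exists>n::nat. (r \<otimes> a) [^] n = \<zero>" if "r \<in> carrier R" for r using that by blast
  have nil: "\<exists>n::nat. (a \<otimes> r) [^] n = \<zero>" if "r \<in> carrier R" for r
  proof -
    obtain n :: nat where "(r \<otimes> a) [^] n = \<zero>" using nil' \<open>r \<in> carrier R\<close> by blast
    then have "(a \<otimes> r) [^] Suc n = \<zero>" using pow_mult_swap[OF a(1) that, of n] a that by simp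
    then show ?thesis by blast
  qed
  let ?A = "(\<lambda>t. a \<otimes> t) ` carrier R - {\<zero>}"
  let ?l = "\<lambda>x. left_annihilator R {x}"
  \<comment> \<open>The chain condition as a maximum principle: without a maximal annihilator,
    dependent choice builds a strictly increasing sequence.\<close>
  have "\<exists>u\<in>?A. \<forall>v\<in>?A. ?l u \<subseteq> ?l v \<longrightarrow> ?l v = ?l u"
  proof (rule ccontr)
    assume no: "\<not> ?thesis"
    have "\<exists>v. v \<in> ?A \<and> ?l u \<subset> ?l v" if "u \<in> ?A" for u
      using no that by blast
    moreover have "\<exists>u. u \<in> ?A" using a r_one by (metis DiffI imageI one_closed singletonD)
    ultimately obtain u :: "nat \<Rightarrow> 'a" where u: "\<And>n. u n \<in> ?A" "\<And>n. ?l (u n) \<subset> ?l (u (Suc n))"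
      using dependent_nat_choice[of "\<lambda>_ u. u \<in> ?A" "\<lambda>_ u v. ?l u \<subset> ?l v"] by metis
    have "\<exists>N. \<forall>n\<ge>N. ?l (u n) = ?l (u N)"
    proof (rule left_goldie_acc[OF go])
      show "{u n} \<subseteq> carrier R" for n using u(1)[of n] a by auto
      show "?l (u n) \<subseteq> ?l (u (Suc n))" for n using u(2)[of n] by blast
    qed
    then obtain N where "?l (u (Suc N)) = ?l (u N)" by (meson le_SucI order_refl)
    then show False using u(2)[of N] by blast
  qed
  then obtain u where u: "u \<in> ?A" and max: "\<And>v. v \<in> ?A \<Longrightarrow> ?l u \<subseteq> ?l v \<Longrightarrow> ?l v = ?l u" by blast
  obtain t where t: "t \<in> carrier R" "u = a \<otimes> t" using u by blast
  have uc: "u \<in> carrier R" "u \<noteq> \<zero>" using t a u by auto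
  have "u \<otimes> r \<otimes> u = \<zero>" if r: "r \<in> carrier R" for r
  proof -
    let ?w = "u \<otimes> r"
    have wc: "?w \<in> carrier R" using uc r by simp
    obtain n :: nat where "(a \<otimes> (t \<otimes> r)) [^] n = \<zero>" using nil t r by blast
    then have "?w [^] n = \<zero>" using t r a by (simp add: m_assoc)
    then obtain k :: nat where k: "?w [^] k = \<zero>" "\<And>j. j < k \<Longrightarrow> ?w [^] j \<noteq> \<zero>"
      using exists_least_iff[of "\<lambda>n. ?w [^] n = \<zero>"] by blast
    have "k \<noteq> 0"
    proof
      assume "k = 0"
      then have "\<one> = \<zero>" using k by simp
      then show False using uc r_one by (metis r_null)
    qed
    then obtain m where m: "k = Suc m" using not0_implies_Suc by blast
    show ?thesis
    proof (cases m)
      case 0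
      then have "?w = \<zero>" using k(1) m wc by simp
      then show ?thesis using uc by simp
    next
      case (Suc i)
      \<comment> \<open>\<open>?v\<close> is the last nonzero power of \<open>?w\<close>. It is a
        right multiple of \<open>u\<close>, so by maximality it has the same left annihilator;
        \<open>?w\<close> kills \<open>?v\<close>, hence also \<open>u\<close>.\<close>
      let ?v = "?w [^] m"
      have v: "?v = u \<otimes> (r \<otimes> ?w [^] i)" using nat_pow_Suc2[OF wc, of i] Suc uc r wc by (simp add: m_assoc)
      then have "?v = a \<otimes> (t \<otimes> (r \<otimes> ?w [^] i))" using t a r wc by (simp add: m_assoc)
      then have "?v \<in> ?A" using k(2)[of m] m t r wc by blast
      moreover have "?l u \<subseteq> ?l ?v" unfolding v using left_annihilator_mult_right uc r wc by simp
      ultimately have "?l ?v = ?l u" by (rule max)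
      moreover have "?w \<in> ?l ?v"
        using k(1) m nat_pow_Suc2[OF wc, of m] wc unfolding left_annihilator_def by simp
      ultimately show ?thesis unfolding left_annihilator_def by simp
    qed
  qed
  then show False using prime_ringD[OF pr uc(1) uc(1)] uc(2) by blast
qed

text \<open>For nonzero \<open>c\<close> this says that \<open>c\<close> and \<open>c^2\<close> have
  the same left annihilator, or that \<open>R c\<close> meets the left annihilator of
  \<open>c\<close> only in 0.\<close>

definition stable_element :: "'a \<Rightarrow> bool" where
  "stable_element c \<longleftrightarrow> c \<in> carrier R \<and> c \<noteq> \<zero> \<and>
    (\<forall>r\<in>carrier R. r \<otimes> c \<otimes> c = \<zero> \<longrightarrow> r \<otimes> c = \<zero>)"

text \<open>The left annihilators of the powers of a non-nilpotent \<open>b\<close> in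
  \<open>R a\<close> ascend and become constant; a power beyond that point is stable and still
  nonzero.\<close>

lemma ex_stable_multiple:
  assumes pr: "prime_ring R" and go: "left_goldie R" and a: "a \<in> carrier R" "a \<noteq> \<zero>"
  shows "\<exists>s\<in>carrier R. stable_element (s \<otimes> a)"
proof -
  obtain r where r: "r \<in> carrier R" "\<And>n::nat. (r \<otimes> a) [^] n \<noteq> \<zero>"
    using ex_not_nilpotent[OF assms] by blast
  let ?b = "r \<otimes> a"
  have b: "?b \<in> carrier R" using r a by simp
  have "\<exists>N. \<forall>n\<ge>N. left_annihilator R {?b [^] n} = left_annihilator R {?b [^] (N::nat)}"
    by (rule left_goldie_acc[OF go]) (use b left_annihilator_mult_right[OF nat_pow_closed[OF b] b] in auto)
  then obtain N :: nat where N: "\<And>n. n \<ge> N \<Longrightarrow> left_annihilator R {?b [^] n} = left_annihilator R {?b [^] N}"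
    by blast
  \<comment> \<open>The exponent is \<open>Suc N\<close>, not \<open>N\<close>, so that the power
    remains a left multiple of \<open>a\<close> even when \<open>N = 0\<close>.\<close>
  let ?c = "?b [^] Suc N"
  have c: "?c \<in> carrier R" using b by simp
  have "x \<otimes> ?c = \<zero>" if x: "x \<in> carrier R" "x \<otimes> ?c \<otimes> ?c = \<zero>" for x
  proof -
    have "x \<otimes> ?b [^] (Suc N + Suc N) = \<zero>"
      using nat_pow_mult[OF b, of "Suc N" "Suc N"] x c by (metis m_assoc)
    then have "x \<in> left_annihilator R {?b [^] (Suc N + Suc N)}" using x unfolding left_annihilator_def by simp
    then have "x \<in> left_annihilator R {?c}" using N[of "Suc N + Suc N"] N[of "Suc N"] by simp
    then show ?thesis unfolding left_annihilator_def by simp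
  qed
  then have "stable_element ?c" unfolding stable_element_def using c r(2) by blast
  moreover have "?c = (?b [^] N \<otimes> r) \<otimes> a" using b r a by (simp add: m_assoc)
  moreover have "?b [^] N \<otimes> r \<in> carrier R" using b r by simp
  ultimately show ?thesis by metis
qed

text \<open>Multiply the sum on the right by \<open>a i\<close>: terms before \<open>i\<close>
  vanish by induction, terms after \<open>i\<close> by \<open>tri\<close>, and stability of
  \<open>a i\<close> removes the extra factor from what remains.\<close>

lemma triangular_sum_zero:
  fixes n :: nat
  assumes st: "\<And>i. i < n \<Longrightarrow> stable_element (a i)"
    and tri: "\<And>i j. i < j \<Longrightarrow> j < n \<Longrightarrow> a j \<otimes> a i = \<zero>"
    and f: "\<And>i. i < n \<Longrightarrow> r i \<in> carrier R" "\<And>i. i < n \<Longrightarrow> f i = r i \<otimes> a i"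
    and sum: "(\<Oplus>i\<in>{..<n}. f i) = \<zero>" and "i < n"
  shows "f i = \<zero>"
  using \<open>i < n\<close>
proof (induction i rule: less_induct)
  case (less i)
  have ac: "a j \<in> carrier R" if "j < n" for j using st[OF that] unfolding stable_element_def by blast
  have fc: "f \<in> {..<n} \<rightarrow> carrier R" using f ac by auto
  have "f j \<otimes> a i = (if j = i then f i \<otimes> a i else \<zero>)" if "j < n" for j
  proof -
    consider "j < i" | "j = i" | "i < j" by linarith
    then show ?thesis
    proof cases
      case 1
      then show ?thesis using less ac by simp
    next
      case 3
      then show ?thesis using f[OF that] tri[OF 3 that] ac that less.prems by (simp add: m_assoc)
    qed simp
  qed
  then have "(\<Oplus>j\<in>{..<n}. f j \<otimes> a i) = (\<Oplus>j\<in>{..<n}. if i = j then f i \<otimes> a i else \<zero>)"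
    using f ac less.prems by (intro add.finprod_cong') auto
  also have "\<dots> = f i \<otimes> a i"
    using add.finprod_singleton[of i "{..<n}" "\<lambda>_. f i \<otimes> a i"] less.prems f ac by simp
  also have "(\<Oplus>j\<in>{..<n}. f j \<otimes> a i) = \<zero>"
    using finsum_ldistr[OF _ ac[OF less.prems] fc] sum ac[OF less.prems] by simp
  finally have "r i \<otimes> a i \<otimes> a i = \<zero>" using f less.prems by simp
  then show ?case using st[OF less.prems] f less.prems unfolding stable_element_def by simp
qed

text \<open>If no such element exists, one constructs stable elements \<open>a n\<close> of
  \<open>M\<close> with \<open>a n\<close> killing every earlier \<open>a i\<close> from the left.
  The left ideals \<open>R (a n)\<close> are then independent, against the Goldie condition.\<close>

theorem prime_goldie_regular:
  assumes pr: "prime_ring R" and go: "left_goldie R" and M: "ideal M R" "M \<noteq> {\<zero>}"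
  shows "\<exists>c\<in>M. \<forall>r\<in>carrier R. r \<otimes> c = \<zero> \<longrightarrow> r = \<zero>"
proof (rule ccontr)
  assume "\<not> ?thesis"
  then have irreg: "\<exists>r\<in>carrier R. r \<otimes> c = \<zero> \<and> r \<noteq> \<zero>" if "c \<in> M" for c using that by blast
  have Mc: "M \<subseteq> carrier R" using ideal.Icarr[OF M(1)] by blast
  have M0: "\<zero> \<in> M" using additive_subgroup.zero_closed[OF ideal.axioms(1)[OF M(1)]] .
  obtain m0 where m0: "m0 \<in> M" "m0 \<noteq> \<zero>" using M M0 by blast
  let ?P = "\<lambda>f n c. c \<in> M \<and> stable_element c \<and> (\<forall>i<n. c \<otimes> f i = \<zero>)"
  have "\<exists>f. \<forall>n::nat. ?P f n (f n)"
  proof (rule dependent_wellorder_choice)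
    fix n :: nat and f :: "nat \<Rightarrow> 'a"
    assume IH: "\<And>i. i < n \<Longrightarrow> ?P f i (f i)"
    \<comment> \<open>The sum lies in \<open>M\<close>, so some \<open>r \<noteq> 0\<close> kills
      it; stability and triangularity split this single equation into \<open>r (f i) = 0\<close> for
      each \<open>i < n\<close>.\<close>
    let ?b = "\<Oplus>i\<in>{..<n}. f i"
    have fM: "f i \<in> M" "f i \<in> carrier R" "stable_element (f i)" if "i < n" for i
      using IH[OF that] Mc by auto
    have "?b \<in> M"
    proof -
      have "(\<Oplus>i\<in>A. f i) \<in> M" if "finite A" "A \<subseteq> {..<n}" for A
        using that
      proof (induction A rule: finite_induct)
        case (insert i A)
        then show ?case using fM additive_subgroup.a_closed[OF ideal.axioms(1)[OF M(1)]]
          by (subst finsum_insert) auto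
      qed (simp add: M0)
      then show ?thesis by simp
    qed
    then obtain r where r: "r \<in> carrier R" "r \<otimes> ?b = \<zero>" "r \<noteq> \<zero>" using irreg by blast
    have "(\<Oplus>i\<in>{..<n}. r \<otimes> f i) = \<zero>"
      using finsum_rdistr[of "{..<n}" r f] r fM by auto
    then have rf: "r \<otimes> f i = \<zero>" if "i < n" for i
      using triangular_sum_zero[of n f "\<lambda>_. r" "\<lambda>i. r \<otimes> f i" i] IH r that by blast
    \<comment> \<open>Primeness moves the annihilating element into \<open>M\<close> without making
      it zero: \<open>m0 t r\<close> lies in \<open>M\<close> and still kills every
      \<open>f i\<close>.\<close>
    obtain t where t: "t \<in> carrier R" "m0 \<otimes> t \<otimes> r \<noteq> \<zero>"
      using prime_ringD[OF pr _ r(1), of m0] m0 r Mc by blast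
    let ?y = "m0 \<otimes> t \<otimes> r"
    have m0c: "m0 \<in> carrier R" using m0 Mc by blast
    have y: "?y \<in> M" "?y \<in> carrier R"
      using m0 t r Mc by (auto intro!: ideal.I_r_closed[OF M(1)])
    obtain s where s: "s \<in> carrier R" "stable_element (s \<otimes> ?y)"
      using ex_stable_multiple[OF pr go y(2) t(2)] by blast
    have "s \<otimes> ?y \<otimes> f i = \<zero>" if "i < n" for i
    proof -
      have "s \<otimes> ?y \<otimes> f i = (s \<otimes> m0 \<otimes> t) \<otimes> (r \<otimes> f i)"
        using s m0c t r fM[OF that] by (simp add: m_assoc)
      then show ?thesis using rf[OF that] s m0c t by simp
    qed
    then show "\<exists>c. ?P f n c"
      using ideal.I_l_closed[OF M(1) y(1) s(1)] s(2) by blast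
  qed simp
  then obtain a :: "nat \<Rightarrow> 'a" where a: "\<And>n. ?P a n (a n)" by blast
  let ?L = "\<lambda>n. (\<lambda>r. r \<otimes> a n) ` carrier R"
  have ac: "a n \<in> carrier R" "a n \<noteq> \<zero>" for n using a[of n] unfolding stable_element_def by auto
  have "left_ideal (?L n) R \<and> ?L n \<noteq> {\<zero>}" for n
  proof -
    have "additive_subgroup (?L n) R"
    proof (intro additive_subgroupI add.subgroupI)
      show "?L n \<subseteq> carrier R" "?L n \<noteq> {}" using ac by auto
      show "\<ominus> x \<in> ?L n" if "x \<in> ?L n" for x
      proof -
        obtain r where "r \<in> carrier R" "x = r \<otimes> a n" using \<open>x \<in> ?L n\<close> by blast
        then show ?thesis using l_minus[of r "a n"] ac a_inv_closed by (metis imageI)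
      qed
      show "x \<oplus> y \<in> ?L n" if "x \<in> ?L n" "y \<in> ?L n" for x y
      proof -
        from that obtain r s where "r \<in> carrier R" "x = r \<otimes> a n" "s \<in> carrier R" "y = s \<otimes> a n"
          by blast
        then have "x \<oplus> y = (r \<oplus> s) \<otimes> a n" "r \<oplus> s \<in> carrier R" using ac(1) l_distr by auto
        then show ?thesis by (rule image_eqI)
      qed
    qed
    moreover have "x \<otimes> y \<in> ?L n" if x: "x \<in> carrier R" and "y \<in> ?L n" for x y
    proof -
      from that obtain r where "r \<in> carrier R" "y = r \<otimes> a n" by blast
      then show ?thesis using x m_assoc[of x r "a n"] ac by (metis imageI m_closed)
    qed
    moreover have "a n \<in> ?L n" using l_one[of "a n"] ac by (metis imageI one_closed)
    ultimately show ?thesis unfolding left_ideal_def using ac[of n] by blast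
  qed
  moreover have "independent_sequence R ?L"
    unfolding independent_sequence_def
  proof (intro allI impI, elim conjE)
    fix n f i assume f: "\<forall>i\<le>n. f i \<in> ?L i" and s: "(\<Oplus>i\<in>{..n}. f i) = \<zero>" and "i \<le> n"
    have "\<forall>i\<in>{..n}. \<exists>r. r \<in> carrier R \<and> f i = r \<otimes> a i" using f by fastforce
    from bchoice[OF this] obtain r where r: "\<And>i. i \<le> n \<Longrightarrow> r i \<in> carrier R \<and> f i = r i \<otimes> a i"
      by auto
    show "f i = \<zero>"
      by (rule triangular_sum_zero[of "Suc n" a r f i])
        (use a r s \<open>i \<le> n\<close> in \<open>auto simp: lessThan_Suc_atMost less_Suc_eq_le\<close>)
  qed
  ultimately have "\<exists>L :: nat \<Rightarrow> 'a set. (\<forall>n. left_ideal (L n) R \<and> L n \<noteq> {\<zero>}) \<and> independent_sequence R L"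
    by (intro exI[of _ ?L] conjI allI) simp_all
  then show False by (rule notE[OF conjunct2[OF go[unfolded left_goldie_def]]])
qed

end

section \<open>Polynomial values\<close>

context k_algebra
begin

lemma scalar_commute:
  assumes "c \<in> carrier K" "x \<in> carrier R"
  shows "x \<otimes>\<^bsub>R\<^esub> (c \<odot>\<^bsub>R\<^esub> \<one>\<^bsub>R\<^esub>) = c \<odot>\<^bsub>R\<^esub> x"
  using assms by (simp add: smult_mult_right)

definition ev :: "'a \<Rightarrow> 'k list \<Rightarrow> 'a" where
  "ev b p = R.eval (map (\<lambda>c. c \<odot>\<^bsub>R\<^esub> \<one>\<^bsub>R\<^esub>) p) b"

lemma ev_closed: "set p \<subseteq> carrier K \<Longrightarrow> b \<in> carrier R \<Longrightarrow> ev b p \<in> carrier R"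
  unfolding ev_def by (rule R.eval_in_carrier) auto

lemma ev_Nil [simp]: "ev b [] = \<zero>\<^bsub>R\<^esub>"
  by (simp add: ev_def)

lemma ev_Cons:
  assumes "c \<in> carrier K" "b \<in> carrier R"
  shows "ev b (c # p) = c \<odot>\<^bsub>R\<^esub> b [^]\<^bsub>R\<^esub> length p \<oplus>\<^bsub>R\<^esub> ev b p"
  using assms by (simp add: ev_def smult_mult_left)

lemma ev_snoc:
  assumes "set p \<subseteq> carrier K" "c \<in> carrier K" "b \<in> carrier R"
  shows "ev b (p @ [c]) = ev b p \<otimes>\<^bsub>R\<^esub> b \<oplus>\<^bsub>R\<^esub> c \<odot>\<^bsub>R\<^esub> \<one>\<^bsub>R\<^esub>"
  unfolding ev_def map_append list.map using assms by (intro R.eval_append_aux) auto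

lemma eval_snoc:
  assumes "set p \<subseteq> carrier K" "c \<in> carrier K" "t \<in> carrier K"
  shows "V.eval (p @ [c]) t = V.eval p t \<otimes>\<^bsub>K\<^esub> t \<oplus>\<^bsub>K\<^esub> c"
  using assms by (intro V.eval_append_aux) auto

text \<open>The relation couples a polynomial function on \<open>K\<close> with the value at
  \<open>b\<close> of the same coefficient list. Such pairs are closed under the operations needed
  below, and one point where \<open>\<phi>\<close> is nonzero certifies that the polynomial is
  nonzero.\<close>

definition polyf :: "'a \<Rightarrow> ('k \<Rightarrow> 'k) \<Rightarrow> 'a \<Rightarrow> bool" where
  "polyf b \<phi> z \<longleftrightarrow> (\<exists>p. set p \<subseteq> carrier K \<and> (\<forall>t\<in>carrier K. \<phi> t = V.eval p t) \<and> z = ev b p)"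

lemma polyf_closed: "polyf b \<phi> z \<Longrightarrow> b \<in> carrier R \<Longrightarrow> z \<in> carrier R"
  unfolding polyf_def using ev_closed by blast

lemma polyf_fun_closed: "polyf b \<phi> z \<Longrightarrow> t \<in> carrier K \<Longrightarrow> \<phi> t \<in> carrier K"
  unfolding polyf_def using V.eval_in_carrier by auto

lemma polyf_zero: "polyf b (\<lambda>_. \<zero>\<^bsub>K\<^esub>) \<zero>\<^bsub>R\<^esub>"
  unfolding polyf_def by (intro exI[of _ "[]"]) auto

lemma polyf_const:
  assumes "c \<in> carrier K" "b \<in> carrier R"
  shows "polyf b (\<lambda>_. c) (c \<odot>\<^bsub>R\<^esub> \<one>\<^bsub>R\<^esub>)"
  unfolding polyf_def by (intro exI[of _ "[c]"]) (use assms in \<open>auto simp: ev_Cons\<close>)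

lemma polyf_times_var:
  assumes "polyf b \<phi> z" "c \<in> carrier K" "b \<in> carrier R"
  shows "polyf b (\<lambda>t. \<phi> t \<otimes>\<^bsub>K\<^esub> t \<oplus>\<^bsub>K\<^esub> c) (z \<otimes>\<^bsub>R\<^esub> b \<oplus>\<^bsub>R\<^esub> c \<odot>\<^bsub>R\<^esub> \<one>\<^bsub>R\<^esub>)"
proof -
  obtain p where p: "set p \<subseteq> carrier K" "\<forall>t\<in>carrier K. \<phi> t = V.eval p t" "z = ev b p"
    using assms unfolding polyf_def by blast
  then show ?thesis unfolding polyf_def
    by (intro exI[of _ "p @ [c]"]) (use assms in \<open>auto simp: ev_snoc eval_snoc\<close>)
qed

lemma polyf_add:
  assumes "polyf b \<phi> z" "polyf b \<psi> w" "b \<in> carrier R"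
  shows "polyf b (\<lambda>t. \<phi> t \<oplus>\<^bsub>K\<^esub> \<psi> t) (z \<oplus>\<^bsub>R\<^esub> w)"
proof -
  have "\<exists>r. set r \<subseteq> carrier K \<and> (\<forall>t\<in>carrier K. V.eval p t \<oplus>\<^bsub>K\<^esub> V.eval q t = V.eval r t)
      \<and> ev b p \<oplus>\<^bsub>R\<^esub> ev b q = ev b r" if "set p \<subseteq> carrier K" "set q \<subseteq> carrier K" for p q
    using that
  \<comment> \<open>Lists begin with the leading coefficient, so lists of different lengths are
    aligned at the constant term; hence the induction from the end, with Horner's rule.\<close>
  proof (induction p arbitrary: q rule: rev_induct)
    case Nil
    then show ?case using assms(3)
      by (intro exI[of _ q]) (simp add: ev_closed V.eval_in_carrier)
  next
    case (snoc c p)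
    show ?case
    proof (cases q rule: rev_cases)
      case Nil
      then show ?thesis using assms(3) snoc.prems ev_closed[of "p @ [c]"]
        V.eval_in_carrier[of "p @ [c]"]
        by (intro exI[of _ "p @ [c]"]) simp
    next
      case (snoc q' d)
      have sets: "set p \<subseteq> carrier K" "set q' \<subseteq> carrier K" "c \<in> carrier K" "d \<in> carrier K"
        using snoc.prems snoc by auto
      obtain r where r: "set r \<subseteq> carrier K" "\<forall>t\<in>carrier K. V.eval p t \<oplus>\<^bsub>K\<^esub> V.eval q' t = V.eval r t"
        "ev b p \<oplus>\<^bsub>R\<^esub> ev b q' = ev b r" using snoc.IH[of q'] sets by blast
      have "V.eval (p @ [c]) t \<oplus>\<^bsub>K\<^esub> V.eval q t = V.eval (r @ [c \<oplus>\<^bsub>K\<^esub> d]) t" if t: "t \<in> carrier K" for t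
      proof -
        have cl: "V.eval p t \<in> carrier K" "V.eval q' t \<in> carrier K"
          using V.eval_in_carrier sets t by auto
        have "V.eval (r @ [c \<oplus>\<^bsub>K\<^esub> d]) t = (V.eval p t \<oplus>\<^bsub>K\<^esub> V.eval q' t) \<otimes>\<^bsub>K\<^esub> t \<oplus>\<^bsub>K\<^esub> (c \<oplus>\<^bsub>K\<^esub> d)"
          using eval_snoc r sets t by simp
        also have "\<dots> = (V.eval p t \<otimes>\<^bsub>K\<^esub> t \<oplus>\<^bsub>K\<^esub> c) \<oplus>\<^bsub>K\<^esub> (V.eval q' t \<otimes>\<^bsub>K\<^esub> t \<oplus>\<^bsub>K\<^esub> d)"
          using cl sets t by (simp add: V.R.l_distr V.R.a_assoc V.R.a_lcomm)
        finally show ?thesis using eval_snoc sets t snoc by simp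
      qed
      moreover have "ev b (p @ [c]) \<oplus>\<^bsub>R\<^esub> ev b q = ev b (r @ [c \<oplus>\<^bsub>K\<^esub> d])"
      proof -
        have cl: "ev b p \<in> carrier R" "ev b q' \<in> carrier R" using ev_closed sets assms(3) by auto
        have "ev b (r @ [c \<oplus>\<^bsub>K\<^esub> d]) = (ev b p \<oplus>\<^bsub>R\<^esub> ev b q') \<otimes>\<^bsub>R\<^esub> b \<oplus>\<^bsub>R\<^esub> (c \<oplus>\<^bsub>K\<^esub> d) \<odot>\<^bsub>R\<^esub> \<one>\<^bsub>R\<^esub>"
          using ev_snoc r sets assms(3) by simp
        also have "\<dots> = (ev b p \<otimes>\<^bsub>R\<^esub> b \<oplus>\<^bsub>R\<^esub> c \<odot>\<^bsub>R\<^esub> \<one>\<^bsub>R\<^esub>) \<oplus>\<^bsub>R\<^esub> (ev b q' \<otimes>\<^bsub>R\<^esub> b \<oplus>\<^bsub>R\<^esub> d \<odot>\<^bsub>R\<^esub> \<one>\<^bsub>R\<^esub>)"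
          using cl sets assms(3) by (simp add: R.l_distr V.smult_l_distr V.M.a_assoc V.M.a_lcomm)
        finally show ?thesis using ev_snoc sets assms(3) snoc by simp
      qed
      ultimately show ?thesis using r sets by (intro exI[of _ "r @ [c \<oplus>\<^bsub>K\<^esub> d]"]) auto
    qed
  qed
  then show ?thesis using assms unfolding polyf_def by (smt (verit, best))
qed

lemma polyf_smult:
  assumes "polyf b \<phi> z" "a \<in> carrier K" "b \<in> carrier R"
  shows "polyf b (\<lambda>t. a \<otimes>\<^bsub>K\<^esub> \<phi> t) (a \<odot>\<^bsub>R\<^esub> z)"
proof -
  obtain p where p: "set p \<subseteq> carrier K" "\<forall>t\<in>carrier K. \<phi> t = V.eval p t" "z = ev b p"
    using assms unfolding polyf_def by blast
  let ?q = "map (\<lambda>c. a \<otimes>\<^bsub>K\<^esub> c) p"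
  have "V.eval ?q t = a \<otimes>\<^bsub>K\<^esub> V.eval p t" if "t \<in> carrier K" for t
    using p(1)
  proof (induction p rule: rev_induct)
    case (snoc c p)
    have sets: "set p \<subseteq> carrier K" "c \<in> carrier K" "set (map ((\<otimes>\<^bsub>K\<^esub>) a) p) \<subseteq> carrier K"
      using snoc.prems assms(2) by auto
    have "V.eval p t \<in> carrier K" using V.eval_in_carrier[OF sets(1) that] .
    then show ?case
      using snoc.IH[OF sets(1)] sets(2) assms(2) that
        eval_snoc[OF sets(1,2) that] eval_snoc[OF sets(3), of "a \<otimes>\<^bsub>K\<^esub> c" t]
      by (simp add: V.R.r_distr V.R.m_assoc)
  qed (use assms in simp)
  moreover have "ev b ?q = a \<odot>\<^bsub>R\<^esub> ev b p"
    using p(1)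
  proof (induction p rule: rev_induct)
    case (snoc c p)
    have sets: "set p \<subseteq> carrier K" "c \<in> carrier K" "set (map ((\<otimes>\<^bsub>K\<^esub>) a) p) \<subseteq> carrier K"
      using snoc.prems assms(2) by auto
    then show ?case
      using snoc.IH[OF sets(1)] assms(2,3) ev_closed[OF sets(1) assms(3)]
        ev_snoc[OF sets(1,2) assms(3)] ev_snoc[OF sets(3), of "a \<otimes>\<^bsub>K\<^esub> c" b]
      by (simp add: V.smult_r_distr V.smult_assoc1 smult_mult_left)
  qed (use assms in simp)
  moreover have "set ?q \<subseteq> carrier K" using p assms by auto
  ultimately show ?thesis unfolding polyf_def using p by (intro exI[of _ ?q]) simp
qed

lemma polyf_times_linear:
  assumes "polyf b \<phi> z" "a \<in> carrier K" "b \<in> carrier R"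
  shows "polyf b (\<lambda>t. \<phi> t \<otimes>\<^bsub>K\<^esub> (t \<ominus>\<^bsub>K\<^esub> a)) (z \<otimes>\<^bsub>R\<^esub> (b \<ominus>\<^bsub>R\<^esub> a \<odot>\<^bsub>R\<^esub> \<one>\<^bsub>R\<^esub>))"
proof -
  have z: "z \<in> carrier R" using polyf_closed assms by blast
  have "polyf b (\<lambda>t. (\<phi> t \<otimes>\<^bsub>K\<^esub> t \<oplus>\<^bsub>K\<^esub> \<zero>\<^bsub>K\<^esub>) \<oplus>\<^bsub>K\<^esub> (\<ominus>\<^bsub>K\<^esub> a) \<otimes>\<^bsub>K\<^esub> \<phi> t)
      ((z \<otimes>\<^bsub>R\<^esub> b \<oplus>\<^bsub>R\<^esub> \<zero>\<^bsub>K\<^esub> \<odot>\<^bsub>R\<^esub> \<one>\<^bsub>R\<^esub>) \<oplus>\<^bsub>R\<^esub> (\<ominus>\<^bsub>K\<^esub> a) \<odot>\<^bsub>R\<^esub> z)"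
    using assms by (intro polyf_add polyf_times_var polyf_smult) auto
  moreover have "(z \<otimes>\<^bsub>R\<^esub> b \<oplus>\<^bsub>R\<^esub> \<zero>\<^bsub>K\<^esub> \<odot>\<^bsub>R\<^esub> \<one>\<^bsub>R\<^esub>) \<oplus>\<^bsub>R\<^esub> (\<ominus>\<^bsub>K\<^esub> a) \<odot>\<^bsub>R\<^esub> z
      = z \<otimes>\<^bsub>R\<^esub> (b \<ominus>\<^bsub>R\<^esub> a \<odot>\<^bsub>R\<^esub> \<one>\<^bsub>R\<^esub>)"
    using z assms by (simp add: a_minus_def R.r_distr R.r_minus scalar_commute V.smult_l_minus)
  moreover have "(\<phi> t \<otimes>\<^bsub>K\<^esub> t \<oplus>\<^bsub>K\<^esub> \<zero>\<^bsub>K\<^esub>) \<oplus>\<^bsub>K\<^esub> (\<ominus>\<^bsub>K\<^esub> a) \<otimes>\<^bsub>K\<^esub> \<phi> t = \<phi> t \<otimes>\<^bsub>K\<^esub> (t \<ominus>\<^bsub>K\<^esub> a)"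
    if "t \<in> carrier K" for t
    using that assms polyf_fun_closed[OF assms(1) that]
    by (simp add: a_minus_def V.R.r_distr V.R.r_minus V.R.l_minus V.R.m_comm)
  ultimately show ?thesis unfolding polyf_def by simp
qed

text \<open>Synthetic division, done in \<open>K\<close> and in \<open>R\<close> with the same
  quotient. If \<open>p = s (X - a) + r\<close>, then
  \<open>p X + c = (s X + r) (X - a) + (r a + c)\<close>, and \<open>s X + r\<close> is the list
  \<open>s @ [r]\<close>.\<close>

lemma polyf_divide_linear:
  assumes "set p \<subseteq> carrier K" "a \<in> carrier K" "b \<in> carrier R"
  shows "\<exists>s. set s \<subseteq> carrier K \<and> length s = length p - 1 \<and>
     (\<forall>t\<in>carrier K. V.eval p t = V.eval s t \<otimes>\<^bsub>K\<^esub> (t \<ominus>\<^bsub>K\<^esub> a) \<oplus>\<^bsub>K\<^esub> V.eval p a) \<and>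
     ev b p = ev b s \<otimes>\<^bsub>R\<^esub> (b \<ominus>\<^bsub>R\<^esub> a \<odot>\<^bsub>R\<^esub> \<one>\<^bsub>R\<^esub>) \<oplus>\<^bsub>R\<^esub> V.eval p a \<odot>\<^bsub>R\<^esub> \<one>\<^bsub>R\<^esub>"
  using assms(1)
proof (induction p rule: rev_induct)
  case Nil
  then show ?case using assms by (intro exI[of _ "[]"]) auto
next
  case (snoc c p)
  show ?case
  proof (cases "p = []")
    case True
    then show ?thesis using assms snoc.prems by (intro exI[of _ "[]"]) (auto simp: ev_Cons)
  next
    case False
    have pc: "set p \<subseteq> carrier K" "c \<in> carrier K" using snoc.prems by auto
    let ?r = "V.eval p a"
    have r: "?r \<in> carrier K" using V.eval_in_carrier pc assms by auto
    obtain s where s: "set s \<subseteq> carrier K" "length s = length p - 1"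
      "\<forall>t\<in>carrier K. V.eval p t = V.eval s t \<otimes>\<^bsub>K\<^esub> (t \<ominus>\<^bsub>K\<^esub> a) \<oplus>\<^bsub>K\<^esub> ?r"
      "ev b p = ev b s \<otimes>\<^bsub>R\<^esub> (b \<ominus>\<^bsub>R\<^esub> a \<odot>\<^bsub>R\<^esub> \<one>\<^bsub>R\<^esub>) \<oplus>\<^bsub>R\<^esub> ?r \<odot>\<^bsub>R\<^esub> \<one>\<^bsub>R\<^esub>"
      using snoc.IH[OF pc(1)] by blast
    have "V.eval (p @ [c]) t = V.eval (s @ [?r]) t \<otimes>\<^bsub>K\<^esub> (t \<ominus>\<^bsub>K\<^esub> a) \<oplus>\<^bsub>K\<^esub> V.eval (p @ [c]) a"
      if t: "t \<in> carrier K" for t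
    proof -
      have e: "V.eval s t \<in> carrier K" using V.eval_in_carrier[OF s(1) t] .
      have p_eq: "V.eval p t = V.eval s t \<otimes>\<^bsub>K\<^esub> (t \<ominus>\<^bsub>K\<^esub> a) \<oplus>\<^bsub>K\<^esub> ?r" using s(3) t by blast
      show ?thesis
        unfolding eval_snoc[OF pc t] eval_snoc[OF pc assms(2)] eval_snoc[OF s(1) r t] p_eq
        using e r t assms(2) pc
        by algebra
    qed
    moreover have "ev b (p @ [c]) = ev b (s @ [?r]) \<otimes>\<^bsub>R\<^esub> (b \<ominus>\<^bsub>R\<^esub> a \<odot>\<^bsub>R\<^esub> \<one>\<^bsub>R\<^esub>)
        \<oplus>\<^bsub>R\<^esub> V.eval (p @ [c]) a \<odot>\<^bsub>R\<^esub> \<one>\<^bsub>R\<^esub>"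
    proof -
      let ?e = "ev b s"
      have e: "?e \<in> carrier R" using ev_closed[OF s(1) assms(3)] .
      have "ev b (p @ [c]) = (?e \<otimes>\<^bsub>R\<^esub> (b \<ominus>\<^bsub>R\<^esub> a \<odot>\<^bsub>R\<^esub> \<one>\<^bsub>R\<^esub>) \<oplus>\<^bsub>R\<^esub> ?r \<odot>\<^bsub>R\<^esub> \<one>\<^bsub>R\<^esub>) \<otimes>\<^bsub>R\<^esub> b \<oplus>\<^bsub>R\<^esub> c \<odot>\<^bsub>R\<^esub> \<one>\<^bsub>R\<^esub>"
        unfolding ev_snoc[OF pc assms(3)] s(4) ..
      also have "\<dots> = (?e \<otimes>\<^bsub>R\<^esub> b \<oplus>\<^bsub>R\<^esub> ?r \<odot>\<^bsub>R\<^esub> \<one>\<^bsub>R\<^esub>) \<otimes>\<^bsub>R\<^esub> (b \<ominus>\<^bsub>R\<^esub> a \<odot>\<^bsub>R\<^esub> \<one>\<^bsub>R\<^esub>)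
          \<oplus>\<^bsub>R\<^esub> (?r \<otimes>\<^bsub>K\<^esub> a \<oplus>\<^bsub>K\<^esub> c) \<odot>\<^bsub>R\<^esub> \<one>\<^bsub>R\<^esub>"
      proof -
        let ?E = "?e \<otimes>\<^bsub>R\<^esub> b" and ?ra = "(?r \<otimes>\<^bsub>K\<^esub> a) \<odot>\<^bsub>R\<^esub> \<one>\<^bsub>R\<^esub>"
        have E: "?E \<in> carrier R" "?ra \<in> carrier R" using e assms r by auto
        have 1: "?e \<otimes>\<^bsub>R\<^esub> (b \<ominus>\<^bsub>R\<^esub> a \<odot>\<^bsub>R\<^esub> \<one>\<^bsub>R\<^esub>) = ?E \<ominus>\<^bsub>R\<^esub> a \<odot>\<^bsub>R\<^esub> ?e"
          using e assms by (simp add: a_minus_def R.r_distr R.r_minus scalar_commute)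
        have 2: "?E \<otimes>\<^bsub>R\<^esub> (b \<ominus>\<^bsub>R\<^esub> a \<odot>\<^bsub>R\<^esub> \<one>\<^bsub>R\<^esub>) = ?E \<otimes>\<^bsub>R\<^esub> b \<ominus>\<^bsub>R\<^esub> a \<odot>\<^bsub>R\<^esub> ?E"
          using E assms by (simp add: a_minus_def R.r_distr R.r_minus scalar_commute)
        have 3: "(?r \<odot>\<^bsub>R\<^esub> \<one>\<^bsub>R\<^esub>) \<otimes>\<^bsub>R\<^esub> (b \<ominus>\<^bsub>R\<^esub> a \<odot>\<^bsub>R\<^esub> \<one>\<^bsub>R\<^esub>) = ?r \<odot>\<^bsub>R\<^esub> b \<ominus>\<^bsub>R\<^esub> ?ra"
          using r assms
          by (simp add: a_minus_def R.r_distr R.r_minus smult_mult_left V.smult_r_distr V.smult_assoc1)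
        have 4: "(?E \<ominus>\<^bsub>R\<^esub> a \<odot>\<^bsub>R\<^esub> ?e) \<otimes>\<^bsub>R\<^esub> b = ?E \<otimes>\<^bsub>R\<^esub> b \<ominus>\<^bsub>R\<^esub> a \<odot>\<^bsub>R\<^esub> ?E"
          using E e assms by (simp add: a_minus_def R.l_distr R.l_minus smult_mult_left)
        let ?A = "?E \<otimes>\<^bsub>R\<^esub> b \<ominus>\<^bsub>R\<^esub> a \<odot>\<^bsub>R\<^esub> ?E" and ?B = "?r \<odot>\<^bsub>R\<^esub> b" and ?C = "c \<odot>\<^bsub>R\<^esub> \<one>\<^bsub>R\<^esub>"
        have cl: "?A \<in> carrier R" "?B \<in> carrier R" "?C \<in> carrier R" using E r assms pc by auto
        have "(?E \<ominus>\<^bsub>R\<^esub> a \<odot>\<^bsub>R\<^esub> ?e \<oplus>\<^bsub>R\<^esub> ?r \<odot>\<^bsub>R\<^esub> \<one>\<^bsub>R\<^esub>) \<otimes>\<^bsub>R\<^esub> b = ?A \<oplus>\<^bsub>R\<^esub> ?B"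
          using E e r assms by (subst R.l_distr) (auto simp: 4 smult_mult_left)
        moreover have "(?E \<oplus>\<^bsub>R\<^esub> ?r \<odot>\<^bsub>R\<^esub> \<one>\<^bsub>R\<^esub>) \<otimes>\<^bsub>R\<^esub> (b \<ominus>\<^bsub>R\<^esub> a \<odot>\<^bsub>R\<^esub> \<one>\<^bsub>R\<^esub>) = ?A \<oplus>\<^bsub>R\<^esub> (?B \<ominus>\<^bsub>R\<^esub> ?ra)"
          using E e r assms by (subst R.l_distr) (auto simp: 2 3)
        moreover have "(?r \<otimes>\<^bsub>K\<^esub> a \<oplus>\<^bsub>K\<^esub> c) \<odot>\<^bsub>R\<^esub> \<one>\<^bsub>R\<^esub> = ?ra \<oplus>\<^bsub>R\<^esub> ?C"
          using r assms pc by (simp add: V.smult_l_distr)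
        moreover have "?A \<oplus>\<^bsub>R\<^esub> ?B \<oplus>\<^bsub>R\<^esub> ?C = ?A \<oplus>\<^bsub>R\<^esub> (?B \<ominus>\<^bsub>R\<^esub> ?ra) \<oplus>\<^bsub>R\<^esub> (?ra \<oplus>\<^bsub>R\<^esub> ?C)"
          using cl E(2) by (simp add: a_minus_def[of R "?B"] V.M.a_assoc V.M.r_neg1 V.M.r_neg2)
        ultimately show ?thesis unfolding 1 by simp
      qed
      finally show ?thesis
        unfolding ev_snoc[OF s(1) r assms(3)] eval_snoc[OF pc assms(2)] .
    qed
    moreover have "set (s @ [?r]) \<subseteq> carrier K" "length (s @ [?r]) = length (p @ [c]) - 1"
      using s(1,2) r False by auto
    ultimately show ?thesis by blast
  qed
qed

lemma ev_normalize:
  assumes "set p \<subseteq> carrier K" "b \<in> carrier R" shows "ev b (V.normalize p) = ev b p"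
  using assms
proof (induction p)
  case (Cons c p)
  then show ?case using ev_closed[of p b] by (auto simp: ev_Cons)
qed simp

lemma polyf_normalE:
  assumes "polyf b \<phi> z" "b \<in> carrier R"
  obtains q where "q \<in> carrier (poly_ring K)" "\<forall>t\<in>carrier K. \<phi> t = V.eval q t" "z = ev b q"
proof -
  obtain p where p: "set p \<subseteq> carrier K" "\<forall>t\<in>carrier K. \<phi> t = V.eval p t" "z = ev b p"
    using assms unfolding polyf_def by blast
  have "V.normalize p \<in> carrier (poly_ring K)"
    using V.normalize_gives_polynomial[OF p(1)] by (simp add: univ_poly_carrier)
  moreover have "\<forall>t\<in>carrier K. \<phi> t = V.eval (V.normalize p) t"
    using p V.eval_normalize by auto
  ultimately show ?thesis using that p ev_normalize[OF p(1) assms(2)] by metis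
qed

lemma poly_ring_set: "q \<in> carrier (poly_ring K) \<Longrightarrow> set q \<subseteq> carrier K"
  using V.polynomial_in_carrier[OF V.carrier_is_subring] by (simp add: univ_poly_carrier[symmetric])

lemma algebraic_elementI:
  assumes "polyf b \<phi> \<zero>\<^bsub>R\<^esub>" "b \<in> carrier R" "t0 \<in> carrier K" "\<phi> t0 \<noteq> \<zero>\<^bsub>K\<^esub>"
  shows "algebraic_element K R b"
proof -
  obtain q where q: "q \<in> carrier (poly_ring K)" "\<forall>t\<in>carrier K. \<phi> t = V.eval q t" "\<zero>\<^bsub>R\<^esub> = ev b q"
    using polyf_normalE[OF assms(1,2)] .
  then have "q \<noteq> []" using assms by auto
  then show ?thesis unfolding algebraic_element_def using q unfolding ev_def
    by (intro bexI[of _ q]) (auto simp: univ_poly_zero)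
qed

text \<open>Leading zeros are allowed, so the distinction is made on \<open>V.normalize p\<close>;
  the zero polynomial falls under the first alternative.\<close>

lemma algebraically_closed_root:
  assumes ac: "algebraically_closed K" and p: "set p \<subseteq> carrier K"
  shows "(\<exists>a\<in>carrier K. V.eval p a = \<zero>\<^bsub>K\<^esub>) \<or> (\<exists>c\<in>carrier K. c \<noteq> \<zero>\<^bsub>K\<^esub> \<and> V.normalize p = [c])"
proof -
  let ?q = "V.normalize p"
  have q: "?q \<in> carrier (poly_ring K)"
    using V.normalize_gives_polynomial[OF p] by (simp add: univ_poly_carrier)
  then have qp: "polynomial\<^bsub>K\<^esub> (carrier K) ?q" by (simp add: univ_poly_carrier)
  show ?thesis
  proof (cases "length ?q \<le> 1")
    case True
    show ?thesis
    proof (cases ?q)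
      case Nil
      then have "V.eval p \<zero>\<^bsub>K\<^esub> = \<zero>\<^bsub>K\<^esub>" using V.eval_normalize[OF p, of "\<zero>\<^bsub>K\<^esub>"] by simp
      then show ?thesis by blast
    next
      case (Cons c l)
      then have "?q = [c]" using True by simp
      then show ?thesis using qp unfolding polynomial_def by auto
    qed
  next
    case False
    have "V.splitted ?q" using algebraically_closed.roots_over_carrier[OF ac q] .
    then have "size (V.roots ?q) > 0" using False unfolding V.splitted_def by simp
    then obtain a where "a \<in># V.roots ?q" by (metis multiset_nonemptyE size_empty less_irrefl)
    then have "V.is_root ?q a" using V.roots_mem_iff_is_root[OF q] by blast
    then show ?thesis using V.eval_normalize[OF p] unfolding V.is_root_def by auto
  qed
qed

end

section \<open>Maximal left ideals\<close>

definition maximal_left_ideal :: "'a set \<Rightarrow> ('a, 'b) ring_scheme \<Rightarrow> bool" where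
  "maximal_left_ideal L R \<longleftrightarrow> left_ideal L R \<and> L \<noteq> carrier R \<and>
    (\<forall>J. left_ideal J R \<and> L \<subseteq> J \<longrightarrow> J = L \<or> J = carrier R)"

context k_algebra
begin

text \<open>Calculations in the left module \<open>R / L\<close> are carried out on representatives
  with this congruence; cosets appear only when an actual module or quotient algebra is
  required.\<close>

definition eqm :: "'a set \<Rightarrow> 'a \<Rightarrow> 'a \<Rightarrow> bool" where
  "eqm L x y \<longleftrightarrow> x \<in> carrier R \<and> y \<in> carrier R \<and> x \<ominus>\<^bsub>R\<^esub> y \<in> L"

lemma eqm_carrier: "eqm L x y \<Longrightarrow> x \<in> carrier R" "eqm L x y \<Longrightarrow> y \<in> carrier R"
  by (simp_all add: eqm_def)

lemma eqm_refl: "submodule K L R \<Longrightarrow> x \<in> carrier R \<Longrightarrow> eqm L x x"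
  by (simp add: eqm_def a_minus_def V.M.r_neg submodule.zero_closed)

lemma eqm_zero: "x \<in> carrier R \<Longrightarrow> x \<in> L \<Longrightarrow> eqm L x \<zero>\<^bsub>R\<^esub>"
  by (simp add: eqm_def a_minus_def)

lemma eqm_sym:
  assumes "submodule K L R" "eqm L x y" shows "eqm L y x"
proof -
  have "y \<ominus>\<^bsub>R\<^esub> x = \<ominus>\<^bsub>R\<^esub> (x \<ominus>\<^bsub>R\<^esub> y)"
    using eqm_carrier[OF assms(2)] by (simp add: a_minus_def V.M.minus_add V.M.a_comm)
  then show ?thesis using assms submodule_neg unfolding eqm_def by metis
qed

lemma eqm_trans:
  assumes "submodule K L R" "eqm L x y" "eqm L y z" shows "eqm L x z"
proof -
  have "x \<ominus>\<^bsub>R\<^esub> z = (x \<ominus>\<^bsub>R\<^esub> y) \<oplus>\<^bsub>R\<^esub> (y \<ominus>\<^bsub>R\<^esub> z)"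
    using eqm_carrier[OF assms(2)] eqm_carrier[OF assms(3)]
    by (simp add: a_minus_def V.M.a_assoc V.M.r_neg1)
  then show ?thesis using assms submodule.m_closed[OF assms(1)] unfolding eqm_def by metis
qed

lemma eqm_mem:
  assumes "submodule K L R" "eqm L x y" "y \<in> L" shows "x \<in> L"
proof -
  have "x = (x \<ominus>\<^bsub>R\<^esub> y) \<oplus>\<^bsub>R\<^esub> y"
    using eqm_carrier[OF assms(2)] by (simp add: a_minus_def V.M.a_assoc V.M.l_neg)
  then show ?thesis using assms submodule.m_closed[OF assms(1)] unfolding eqm_def by metis
qed

lemma eqm_add:
  assumes "submodule K L R" "eqm L x y" "eqm L z w" shows "eqm L (x \<oplus>\<^bsub>R\<^esub> z) (y \<oplus>\<^bsub>R\<^esub> w)"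
proof -
  have "(x \<oplus>\<^bsub>R\<^esub> z) \<ominus>\<^bsub>R\<^esub> (y \<oplus>\<^bsub>R\<^esub> w) = (x \<ominus>\<^bsub>R\<^esub> y) \<oplus>\<^bsub>R\<^esub> (z \<ominus>\<^bsub>R\<^esub> w)"
    using eqm_carrier[OF assms(2)] eqm_carrier[OF assms(3)]
    by (simp add: a_minus_def V.M.minus_add V.M.a_assoc V.M.a_lcomm)
  then show ?thesis using assms submodule.m_closed[OF assms(1)] unfolding eqm_def
    by (metis R.ring_simprules(1))
qed

lemma eqm_smult:
  assumes "submodule K L R" "eqm L x y" "c \<in> carrier K"
  shows "eqm L (c \<odot>\<^bsub>R\<^esub> x) (c \<odot>\<^bsub>R\<^esub> y)"
proof -
  have "c \<odot>\<^bsub>R\<^esub> x \<ominus>\<^bsub>R\<^esub> c \<odot>\<^bsub>R\<^esub> y = c \<odot>\<^bsub>R\<^esub> (x \<ominus>\<^bsub>R\<^esub> y)"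
    using eqm_carrier[OF assms(2)] assms(3) by (simp add: a_minus_def V.smult_r_distr V.smult_r_minus)
  then show ?thesis using assms submodule.smult_closed[OF assms(1)] unfolding eqm_def by simp
qed

lemma eqm_lmult:
  assumes "left_ideal L R" "eqm L x y" "r \<in> carrier R"
  shows "eqm L (r \<otimes>\<^bsub>R\<^esub> x) (r \<otimes>\<^bsub>R\<^esub> y)"
proof -
  have "r \<otimes>\<^bsub>R\<^esub> x \<ominus>\<^bsub>R\<^esub> r \<otimes>\<^bsub>R\<^esub> y = r \<otimes>\<^bsub>R\<^esub> (x \<ominus>\<^bsub>R\<^esub> y)"
    using eqm_carrier[OF assms(2)] assms(3) by (simp add: a_minus_def R.r_distr R.r_minus)
  then show ?thesis using assms left_ideal_closed(4)[OF assms(1)] unfolding eqm_def by simp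
qed

lemma eqm_rmult:
  assumes "\<And>l. l \<in> L \<Longrightarrow> l \<otimes>\<^bsub>R\<^esub> b \<in> N" "eqm L x y" "b \<in> carrier R"
  shows "eqm N (x \<otimes>\<^bsub>R\<^esub> b) (y \<otimes>\<^bsub>R\<^esub> b)"
proof -
  have "x \<otimes>\<^bsub>R\<^esub> b \<ominus>\<^bsub>R\<^esub> y \<otimes>\<^bsub>R\<^esub> b = (x \<ominus>\<^bsub>R\<^esub> y) \<otimes>\<^bsub>R\<^esub> b"
    using eqm_carrier[OF assms(2)] assms(3) by (simp add: a_minus_def R.l_distr R.l_minus)
  then show ?thesis using assms unfolding eqm_def by simp
qed

section \<open>Left ideals, and inverses modulo a maximal one\<close>

lemma left_idealI:
  assumes "L \<subseteq> carrier R" "\<zero>\<^bsub>R\<^esub> \<in> L"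
    and "\<And>x y. x \<in> L \<Longrightarrow> y \<in> L \<Longrightarrow> x \<oplus>\<^bsub>R\<^esub> y \<in> L"
    and "\<And>r x. r \<in> carrier R \<Longrightarrow> x \<in> L \<Longrightarrow> r \<otimes>\<^bsub>R\<^esub> x \<in> L"
  shows "left_ideal L R"
proof -
  have "\<ominus>\<^bsub>R\<^esub> x \<in> L" if "x \<in> L" for x
  proof -
    have x: "x \<in> carrier R" using that assms(1) by blast
    then have "(\<ominus>\<^bsub>R\<^esub> \<one>\<^bsub>R\<^esub>) \<otimes>\<^bsub>R\<^esub> x = \<ominus>\<^bsub>R\<^esub> x" by (simp add: R.l_minus)
    then show ?thesis using assms(4)[of "\<ominus>\<^bsub>R\<^esub> \<one>\<^bsub>R\<^esub>" x] that by simp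
  qed
  then have "additive_subgroup L R"
    using assms by (intro additive_subgroupI V.M.add.subgroupI) auto
  then show ?thesis unfolding left_ideal_def using assms(4) by blast
qed

lemma left_ideal_one: "left_ideal L R \<Longrightarrow> \<one>\<^bsub>R\<^esub> \<in> L \<Longrightarrow> L = carrier R"
  using left_ideal_closed(1,4)[of L] R.r_one by (metis subsetI subset_antisym)

lemma left_ideal_colon:
  assumes "left_ideal L R" "a \<in> carrier R"
  shows "left_ideal {r \<in> carrier R. r \<otimes>\<^bsub>R\<^esub> a \<in> L} R"
  using assms left_ideal_closed[OF assms(1)]
  by (intro left_idealI) (auto simp: R.l_distr R.m_assoc)

lemma left_ideal_join:
  assumes "left_ideal L R" "u \<in> carrier R"
  shows "left_ideal {l \<oplus>\<^bsub>R\<^esub> r \<otimes>\<^bsub>R\<^esub> u |l r. l \<in> L \<and> r \<in> carrier R} R" (is "left_ideal ?J R")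
proof (rule left_idealI)
  note L = left_ideal_closed[OF assms(1)]
  show "?J \<subseteq> carrier R" using L(1) assms(2) by auto
  have "\<zero>\<^bsub>R\<^esub> = \<zero>\<^bsub>R\<^esub> \<oplus>\<^bsub>R\<^esub> \<zero>\<^bsub>R\<^esub> \<otimes>\<^bsub>R\<^esub> u" using assms(2) by simp
  then show "\<zero>\<^bsub>R\<^esub> \<in> ?J" using L(2) by blast
  show "x \<oplus>\<^bsub>R\<^esub> y \<in> ?J" if xy: "x \<in> ?J" "y \<in> ?J" for x y
  proof -
    from xy obtain l r m s where *: "l \<in> L" "r \<in> carrier R" "x = l \<oplus>\<^bsub>R\<^esub> r \<otimes>\<^bsub>R\<^esub> u"
      "m \<in> L" "s \<in> carrier R" "y = m \<oplus>\<^bsub>R\<^esub> s \<otimes>\<^bsub>R\<^esub> u" by blast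
    then have "l \<in> carrier R" "m \<in> carrier R" using L(1) by auto
    then have "x \<oplus>\<^bsub>R\<^esub> y = (l \<oplus>\<^bsub>R\<^esub> m) \<oplus>\<^bsub>R\<^esub> (r \<oplus>\<^bsub>R\<^esub> s) \<otimes>\<^bsub>R\<^esub> u"
      using * assms(2) by (simp add: R.l_distr V.M.a_assoc V.M.a_lcomm)
    then show ?thesis using * L(3) by blast
  qed
  show "t \<otimes>\<^bsub>R\<^esub> x \<in> ?J" if t: "t \<in> carrier R" and x: "x \<in> ?J" for t x
  proof -
    from x obtain l r where *: "l \<in> L" "r \<in> carrier R" "x = l \<oplus>\<^bsub>R\<^esub> r \<otimes>\<^bsub>R\<^esub> u" by blast
    then have "l \<in> carrier R" using L(1) by auto
    then have "t \<otimes>\<^bsub>R\<^esub> x = t \<otimes>\<^bsub>R\<^esub> l \<oplus>\<^bsub>R\<^esub> (t \<otimes>\<^bsub>R\<^esub> r) \<otimes>\<^bsub>R\<^esub> u"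
      using * t assms(2) by (simp add: R.r_distr R.m_assoc)
    then show ?thesis using * t L(4) R.m_closed by blast
  qed
qed

lemma maximal_left_idealD:
  assumes "maximal_left_ideal L R"
  shows "left_ideal L R" "submodule K L R" "\<one>\<^bsub>R\<^esub> \<notin> L"
  using assms left_ideal_one left_ideal_submodule unfolding maximal_left_ideal_def by blast+

text \<open>A nonzero vector generates the simple module \<open>R / L\<close>: the left ideal
  \<open>L + R u\<close> is larger than \<open>L\<close>, hence everything.\<close>

lemma maximal_left_ideal_inverse:
  assumes "maximal_left_ideal L R" "u \<in> carrier R" "u \<notin> L"
  shows "\<exists>r\<in>carrier R. eqm L (r \<otimes>\<^bsub>R\<^esub> u) \<one>\<^bsub>R\<^esub>"
proof -
  have L: "left_ideal L R" and sm: "submodule K L R" using maximal_left_idealD[OF assms(1)] by auto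
  let ?J = "{l \<oplus>\<^bsub>R\<^esub> r \<otimes>\<^bsub>R\<^esub> u |l r. l \<in> L \<and> r \<in> carrier R}"
  have "L \<subseteq> ?J"
  proof
    fix l assume l: "l \<in> L"
    then have "l = l \<oplus>\<^bsub>R\<^esub> \<zero>\<^bsub>R\<^esub> \<otimes>\<^bsub>R\<^esub> u" using assms(2) left_ideal_closed(1)[OF L] by auto
    then show "l \<in> ?J" using l V.M.zero_closed by blast
  qed
  moreover have "u = \<zero>\<^bsub>R\<^esub> \<oplus>\<^bsub>R\<^esub> \<one>\<^bsub>R\<^esub> \<otimes>\<^bsub>R\<^esub> u" using assms(2) by simp
  then have "u \<in> ?J" using left_ideal_closed(2)[OF L] R.one_closed by blast
  ultimately have "?J = carrier R"
    using assms left_ideal_join[OF L assms(2)] unfolding maximal_left_ideal_def by blast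
  then have "\<one>\<^bsub>R\<^esub> \<in> ?J" by simp
  then obtain l r where lr: "l \<in> L" "r \<in> carrier R" "\<one>\<^bsub>R\<^esub> = l \<oplus>\<^bsub>R\<^esub> r \<otimes>\<^bsub>R\<^esub> u" by blast
  have lc: "l \<in> carrier R" using lr left_ideal_closed(1)[OF L] by blast
  have "\<one>\<^bsub>R\<^esub> \<ominus>\<^bsub>R\<^esub> r \<otimes>\<^bsub>R\<^esub> u = l" using lr lc assms(2) by (simp add: a_minus_def V.M.a_assoc V.M.r_neg)
  then have "eqm L \<one>\<^bsub>R\<^esub> (r \<otimes>\<^bsub>R\<^esub> u)"
    unfolding eqm_def using lr(1,2) assms(2) R.one_closed R.m_closed by metis
  then show ?thesis using eqm_sym[OF sm] lr(2) by blast
qed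

text \<open>The Amitsur--Dixmier trick: uncountably many resolvents \<open>(b - \<lambda>)\<^sup>-\<^sup>1\<close> in an algebra of countable
  dimension are linearly dependent, and clearing denominators gives a polynomial relation.\<close>

lemma uncountable_dependent:
  assumes S: "generates S" and unc: "uncountable \<Lambda>" and y: "\<And>l. l \<in> \<Lambda> \<Longrightarrow> y l \<in> carrier R"
  shows "\<exists>l as. l \<in> \<Lambda> \<and> set as \<subseteq> \<Lambda> \<and> l \<notin> set as \<and> y l \<in> sp (y ` set as)"
proof -
  have S': "S \<subseteq> carrier R" "finite S" using S unfolding generates_def by auto
  \<comment> \<open>\<open>R\<close> is a countable union of finite-dimensional layers, so one layer
    contains \<open>y l\<close> for infinitely many \<open>l\<close>, more than its dimension allows
    to be independent.\<close>
  let ?\<Lambda> = "\<lambda>n. {l \<in> \<Lambda>. y l \<in> sp (words R S n)}"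
  have "\<exists>n. infinite (?\<Lambda> n)"
  proof (rule ccontr)
    assume "\<nexists>n. infinite (?\<Lambda> n)"
    then have "countable (\<Union>n. ?\<Lambda> n)" by (intro countable_UN) (auto intro: countable_finite)
    moreover have "\<Lambda> \<subseteq> (\<Union>n. ?\<Lambda> n)" using S y unfolding generates_def by blast
    ultimately show False using unc countable_subset by blast
  qed
  then obtain n where n: "infinite (?\<Lambda> n)" by blast
  let ?W = "words R S n"
  obtain F where F: "F \<subseteq> ?\<Lambda> n" "finite F" "card F = card ?W + 1"
    using infinite_arbitrarily_large[OF n] by blast
  obtain ls where ls: "set ls = F" "distinct ls" using finite_distinct_list[OF F(2)] by blast
  have "length ls = card ?W + 1" using distinct_card[OF ls(2)] ls(1) F(3) by simp
  moreover have "set (map y ls) \<subseteq> sp ({} \<union> ?W)" using F ls by auto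
  ultimately have "\<not> indep {} (map y ls)"
    using indep_length_le[of ?W "map y ls" "{}"] finite_words[OF S'(2)] words_closed[OF S'(1)] by force
  then obtain as f bs where *: "map y ls = as @ f # bs" "f \<in> sp ({} \<union> set as)"
    by (rule not_indepE)
  from *(1) obtain as' r where r: "ls = as' @ r" "as = map y as'" "f # bs = map y r"
    unfolding map_eq_append_conv by (elim exE conjE)
  from r(3) obtain l bs' where l: "r = l # bs'" "y l = f" by (cases r) auto
  have "l \<in> \<Lambda>" "set as' \<subseteq> \<Lambda>" "l \<notin> set as'" using r l ls F by auto
  moreover have "y l \<in> sp (y ` set as')" using *(2) r(2) l(2) by auto
  ultimately show ?thesis by blast
qed

text \<open>The version relative to a left ideal with \<open>L b \<subseteq> L\<close> serves two
  purposes: \<open>L = 0\<close> shows that \<open>x\<close> would be algebraic, and a maximal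
  \<open>L\<close> gives Schur's lemma. Each \<open>y\<close> is only a left inverse modulo
  \<open>L\<close>.\<close>

lemma dixmier:
  assumes S: "generates S" and unc: "uncountable \<Lambda>" "\<Lambda> \<subseteq> carrier K" and L: "left_ideal L R"
    and b: "b \<in> carrier R" "\<And>l. l \<in> L \<Longrightarrow> l \<otimes>\<^bsub>R\<^esub> b \<in> L"
    and y: "\<And>\<mu>. \<mu> \<in> \<Lambda> \<Longrightarrow> \<exists>y\<in>carrier R. eqm L (y \<otimes>\<^bsub>R\<^esub> (b \<ominus>\<^bsub>R\<^esub> \<mu> \<odot>\<^bsub>R\<^esub> \<one>\<^bsub>R\<^esub>)) \<one>\<^bsub>R\<^esub>"
  shows "\<exists>\<phi> w. polyf b \<phi> w \<and> w \<in> L \<and> (\<exists>t\<in>carrier K. \<phi> t \<noteq> \<zero>\<^bsub>K\<^esub>)"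
proof -
  let ?b = "\<lambda>\<mu>. b \<ominus>\<^bsub>R\<^esub> \<mu> \<odot>\<^bsub>R\<^esub> \<one>\<^bsub>R\<^esub>"
  have sm: "submodule K L R" using left_ideal_submodule[OF L] .
  have bc: "?b \<mu> \<in> carrier R" if "\<mu> \<in> carrier K" for \<mu> using that b by simp
  have Lb: "l \<otimes>\<^bsub>R\<^esub> ?b \<mu> \<in> L" if "l \<in> L" "\<mu> \<in> carrier K" for l \<mu>
  proof -
    have lc: "l \<in> carrier R" using that left_ideal_closed(1)[OF L] by blast
    have "l \<otimes>\<^bsub>R\<^esub> ?b \<mu> = l \<otimes>\<^bsub>R\<^esub> b \<ominus>\<^bsub>R\<^esub> \<mu> \<odot>\<^bsub>R\<^esub> l"
      using that lc b(1) by (simp add: a_minus_def R.r_distr R.r_minus scalar_commute)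
    then show ?thesis
      using submodule_minus[OF sm b(2)[OF that(1)] submodule.smult_closed[OF sm that(2,1)]] by simp
  qed
  obtain y where y: "\<And>\<mu>. \<mu> \<in> \<Lambda> \<Longrightarrow> y \<mu> \<in> carrier R \<and> eqm L (y \<mu> \<otimes>\<^bsub>R\<^esub> ?b \<mu>) \<one>\<^bsub>R\<^esub>"
    using bchoice[of \<Lambda> "\<lambda>\<mu> y. y \<in> carrier R \<and> eqm L (y \<otimes>\<^bsub>R\<^esub> ?b \<mu>) \<one>\<^bsub>R\<^esub>"] y by blast
  obtain l0 as where l0: "l0 \<in> \<Lambda>" "l0 \<notin> set as" and as: "set as \<subseteq> \<Lambda>" and dep: "y l0 \<in> sp (y ` set as)"
    using uncountable_dependent[OF S unc(1), of y] y by blast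
  \<comment> \<open>\<open>P ms\<close> is the product of the factors \<open>b - \<mu>\<close>, the
    common denominator, and \<open>\<pi> ms\<close> is its scalar polynomial function.\<close>
  define P where "P = (\<lambda>as. foldr (\<lambda>\<mu> z. z \<otimes>\<^bsub>R\<^esub> ?b \<mu>) as \<one>\<^bsub>R\<^esub>)"
  define \<pi> where "\<pi> = (\<lambda>as t. foldr (\<lambda>\<mu> z. z \<otimes>\<^bsub>K\<^esub> (t \<ominus>\<^bsub>K\<^esub> \<mu>)) as \<one>\<^bsub>K\<^esub>)"
  have P_poly: "polyf b (\<pi> ms) (P ms)" if "set ms \<subseteq> carrier K" for ms
    using that
  proof (induction ms)
    case Nil
    then show ?case using polyf_const[of "\<one>\<^bsub>K\<^esub>" b] b unfolding P_def \<pi>_def by simp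
  next
    case (Cons m ms)
    then show ?case using polyf_times_linear[of b "\<pi> ms" "P ms" m] b unfolding P_def \<pi>_def by simp
  qed
  have Pc: "P ms \<in> carrier R" if "set ms \<subseteq> carrier K" for ms using polyf_closed[OF P_poly[OF that] b(1)] .
  have LP: "l \<otimes>\<^bsub>R\<^esub> P ms \<in> L" if "l \<in> L" "set ms \<subseteq> carrier K" for l ms
    using that(2)
  proof (induction ms)
    case Nil
    then show ?case using that(1) left_ideal_closed(1)[OF L] unfolding P_def by auto
  next
    case (Cons m ms)
    have lc: "l \<in> carrier R" using that left_ideal_closed(1)[OF L] by blast
    have "l \<otimes>\<^bsub>R\<^esub> P (m # ms) = (l \<otimes>\<^bsub>R\<^esub> P ms) \<otimes>\<^bsub>R\<^esub> ?b m"
      using lc Pc[of ms] bc[of m] Cons.prems unfolding P_def by (simp add: R.m_assoc)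
    then show ?case using Lb Cons by simp
  qed
  have comm_b: "?b \<mu> \<otimes>\<^bsub>R\<^esub> ?b \<nu> = ?b \<nu> \<otimes>\<^bsub>R\<^esub> ?b \<mu>" if "\<mu> \<in> carrier K" "\<nu> \<in> carrier K" for \<mu> \<nu>
  proof -
    have "?b \<mu> \<otimes>\<^bsub>R\<^esub> ?b \<nu> = ?b \<mu> \<otimes>\<^bsub>R\<^esub> b \<ominus>\<^bsub>R\<^esub> \<nu> \<odot>\<^bsub>R\<^esub> ?b \<mu>"
      using bc[OF that(1)] b(1) that by (simp add: a_minus_def[of R b "\<nu> \<odot>\<^bsub>R\<^esub> \<one>\<^bsub>R\<^esub>"] a_minus_def[of R "?b \<mu> \<otimes>\<^bsub>R\<^esub> b"]
          R.r_distr[of b "\<ominus>\<^bsub>R\<^esub> (\<nu> \<odot>\<^bsub>R\<^esub> \<one>\<^bsub>R\<^esub>)" "?b \<mu>"] R.r_minus scalar_commute)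
    moreover have "?b \<mu> \<otimes>\<^bsub>R\<^esub> b = b \<otimes>\<^bsub>R\<^esub> ?b \<mu>"
      using b(1) that by (simp add: a_minus_def R.l_distr R.r_distr R.l_minus R.r_minus scalar_commute smult_mult_left)
    moreover have "?b \<nu> \<otimes>\<^bsub>R\<^esub> ?b \<mu> = b \<otimes>\<^bsub>R\<^esub> ?b \<mu> \<ominus>\<^bsub>R\<^esub> \<nu> \<odot>\<^bsub>R\<^esub> ?b \<mu>"
      using bc[OF that(1)] b(1) that by (simp add: a_minus_def[of R b "\<nu> \<odot>\<^bsub>R\<^esub> \<one>\<^bsub>R\<^esub>"] a_minus_def[of R "b \<otimes>\<^bsub>R\<^esub> ?b \<mu>"]
          R.l_distr[of b "\<ominus>\<^bsub>R\<^esub> (\<nu> \<odot>\<^bsub>R\<^esub> \<one>\<^bsub>R\<^esub>)" "?b \<mu>"] R.l_minus smult_mult_left)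
    ultimately show ?thesis by simp
  qed
  have comm: "P ms \<otimes>\<^bsub>R\<^esub> ?b \<mu> = ?b \<mu> \<otimes>\<^bsub>R\<^esub> P ms" if "set ms \<subseteq> carrier K" "\<mu> \<in> carrier K" for ms \<mu>
    using that(1)
  proof (induction ms)
    case Nil
    then show ?case using bc[OF that(2)] unfolding P_def by simp
  next
    case (Cons m ms)
    let ?p = "P ms"
    have pc: "?p \<in> carrier R" "?b m \<in> carrier R" "?b \<mu> \<in> carrier R" using Pc bc that Cons.prems by auto
    have "P (m # ms) \<otimes>\<^bsub>R\<^esub> ?b \<mu> = ?p \<otimes>\<^bsub>R\<^esub> (?b m \<otimes>\<^bsub>R\<^esub> ?b \<mu>)"
      using pc unfolding P_def by (simp add: R.m_assoc)
    also have "\<dots> = (?p \<otimes>\<^bsub>R\<^esub> ?b \<mu>) \<otimes>\<^bsub>R\<^esub> ?b m"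
      using comm_b[of m \<mu>] that Cons.prems pc by (simp add: R.m_assoc)
    also have "\<dots> = ?b \<mu> \<otimes>\<^bsub>R\<^esub> P (m # ms)"
      using Cons pc unfolding P_def by (simp add: R.m_assoc)
    finally show ?case .
  qed
  \<comment> \<open>The factors commute, so the factor for \<open>\<mu>\<close> can be moved next to
    its left inverse \<open>y \<mu>\<close>; the error stays in \<open>L\<close> because
    \<open>L\<close> is stable under right multiplication by \<open>P ms\<close>.\<close>
  have yP: "eqm L (y \<mu> \<otimes>\<^bsub>R\<^esub> P ms \<otimes>\<^bsub>R\<^esub> ?b \<mu>) (P ms)" if "\<mu> \<in> \<Lambda>" "set ms \<subseteq> carrier K" for \<mu> ms
  proof -
    have m: "\<mu> \<in> carrier K" "y \<mu> \<in> carrier R" using that unc(2) y by auto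
    have "eqm L (y \<mu> \<otimes>\<^bsub>R\<^esub> ?b \<mu> \<otimes>\<^bsub>R\<^esub> P ms) (\<one>\<^bsub>R\<^esub> \<otimes>\<^bsub>R\<^esub> P ms)"
      by (rule eqm_rmult[OF LP[OF _ that(2)]]) (use y that Pc in auto)
    then show ?thesis using comm[OF that(2) m(1)] m bc Pc[OF that(2)] by (simp add: R.m_assoc)
  qed
  have clear: "\<exists>\<phi> w. polyf b \<phi> w \<and> eqm L (y \<mu> \<otimes>\<^bsub>R\<^esub> P ms) w"
    if "\<mu> \<in> set ms" "set ms \<subseteq> \<Lambda>" for \<mu> ms
    using that
  proof (induction ms)
    case (Cons m ms)
    have sets: "set ms \<subseteq> carrier K" "m \<in> carrier K" "\<mu> \<in> \<Lambda>" "m \<in> \<Lambda>" using Cons.prems unc by auto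
    have ym: "y \<mu> \<in> carrier R" using y sets by blast
    have eq: "y \<mu> \<otimes>\<^bsub>R\<^esub> P (m # ms) = y \<mu> \<otimes>\<^bsub>R\<^esub> P ms \<otimes>\<^bsub>R\<^esub> ?b m"
      using ym Pc[OF sets(1)] bc[OF sets(2)] unfolding P_def by (simp add: R.m_assoc)
    show ?case
    proof (cases "\<mu> = m")
      case True
      then show ?thesis using yP[OF sets(3,1)] P_poly[OF sets(1)] unfolding eq by blast
    next
      case False
      then obtain \<phi> w where w: "polyf b \<phi> w" "eqm L (y \<mu> \<otimes>\<^bsub>R\<^esub> P ms) w"
        using Cons by auto
      then have "eqm L (y \<mu> \<otimes>\<^bsub>R\<^esub> P ms \<otimes>\<^bsub>R\<^esub> ?b m) (w \<otimes>\<^bsub>R\<^esub> ?b m)"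
        by (intro eqm_rmult[OF Lb[OF _ sets(2)]] bc sets)
      then show ?thesis using polyf_times_linear[OF w(1) sets(2) b(1)] unfolding eq by blast
    qed
  qed simp
  have asK: "set as \<subseteq> carrier K" "l0 \<in> carrier K" "y l0 \<in> carrier R" using as unc l0 y by auto
  \<comment> \<open>The elements that multiplication by \<open>P as\<close> turns into polynomials
    in \<open>b\<close> modulo \<open>L\<close> form a subspace. It contains the resolvents indexed
    by \<open>as\<close>, hence also \<open>y l0\<close>.\<close>
  let ?N = "{z \<in> carrier R. \<exists>\<phi> w. polyf b \<phi> w \<and> eqm L (z \<otimes>\<^bsub>R\<^esub> P as) w}"
  have "submodule K ?N R"
  proof (rule submoduleI)
    show "\<zero>\<^bsub>R\<^esub> \<in> ?N" using polyf_zero eqm_refl[OF sm] Pc[OF asK(1)] by fastforce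
    show "v \<oplus>\<^bsub>R\<^esub> w \<in> ?N" if vw: "v \<in> ?N" "w \<in> ?N" for v w
    proof -
      from vw obtain \<phi> z \<psi> x where "polyf b \<phi> z" "eqm L (v \<otimes>\<^bsub>R\<^esub> P as) z"
        "polyf b \<psi> x" "eqm L (w \<otimes>\<^bsub>R\<^esub> P as) x" by blast
      then have "polyf b (\<lambda>t. \<phi> t \<oplus>\<^bsub>K\<^esub> \<psi> t) (z \<oplus>\<^bsub>R\<^esub> x)"
        "eqm L (v \<otimes>\<^bsub>R\<^esub> P as \<oplus>\<^bsub>R\<^esub> w \<otimes>\<^bsub>R\<^esub> P as) (z \<oplus>\<^bsub>R\<^esub> x)"
        using polyf_add[OF _ _ b(1)] eqm_add[OF sm] by blast+
      moreover have "(v \<oplus>\<^bsub>R\<^esub> w) \<otimes>\<^bsub>R\<^esub> P as = v \<otimes>\<^bsub>R\<^esub> P as \<oplus>\<^bsub>R\<^esub> w \<otimes>\<^bsub>R\<^esub> P as"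
        using vw Pc[OF asK(1)] by (simp add: R.l_distr)
      moreover have "v \<oplus>\<^bsub>R\<^esub> w \<in> carrier R" using vw by simp
      ultimately show ?thesis by force
    qed
    show "c \<odot>\<^bsub>R\<^esub> v \<in> ?N" if c: "c \<in> carrier K" and v: "v \<in> ?N" for c v
    proof -
      from v obtain \<phi> z where "polyf b \<phi> z" "eqm L (v \<otimes>\<^bsub>R\<^esub> P as) z" by blast
      then have "polyf b (\<lambda>t. c \<otimes>\<^bsub>K\<^esub> \<phi> t) (c \<odot>\<^bsub>R\<^esub> z)" "eqm L (c \<odot>\<^bsub>R\<^esub> (v \<otimes>\<^bsub>R\<^esub> P as)) (c \<odot>\<^bsub>R\<^esub> z)"
        using polyf_smult[OF _ c b(1)] eqm_smult[OF sm _ c] by blast+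
      moreover have "(c \<odot>\<^bsub>R\<^esub> v) \<otimes>\<^bsub>R\<^esub> P as = c \<odot>\<^bsub>R\<^esub> (v \<otimes>\<^bsub>R\<^esub> P as)"
        using v c Pc[OF asK(1)] by (simp add: smult_mult_left)
      moreover have "c \<odot>\<^bsub>R\<^esub> v \<in> carrier R" using v c by simp
      ultimately show ?thesis by force
    qed
  qed blast
  moreover have "y ` set as \<subseteq> ?N" using clear[OF _ as] y as by blast
  ultimately have "y l0 \<in> ?N" using span_minimal dep by blast
  then obtain \<phi> w where w: "polyf b \<phi> w" "eqm L (y l0 \<otimes>\<^bsub>R\<^esub> P as) w" by blast
  have wc: "w \<in> carrier R" using w polyf_closed b by blast
  have "eqm L (y l0 \<otimes>\<^bsub>R\<^esub> P as \<otimes>\<^bsub>R\<^esub> ?b l0) (w \<otimes>\<^bsub>R\<^esub> ?b l0)"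
    by (rule eqm_rmult[OF Lb[OF _ asK(2)] w(2) bc[OF asK(2)]])
  then have "eqm L (P as) (w \<otimes>\<^bsub>R\<^esub> ?b l0)"
    using eqm_trans[OF sm eqm_sym[OF sm yP[OF l0(1) asK(1)]]] by blast
  then have mem: "P as \<ominus>\<^bsub>R\<^esub> w \<otimes>\<^bsub>R\<^esub> ?b l0 \<in> L" unfolding eqm_def by blast
  \<comment> \<open>The relation \<open>P as = w (b - l0)\<close> modulo \<open>L\<close> as one
    polynomial. At \<open>l0\<close> its second term vanishes, while
    \<open>\<pi> as l0 \<noteq> 0\<close> because \<open>l0\<close> is not in \<open>as\<close>; so
    it is not the zero polynomial.\<close>
  let ?\<psi> = "\<lambda>t. \<pi> as t \<oplus>\<^bsub>K\<^esub> (\<ominus>\<^bsub>K\<^esub> \<one>\<^bsub>K\<^esub>) \<otimes>\<^bsub>K\<^esub> (\<phi> t \<otimes>\<^bsub>K\<^esub> (t \<ominus>\<^bsub>K\<^esub> l0))"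
  have "polyf b ?\<psi> (P as \<oplus>\<^bsub>R\<^esub> (\<ominus>\<^bsub>K\<^esub> \<one>\<^bsub>K\<^esub>) \<odot>\<^bsub>R\<^esub> (w \<otimes>\<^bsub>R\<^esub> ?b l0))"
    using P_poly[OF asK(1)] polyf_times_linear[OF w(1) asK(2) b(1)] b(1)
    by (intro polyf_add polyf_smult) auto
  moreover have "P as \<oplus>\<^bsub>R\<^esub> (\<ominus>\<^bsub>K\<^esub> \<one>\<^bsub>K\<^esub>) \<odot>\<^bsub>R\<^esub> (w \<otimes>\<^bsub>R\<^esub> ?b l0) = P as \<ominus>\<^bsub>R\<^esub> w \<otimes>\<^bsub>R\<^esub> ?b l0"
    unfolding smult_neg_one[OF R.m_closed[OF wc bc[OF asK(2)]]]
    by (rule a_minus_def[symmetric])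
  moreover have "?\<psi> l0 \<noteq> \<zero>\<^bsub>K\<^esub>"
  proof -
    have "\<pi> as l0 \<in> carrier K \<and> \<pi> as l0 \<noteq> \<zero>\<^bsub>K\<^esub>"
      using l0(2) asK(1)
    proof (induction as)
      case (Cons m ms)
      then have "l0 \<ominus>\<^bsub>K\<^esub> m \<noteq> \<zero>\<^bsub>K\<^esub>" using asK(2) by auto
      then show ?case using Cons asK(2) unfolding \<pi>_def by (simp add: V.integral_iff)
    qed (simp add: \<pi>_def)
    moreover have "\<phi> l0 \<in> carrier K" using polyf_fun_closed[OF w(1) asK(2)] .
    ultimately show ?thesis using asK(2) by (simp add: a_minus_def V.R.r_neg)
  qed
  ultimately show ?thesis using mem asK(2)
    by (intro exI[of _ ?\<psi>] exI[of _ "P as \<ominus>\<^bsub>R\<^esub> w \<otimes>\<^bsub>R\<^esub> ?b l0"]) auto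
qed

text \<open>Right multiplication by \<open>u\<close> is a nonzero endomorphism of the simple module
  \<open>R / L\<close>, hence injective.\<close>

lemma maximal_left_ideal_colon:
  assumes L: "maximal_left_ideal L R" and u: "u \<in> carrier R" "u \<notin> L"
    and Lu: "\<And>l. l \<in> L \<Longrightarrow> l \<otimes>\<^bsub>R\<^esub> u \<in> L" and r: "r \<in> carrier R" "r \<otimes>\<^bsub>R\<^esub> u \<in> L"
  shows "r \<in> L"
proof -
  let ?J = "{r \<in> carrier R. r \<otimes>\<^bsub>R\<^esub> u \<in> L}"
  have "left_ideal ?J R" using left_ideal_colon maximal_left_idealD(1)[OF L] u(1) by blast
  moreover have "L \<subseteq> ?J" using Lu left_ideal_closed(1)[OF maximal_left_idealD(1)[OF L]] by blast
  moreover have "\<one>\<^bsub>R\<^esub> \<notin> ?J" using u by simp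
  ultimately have "?J = L" using L unfolding maximal_left_ideal_def by blast
  then show ?thesis using r by blast
qed

text \<open>Elements \<open>b\<close> with \<open>L b \<subseteq> L\<close> represent the endomorphisms of the simple module \<open>R / L\<close>, so this is
  Schur's lemma.\<close>

lemma schur_scalar:
  assumes ac: "algebraically_closed K" and unc: "uncountable (carrier K)" and S: "generates S"
    and L: "maximal_left_ideal L R" and b: "b \<in> carrier R" and Lb: "\<And>l. l \<in> L \<Longrightarrow> l \<otimes>\<^bsub>R\<^esub> b \<in> L"
  shows "\<exists>\<mu>\<in>carrier K. b \<ominus>\<^bsub>R\<^esub> \<mu> \<odot>\<^bsub>R\<^esub> \<one>\<^bsub>R\<^esub> \<in> L"
proof (rule ccontr)
  let ?b = "\<lambda>\<mu>. b \<ominus>\<^bsub>R\<^esub> \<mu> \<odot>\<^bsub>R\<^esub> \<one>\<^bsub>R\<^esub>"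
  assume "\<not> ?thesis"
  then have no: "?b \<mu> \<notin> L" if "\<mu> \<in> carrier K" for \<mu> using that by blast
  note LD = maximal_left_idealD[OF L]
  have bc: "?b \<mu> \<in> carrier R" if "\<mu> \<in> carrier K" for \<mu> using that b by simp
  have Lb': "l \<otimes>\<^bsub>R\<^esub> ?b \<mu> \<in> L" if "l \<in> L" "\<mu> \<in> carrier K" for l \<mu>
  proof -
    have lc: "l \<in> carrier R" using that left_ideal_closed(1)[OF LD(1)] by blast
    have "l \<otimes>\<^bsub>R\<^esub> ?b \<mu> = l \<otimes>\<^bsub>R\<^esub> b \<ominus>\<^bsub>R\<^esub> \<mu> \<odot>\<^bsub>R\<^esub> l"
      using that lc b by (simp add: a_minus_def R.r_distr R.r_minus scalar_commute)
    then show ?thesis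
      using submodule_minus[OF LD(2) Lb[OF that(1)] submodule.smult_closed[OF LD(2) that(2,1)]] by simp
  qed
  have "\<exists>\<phi> w. polyf b \<phi> w \<and> w \<in> L \<and> (\<exists>t\<in>carrier K. \<phi> t \<noteq> \<zero>\<^bsub>K\<^esub>)"
    by (rule dixmier[OF S unc order_refl LD(1) b Lb])
      (use maximal_left_ideal_inverse[OF L] no bc in blast)+
  then obtain p t where p: "set p \<subseteq> carrier K" "ev b p \<in> L" "t \<in> carrier K" "V.eval p t \<noteq> \<zero>\<^bsub>K\<^esub>"
    unfolding polyf_def by metis
  then show False
  \<comment> \<open>Linear factors are split off one at a time: \<open>b - a\<close> acts
    injectively on \<open>R / L\<close>, so it can be cancelled. The point \<open>t\<close> with
    nonzero value is carried along to keep the polynomial nonzero; at the end a nonzero constant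
    would lie in \<open>L\<close>.\<close>
  proof (induction "length p" arbitrary: p rule: less_induct)
    case less
    show ?case using algebraically_closed_root[OF ac less.prems(1)]
    proof
      assume "\<exists>a\<in>carrier K. V.eval p a = \<zero>\<^bsub>K\<^esub>"
      then obtain a where a: "a \<in> carrier K" "V.eval p a = \<zero>\<^bsub>K\<^esub>" by blast
      obtain s where s: "set s \<subseteq> carrier K" "length s = length p - 1"
        "\<forall>t\<in>carrier K. V.eval p t = V.eval s t \<otimes>\<^bsub>K\<^esub> (t \<ominus>\<^bsub>K\<^esub> a) \<oplus>\<^bsub>K\<^esub> V.eval p a"
        "ev b p = ev b s \<otimes>\<^bsub>R\<^esub> ?b a \<oplus>\<^bsub>R\<^esub> V.eval p a \<odot>\<^bsub>R\<^esub> \<one>\<^bsub>R\<^esub>"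
        using polyf_divide_linear[OF less.prems(1) a(1) b] by blast
      have sc: "ev b s \<in> carrier R" using ev_closed[OF s(1) b] .
      have "p \<noteq> []" using less.prems by auto
      then have "length s < length p" using s(2) by simp
      moreover have "V.eval s t \<noteq> \<zero>\<^bsub>K\<^esub>"
        using bspec[OF s(3) less.prems(3)] less.prems(3,4) a by auto
      moreover have "ev b s \<otimes>\<^bsub>R\<^esub> ?b a \<in> L" using s(4) a(2) less.prems(2) sc bc[OF a(1)] by simp
      then have "ev b s \<in> L"
        using maximal_left_ideal_colon[OF L bc[OF a(1)] no[OF a(1)] Lb'[OF _ a(1)] sc] by blast
      ultimately show False using less.hyps[of s] s(1) less.prems(3) by blast
    next
      assume "\<exists>c\<in>carrier K. c \<noteq> \<zero>\<^bsub>K\<^esub> \<and> V.normalize p = [c]"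
      then obtain c where c: "c \<in> carrier K" "c \<noteq> \<zero>\<^bsub>K\<^esub>" "V.normalize p = [c]" by blast
      have "ev b p = c \<odot>\<^bsub>R\<^esub> \<one>\<^bsub>R\<^esub>"
        using ev_normalize[OF less.prems(1) b] c b by (simp add: ev_Cons)
      then have "inv\<^bsub>K\<^esub> c \<odot>\<^bsub>R\<^esub> (c \<odot>\<^bsub>R\<^esub> \<one>\<^bsub>R\<^esub>) \<in> L"
        using submodule.smult_closed[OF LD(2), of "inv\<^bsub>K\<^esub> c" "ev b p"] less.prems(2) c
        by (simp add: V.field_Units)
      then have "\<one>\<^bsub>R\<^esub> \<in> L" using c by (simp add: V.smult_assoc1[symmetric] V.field_Units)
      then show False using LD(3) by blast
    qed
  qed
qed

lemma span_UnE:
  assumes "z \<in> sp (A \<union> B)" "A \<subseteq> carrier R" "B \<subseteq> carrier R"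
  obtains u v where "u \<in> sp A" "v \<in> sp B" "z = u \<oplus>\<^bsub>R\<^esub> v"
proof -
  let ?N = "{u \<oplus>\<^bsub>R\<^esub> v |u v. u \<in> sp A \<and> v \<in> sp B}"
  have cl: "sp A \<subseteq> carrier R" "sp B \<subseteq> carrier R" using assms V.span_is_subset2 by auto
  have "submodule K ?N R"
  proof (rule submoduleI)
    show "?N \<subseteq> carrier R" using cl by auto
    have "\<zero>\<^bsub>R\<^esub> = \<zero>\<^bsub>R\<^esub> \<oplus>\<^bsub>R\<^esub> \<zero>\<^bsub>R\<^esub>" by simp
    then show "\<zero>\<^bsub>R\<^esub> \<in> ?N" using span_zero assms by blast
    show "x \<oplus>\<^bsub>R\<^esub> y \<in> ?N" if xy: "x \<in> ?N" "y \<in> ?N" for x y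
    proof -
      from xy obtain u v s t where *: "u \<in> sp A" "v \<in> sp B" "x = u \<oplus>\<^bsub>R\<^esub> v"
        "s \<in> sp A" "t \<in> sp B" "y = s \<oplus>\<^bsub>R\<^esub> t" by blast
      then have "u \<in> carrier R" "v \<in> carrier R" "s \<in> carrier R" "t \<in> carrier R" using cl by auto
      then have "x \<oplus>\<^bsub>R\<^esub> y = (u \<oplus>\<^bsub>R\<^esub> s) \<oplus>\<^bsub>R\<^esub> (v \<oplus>\<^bsub>R\<^esub> t)"
        using * by (simp add: V.M.a_assoc V.M.a_lcomm)
      then show ?thesis using * span_add assms by blast
    qed
    show "c \<odot>\<^bsub>R\<^esub> x \<in> ?N" if c: "c \<in> carrier K" and x: "x \<in> ?N" for c x
    proof -
      from x obtain u v where *: "u \<in> sp A" "v \<in> sp B" "x = u \<oplus>\<^bsub>R\<^esub> v" by blast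
      then have "u \<in> carrier R" "v \<in> carrier R" using cl by auto
      then have "c \<odot>\<^bsub>R\<^esub> x = c \<odot>\<^bsub>R\<^esub> u \<oplus>\<^bsub>R\<^esub> c \<odot>\<^bsub>R\<^esub> v"
        using * c by (simp add: V.smult_r_distr)
      then show ?thesis using * c span_smult assms by blast
    qed
  qed
  moreover have "A \<union> B \<subseteq> ?N"
  proof
    fix x assume "x \<in> A \<union> B"
    then show "x \<in> ?N"
    proof
      assume x: "x \<in> A"
      then have "x = x \<oplus>\<^bsub>R\<^esub> \<zero>\<^bsub>R\<^esub>" using assms by auto
      then show ?thesis using x span_base[OF assms(2)] span_zero[OF assms(3)] by blast
    next
      assume x: "x \<in> B"
      then have "x = \<zero>\<^bsub>R\<^esub> \<oplus>\<^bsub>R\<^esub> x" using assms by auto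
      then show ?thesis using x span_base[OF assms(3)] span_zero[OF assms(2)] by blast
    qed
  qed
  ultimately have "z \<in> ?N" using span_minimal assms(1) by blast
  then show ?thesis using that by blast
qed

text \<open>Jacobson density for \<open>R / L\<close>, whose endomorphism ring consists of scalars by
  \<open>schur_scalar\<close>.\<close>

lemma density:
  assumes ac: "algebraically_closed K" and unc: "uncountable (carrier K)" and S: "generates S"
    and L: "maximal_left_ideal L R"
    and F: "finite F" "F \<subseteq> carrier R" and v: "v \<in> carrier R" "v \<notin> sp (L \<union> F)"
  shows "\<exists>e\<in>carrier R. (\<forall>f\<in>F. e \<otimes>\<^bsub>R\<^esub> f \<in> L) \<and> e \<otimes>\<^bsub>R\<^esub> v \<notin> L"
  using F v
proof (induction F arbitrary: v rule: finite_induct)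
  case empty
  then show ?case
    using span_of_submodule[OF maximal_left_idealD(2)[OF L]] by (intro bexI[of _ "\<one>\<^bsub>R\<^esub>"]) auto
next
  case (insert u F)
  note LD = maximal_left_idealD[OF L]
  have Lc: "L \<subseteq> carrier R" using left_ideal_closed(1)[OF LD(1)] .
  have u: "u \<in> carrier R" and Fc: "F \<subseteq> carrier R" using insert.prems by auto
  have LF: "L \<union> F \<subseteq> carrier R" and LuF: "L \<union> insert u F \<subseteq> carrier R" using Lc Fc u by auto
  have mono: "sp (L \<union> F) \<subseteq> sp (L \<union> insert u F)" by (rule span_mono) blast
  have vLF: "v \<notin> sp (L \<union> F)" using insert.prems mono by blast
  show ?case
  proof (cases "u \<in> sp (L \<union> F)")
    case True
    obtain e where e: "e \<in> carrier R" "\<And>f. f \<in> F \<Longrightarrow> e \<otimes>\<^bsub>R\<^esub> f \<in> L" "e \<otimes>\<^bsub>R\<^esub> v \<notin> L"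
      using insert.IH[OF Fc insert.prems(2) vLF] by blast
    have "e \<otimes>\<^bsub>R\<^esub> u \<in> L"
      by (rule span_lmult[OF True LF e(1) LD(2)]) (use e left_ideal_closed(4)[OF LD(1)] in blast)
    then show ?thesis using e by blast
  next
    case False
    obtain s where s: "s \<in> carrier R" "\<And>f. f \<in> F \<Longrightarrow> s \<otimes>\<^bsub>R\<^esub> f \<in> L" "s \<otimes>\<^bsub>R\<^esub> u \<notin> L"
      using insert.IH[OF Fc u False] by blast
    obtain t where t: "t \<in> carrier R" "eqm L (t \<otimes>\<^bsub>R\<^esub> (s \<otimes>\<^bsub>R\<^esub> u)) \<one>\<^bsub>R\<^esub>"
      using maximal_left_ideal_inverse[OF L _ s(3)] s(1) u by auto
    \<comment> \<open>Modulo \<open>L\<close>, this element kills \<open>F\<close> and sends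
      \<open>u\<close> to 1.\<close>
    define e where "e = t \<otimes>\<^bsub>R\<^esub> s"
    have ec: "e \<in> carrier R" using t s e_def by simp
    have eF: "e \<otimes>\<^bsub>R\<^esub> f \<in> L" if "f \<in> F" for f
    proof -
      have "f \<in> carrier R" using that Fc by blast
      then show ?thesis unfolding e_def
        using left_ideal_closed(4)[OF LD(1) t(1) s(2)[OF that]] t s by (simp add: R.m_assoc)
    qed
    have eu: "eqm L (e \<otimes>\<^bsub>R\<^esub> u) \<one>\<^bsub>R\<^esub>" unfolding e_def using t s u by (simp add: R.m_assoc)
    show ?thesis
    proof (rule ccontr)
      assume "\<not> ?thesis"
      then have kill: "r \<otimes>\<^bsub>R\<^esub> v \<in> L"
        if "r \<in> carrier R" "\<And>f. f \<in> F \<Longrightarrow> r \<otimes>\<^bsub>R\<^esub> f \<in> L" "r \<otimes>\<^bsub>R\<^esub> u \<in> L" for r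
        using that by blast
      \<comment> \<open>If whatever kills \<open>F\<close> and \<open>u\<close> also kills
        \<open>v\<close>, then right multiplication by \<open>e v\<close> is a well-defined
        endomorphism of \<open>R / L\<close>, so it is a scalar \<open>\<mu>\<close>.\<close>
      let ?b = "e \<otimes>\<^bsub>R\<^esub> v"
      have vc: "v \<in> carrier R" by fact
      have bc: "?b \<in> carrier R" using ec vc by simp
      have Lb: "l \<otimes>\<^bsub>R\<^esub> ?b \<in> L" if l: "l \<in> L" for l
      proof -
        have lc: "l \<in> carrier R" using l Lc by blast
        have "(l \<otimes>\<^bsub>R\<^esub> e) \<otimes>\<^bsub>R\<^esub> v \<in> L"
        proof (rule kill)
          show "l \<otimes>\<^bsub>R\<^esub> e \<in> carrier R" using lc ec by simp
          show "l \<otimes>\<^bsub>R\<^esub> e \<otimes>\<^bsub>R\<^esub> f \<in> L" if "f \<in> F" for f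
          proof -
            have "f \<in> carrier R" using that Fc by blast
            then show ?thesis using left_ideal_closed(4)[OF LD(1) lc eF[OF that]] lc ec by (simp add: R.m_assoc)
          qed
          have "eqm L (l \<otimes>\<^bsub>R\<^esub> (e \<otimes>\<^bsub>R\<^esub> u)) (l \<otimes>\<^bsub>R\<^esub> \<one>\<^bsub>R\<^esub>)" using eqm_lmult[OF LD(1) eu lc] .
          then show "l \<otimes>\<^bsub>R\<^esub> e \<otimes>\<^bsub>R\<^esub> u \<in> L" using eqm_mem[OF LD(2)] l lc ec u by (simp add: R.m_assoc)
        qed
        then show ?thesis using lc ec vc by (simp add: R.m_assoc)
      qed
      obtain \<mu> where \<mu>: "\<mu> \<in> carrier K" "?b \<ominus>\<^bsub>R\<^esub> \<mu> \<odot>\<^bsub>R\<^esub> \<one>\<^bsub>R\<^esub> \<in> L"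
        using schur_scalar[OF ac unc S L bc Lb] by blast
      have bm: "eqm L ?b (\<mu> \<odot>\<^bsub>R\<^esub> \<one>\<^bsub>R\<^esub>)" unfolding eqm_def using \<mu> bc by simp
      let ?w = "v \<ominus>\<^bsub>R\<^esub> \<mu> \<odot>\<^bsub>R\<^esub> u"
      have wc: "?w \<in> carrier R" using vc u \<mu> by simp
      have "r \<otimes>\<^bsub>R\<^esub> ?w \<in> L" if r: "r \<in> carrier R" and rF: "\<And>f. f \<in> F \<Longrightarrow> r \<otimes>\<^bsub>R\<^esub> f \<in> L" for r
      proof -
        have ru: "r \<otimes>\<^bsub>R\<^esub> u \<in> carrier R" using r u by simp
        \<comment> \<open>\<open>r u e - r\<close> kills both \<open>F\<close> and \<open>u\<close>,
          hence kills \<open>v\<close>. This reads \<open>r v = \<mu> (r u)\<close> modulo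
          \<open>L\<close>, so \<open>r\<close> kills \<open>v - \<mu> u\<close>, and the induction
          hypothesis puts that vector into the span of \<open>L\<close> and
          \<open>F\<close>.\<close>
        let ?q = "r \<otimes>\<^bsub>R\<^esub> u \<otimes>\<^bsub>R\<^esub> e \<ominus>\<^bsub>R\<^esub> r"
        have qc: "?q \<in> carrier R" using ru ec r by simp
        have q_mult: "?q \<otimes>\<^bsub>R\<^esub> x = r \<otimes>\<^bsub>R\<^esub> u \<otimes>\<^bsub>R\<^esub> (e \<otimes>\<^bsub>R\<^esub> x) \<ominus>\<^bsub>R\<^esub> r \<otimes>\<^bsub>R\<^esub> x" if "x \<in> carrier R" for x
          using that ru ec r by (simp add: a_minus_def R.l_distr R.l_minus R.m_assoc[of "r \<otimes>\<^bsub>R\<^esub> u"])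
        have "?q \<otimes>\<^bsub>R\<^esub> v \<in> L"
        proof (rule kill[OF qc])
          show "?q \<otimes>\<^bsub>R\<^esub> f \<in> L" if "f \<in> F" for f
          proof -
            have "f \<in> carrier R" using that Fc by blast
            then show ?thesis
              using submodule_minus[OF LD(2) left_ideal_closed(4)[OF LD(1) ru eF[OF that]] rF[OF that]]
              by (simp only: q_mult)
          qed
          have "eqm L (r \<otimes>\<^bsub>R\<^esub> u \<otimes>\<^bsub>R\<^esub> (e \<otimes>\<^bsub>R\<^esub> u)) (r \<otimes>\<^bsub>R\<^esub> u \<otimes>\<^bsub>R\<^esub> \<one>\<^bsub>R\<^esub>)" using eqm_lmult[OF LD(1) eu ru] .
          then show "?q \<otimes>\<^bsub>R\<^esub> u \<in> L" unfolding q_mult[OF u] using ru by (simp add: eqm_def)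
        qed
        then have "eqm L (r \<otimes>\<^bsub>R\<^esub> u \<otimes>\<^bsub>R\<^esub> ?b) (r \<otimes>\<^bsub>R\<^esub> v)"
          unfolding q_mult[OF vc] eqm_def using ru bc r vc by simp
        moreover have "eqm L (r \<otimes>\<^bsub>R\<^esub> u \<otimes>\<^bsub>R\<^esub> ?b) (\<mu> \<odot>\<^bsub>R\<^esub> (r \<otimes>\<^bsub>R\<^esub> u))"
          using eqm_lmult[OF LD(1) bm ru] unfolding scalar_commute[OF \<mu>(1) ru] .
        ultimately have "eqm L (r \<otimes>\<^bsub>R\<^esub> v) (\<mu> \<odot>\<^bsub>R\<^esub> (r \<otimes>\<^bsub>R\<^esub> u))"
          by (rule eqm_trans[OF LD(2) eqm_sym[OF LD(2)]])
        moreover have "r \<otimes>\<^bsub>R\<^esub> ?w = r \<otimes>\<^bsub>R\<^esub> v \<ominus>\<^bsub>R\<^esub> \<mu> \<odot>\<^bsub>R\<^esub> (r \<otimes>\<^bsub>R\<^esub> u)"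
          using r vc u \<mu>(1) by (simp add: a_minus_def R.r_distr R.r_minus smult_mult_right)
        ultimately show ?thesis unfolding eqm_def by simp
      qed
      then have "?w \<in> sp (L \<union> F)" using insert.IH[OF Fc wc] by blast
      then have "?w \<in> sp (L \<union> insert u F)" using mono by blast
      moreover have "\<mu> \<odot>\<^bsub>R\<^esub> u \<in> sp (L \<union> insert u F)" using span_smult[OF LuF \<mu>(1) span_base[OF LuF]] by blast
      ultimately have "?w \<oplus>\<^bsub>R\<^esub> \<mu> \<odot>\<^bsub>R\<^esub> u \<in> sp (L \<union> insert u F)" using span_add[OF LuF] by blast
      moreover have "?w \<oplus>\<^bsub>R\<^esub> \<mu> \<odot>\<^bsub>R\<^esub> u = v" using vc u \<mu>(1) by (simp add: a_minus_def V.M.a_assoc V.M.l_neg)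
      ultimately show False using insert.prems(3) by simp
    qed
  qed
qed

section \<open>Subspaces of finite codimension\<close>

text \<open>For a subspace this means finite codimension, not a finite complement as a set.\<close>

definition cofinite :: "'a set \<Rightarrow> bool" where
  "cofinite U \<longleftrightarrow> (\<exists>F. finite F \<and> F \<subseteq> carrier R \<and> carrier R \<subseteq> sp (U \<union> F))"

text \<open>If words of length \<open>n + 1\<close> add nothing modulo \<open>L\<close>, the span of
  \<open>L\<close> and the words of length at most \<open>n\<close> is closed under left
  multiplication by the generators and so is everything. Until then each length contributes a new
  dimension, starting with 1 at length 0.\<close>

lemma strict_growth:
  assumes S: "generates S" and L: "left_ideal L R" and n: "\<not> carrier R \<subseteq> sp (L \<union> words R S n)"
  shows "\<exists>us. length us = n + 1 \<and> set us \<subseteq> words R S n \<and> indep L us"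
  using n
proof (induction n)
  case 0
  have "\<one>\<^bsub>R\<^esub> \<notin> L"
  proof
    assume "\<one>\<^bsub>R\<^esub> \<in> L"
    then have "L = carrier R" using left_ideal_one[OF L] by blast
    then show False using 0 V.in_own_span[OF order_refl] span_mono[of L "L \<union> words R S 0"] by blast
  qed
  then show ?case using span_of_submodule[OF left_ideal_submodule[OF L]] one_in_words
    by (intro exI[of _ "[\<one>\<^bsub>R\<^esub>]"]) auto
next
  case (Suc n)
  have Sc: "S \<subseteq> carrier R" using S unfolding generates_def by blast
  have Lc: "L \<subseteq> carrier R" using left_ideal_closed(1)[OF L] .
  let ?N = "sp (L \<union> words R S n)"
  have c: "L \<union> words R S m \<subseteq> carrier R" for m using Lc words_closed[OF Sc] by blast
  have "?N \<subseteq> sp (L \<union> words R S (Suc n))" using words_mono[of S S n "Suc n"] by (intro span_mono) auto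
  then have "\<not> carrier R \<subseteq> ?N" using Suc.prems by blast
  then obtain us where us: "length us = n + 1" "set us \<subseteq> words R S n" "indep L us" using Suc.IH by blast
  have "\<exists>w\<in>words R S (Suc n). w \<notin> ?N"
  proof (rule ccontr)
    assume "\<not> ?thesis"
    then have sub: "words R S (Suc n) \<subseteq> ?N" by blast
    have N: "submodule K ?N R" using V.span_is_submodule[OF c] .
    have sN: "s \<otimes>\<^bsub>R\<^esub> x \<in> ?N" if s: "s \<in> S" and x: "x \<in> ?N" for s x
    proof (rule span_lmult[OF x c _ N])
      show sc: "s \<in> carrier R" using s Sc by blast
      fix y assume "y \<in> L \<union> words R S n"
      then show "s \<otimes>\<^bsub>R\<^esub> y \<in> ?N"
      proof
        assume "y \<in> L"
        then show ?thesis using left_ideal_closed(4)[OF L sc] span_base[OF c] by blast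
      next
        assume "y \<in> words R S n"
        then have "s \<otimes>\<^bsub>R\<^esub> y \<in> words R S (1 + n)" using words_mult[OF Sc letter_in_words[OF Sc s]] by blast
        then show ?thesis using sub by auto
      qed
    qed
    have "word_value R xs \<in> ?N" if "set xs \<subseteq> S" for xs
      using that
    proof (induction xs)
      case Nil
      show ?case using span_base[OF c] one_in_words by auto
    qed (use sN in auto)
    then have "words R S m \<subseteq> ?N" for m unfolding words_def by blast
    then have "sp (words R S m) \<subseteq> ?N" for m using span_minimal[OF _ N] by blast
    then have "carrier R \<subseteq> ?N" using S unfolding generates_def by blast
    then show False using \<open>\<not> carrier R \<subseteq> ?N\<close> by blast
  qed
  then obtain w where w: "w \<in> words R S (Suc n)" "w \<notin> ?N" by blast
  have "sp (L \<union> set us) \<subseteq> ?N" using us(2) by (intro span_mono) auto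
  then have "indep L (us @ [w])" using us w by (auto simp: indep_append)
  moreover have "set (us @ [w]) \<subseteq> words R S (Suc n)"
    using us(2) w(1) words_mono[of S S n "Suc n"] by auto
  ultimately show ?case using us(1) by (intro exI[of _ "us @ [w]"]) auto
qed

lemma not_cofinite_indep:
  assumes "\<not> cofinite U" "U \<subseteq> carrier R"
  shows "\<exists>fs. length fs = n \<and> set fs \<subseteq> carrier R \<and> indep U fs"
proof (induction n)
  case (Suc n)
  then obtain fs where fs: "length fs = n" "set fs \<subseteq> carrier R" "indep U fs" by blast
  then obtain a where "a \<in> carrier R" "a \<notin> sp (U \<union> set fs)"
    using assms(1) unfolding cofinite_def by blast
  then show ?case using fs by (intro exI[of _ "fs @ [a]"]) (auto simp: indep_append)
qed simp

text \<open>Right multiplication by \<open>w\<close> embeds \<open>A\<close> modulo the new subspace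
  into the finite-dimensional \<open>R / L\<close>. The set \<open>H\<close> lifts a basis of the
  image, and subtracting a combination of \<open>H\<close> moves an element of \<open>A\<close> into
  the new subspace.\<close>

lemma cofinite_colon:
  assumes A: "submodule K A R" "cofinite A" and L: "submodule K L R" "cofinite L" and w: "w \<in> carrier R"
  shows "cofinite {r \<in> A. r \<otimes>\<^bsub>R\<^esub> w \<in> L}"
proof -
  let ?A' = "{r \<in> A. r \<otimes>\<^bsub>R\<^esub> w \<in> L}"
  have Ac: "A \<subseteq> carrier R" and Lc: "L \<subseteq> carrier R" using A L submodule.subset by auto
  obtain F where F: "finite F" "F \<subseteq> carrier R" "carrier R \<subseteq> sp (A \<union> F)" using A unfolding cofinite_def by blast
  obtain E where E: "finite E" "E \<subseteq> carrier R" "carrier R \<subseteq> sp (L \<union> E)" using L unfolding cofinite_def by blast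
  let ?Aw = "(\<lambda>r. r \<otimes>\<^bsub>R\<^esub> w) ` A"
  have Aw: "?Aw \<subseteq> carrier R" using Ac w by auto
  have "\<exists>fs. set fs \<subseteq> ?Aw \<and> indep L fs \<and> ?Aw \<subseteq> sp (L \<union> set fs)"
    by (rule indep_maximal[OF E(1,2) Lc]) (use Aw E(3) in blast)
  then obtain fs where fs: "set fs \<subseteq> ?Aw" "?Aw \<subseteq> sp (L \<union> set fs)" by blast
  obtain H where H: "finite H" "H \<subseteq> A" "set fs = (\<lambda>r. r \<otimes>\<^bsub>R\<^esub> w) ` H"
    using finite_subset_image[OF finite_set fs(1)] by metis
  have Hc: "H \<subseteq> carrier R" using H Ac by blast
  have A'c: "?A' \<union> H \<union> F \<subseteq> carrier R" using Ac Hc F by blast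
  have A'H: "?A' \<union> H \<subseteq> carrier R" using A'c by blast
  have "A \<subseteq> sp (?A' \<union> H)"
  proof
    fix r assume r: "r \<in> A"
    then have "r \<otimes>\<^bsub>R\<^esub> w \<in> sp (L \<union> set fs)" using fs(2) by blast
    then obtain l z where lz: "l \<in> sp L" "z \<in> sp (set fs)" "r \<otimes>\<^bsub>R\<^esub> w = l \<oplus>\<^bsub>R\<^esub> z"
      using span_UnE[of _ L "set fs"] Lc fs(1) Aw by (metis order_trans)
    have l: "l \<in> L" using lz(1) span_of_submodule[OF L(1)] by simp
    have "submodule K ((\<lambda>r. r \<otimes>\<^bsub>R\<^esub> w) ` sp H) R"
      by (rule submodule_image_rmult[OF V.span_is_submodule[OF Hc] w])
    moreover have "set fs \<subseteq> (\<lambda>r. r \<otimes>\<^bsub>R\<^esub> w) ` sp H" unfolding H(3) by (rule image_mono[OF V.in_own_span[OF Hc]])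
    ultimately obtain h where h: "h \<in> sp H" "z = h \<otimes>\<^bsub>R\<^esub> w" using span_minimal lz(2) by blast
    have hA: "h \<in> A" using h(1) span_minimal[OF H(2) A(1)] by blast
    have cl: "r \<in> carrier R" "h \<in> carrier R" "l \<in> carrier R" using r hA l Ac Lc by auto
    have "(r \<ominus>\<^bsub>R\<^esub> h) \<otimes>\<^bsub>R\<^esub> w = l"
      using cl w lz(3) h(2) by (simp add: a_minus_def R.l_distr R.l_minus V.M.a_assoc V.M.r_neg)
    then have "r \<ominus>\<^bsub>R\<^esub> h \<in> ?A'" using submodule_minus[OF A(1) r hA] l by simp
    then have "r \<ominus>\<^bsub>R\<^esub> h \<in> sp (?A' \<union> H)" using span_base[OF A'H] by blast
    moreover have "h \<in> sp (?A' \<union> H)" using h(1) span_mono[of H "?A' \<union> H"] by blast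
    ultimately have "(r \<ominus>\<^bsub>R\<^esub> h) \<oplus>\<^bsub>R\<^esub> h \<in> sp (?A' \<union> H)" using span_add[OF A'H] by blast
    then show "r \<in> sp (?A' \<union> H)" using cl by (simp add: a_minus_def V.M.a_assoc V.M.l_neg)
  qed
  then have "A \<union> F \<subseteq> sp (?A' \<union> H \<union> F)"
    using span_mono[of "?A' \<union> H" "?A' \<union> H \<union> F"] V.in_own_span[OF A'c] by blast
  then have "carrier R \<subseteq> sp (?A' \<union> (H \<union> F))"
    using span_subsetI[OF _ A'c] F(3) unfolding Un_assoc by blast
  then show ?thesis unfolding cofinite_def using H(1) F(1,2) Hc by (intro exI[of _ "H \<union> F"]) auto
qed

text \<open>For a left ideal \<open>L\<close> this is the annihilator of the module
  \<open>R / L\<close>, which is the largest two-sided ideal contained in \<open>L\<close>.\<close>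

definition module_annihilator :: "'a set \<Rightarrow> 'a set" where
  "module_annihilator L = {r \<in> carrier R. \<forall>s\<in>carrier R. r \<otimes>\<^bsub>R\<^esub> s \<in> L}"

lemma module_annihilator_subset:
  assumes "left_ideal L R" shows "module_annihilator L \<subseteq> L"
proof
  fix r assume r: "r \<in> module_annihilator L"
  then have "r \<otimes>\<^bsub>R\<^esub> \<one>\<^bsub>R\<^esub> \<in> L" "r \<in> carrier R" unfolding module_annihilator_def by blast+
  then show "r \<in> L" by simp
qed

lemma module_annihilator_ideal:
  assumes L: "left_ideal L R" shows "ideal (module_annihilator L) R"
proof (rule idealI[OF R.ring_axioms])
  note Lc = left_ideal_closed[OF L] and Ls = left_ideal_submodule[OF L]
  show "subgroup (module_annihilator L) (add_monoid R)"
    unfolding module_annihilator_def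
    by (intro V.M.add.subgroupI) (use Lc submodule_neg[OF Ls] in \<open>auto simp: R.l_distr R.l_minus\<close>)
  show "x \<otimes>\<^bsub>R\<^esub> a \<in> module_annihilator L" if "a \<in> module_annihilator L" "x \<in> carrier R" for a x
    using that Lc(4) unfolding module_annihilator_def by (auto simp: R.m_assoc)
  show "a \<otimes>\<^bsub>R\<^esub> x \<in> module_annihilator L" if "a \<in> module_annihilator L" "x \<in> carrier R" for a x
    using that unfolding module_annihilator_def by (auto simp: R.m_assoc)
qed

text \<open>If \<open>b\<close> does not annihilate \<open>R / L\<close>, some \<open>b s\<close>
  generates this simple module, so \<open>a R b\<close> annihilating it forces \<open>a\<close> to
  annihilate it. The elementwise form matches the finite test in
  \<open>ex_prime_in_infinitely_many\<close>.\<close>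

lemma module_annihilator_prime:
  assumes L: "maximal_left_ideal L R" and ab: "a \<in> carrier R" "b \<in> carrier R"
    and zero: "\<And>r. r \<in> carrier R \<Longrightarrow> a \<otimes>\<^bsub>R\<^esub> r \<otimes>\<^bsub>R\<^esub> b \<in> module_annihilator L"
  shows "a \<in> module_annihilator L \<or> b \<in> module_annihilator L"
proof (rule disjCI)
  note LD = maximal_left_idealD[OF L]
  assume "b \<notin> module_annihilator L"
  then obtain s where s: "s \<in> carrier R" "b \<otimes>\<^bsub>R\<^esub> s \<notin> L" using ab unfolding module_annihilator_def by blast
  obtain t where t: "t \<in> carrier R" "eqm L (t \<otimes>\<^bsub>R\<^esub> (b \<otimes>\<^bsub>R\<^esub> s)) \<one>\<^bsub>R\<^esub>"
    using maximal_left_ideal_inverse[OF L _ s(2)] ab s by auto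
  have "a \<otimes>\<^bsub>R\<^esub> r \<in> L" if r: "r \<in> carrier R" for r
  proof -
    have ar: "a \<otimes>\<^bsub>R\<^esub> r \<in> carrier R" using ab r by simp
    have "eqm L (a \<otimes>\<^bsub>R\<^esub> r \<otimes>\<^bsub>R\<^esub> (t \<otimes>\<^bsub>R\<^esub> (b \<otimes>\<^bsub>R\<^esub> s))) (a \<otimes>\<^bsub>R\<^esub> r \<otimes>\<^bsub>R\<^esub> \<one>\<^bsub>R\<^esub>)" using eqm_lmult[OF LD(1) t(2) ar] .
    moreover have "a \<otimes>\<^bsub>R\<^esub> r \<otimes>\<^bsub>R\<^esub> (t \<otimes>\<^bsub>R\<^esub> (b \<otimes>\<^bsub>R\<^esub> s)) = (a \<otimes>\<^bsub>R\<^esub> (r \<otimes>\<^bsub>R\<^esub> t) \<otimes>\<^bsub>R\<^esub> b) \<otimes>\<^bsub>R\<^esub> s"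
      using ab r t s by (simp add: R.m_assoc)
    moreover have "(a \<otimes>\<^bsub>R\<^esub> (r \<otimes>\<^bsub>R\<^esub> t) \<otimes>\<^bsub>R\<^esub> b) \<otimes>\<^bsub>R\<^esub> s \<in> L"
      using zero[of "r \<otimes>\<^bsub>R\<^esub> t"] r t s unfolding module_annihilator_def by auto
    ultimately show ?thesis using eqm_mem[OF LD(2) eqm_sym[OF LD(2)]] ar by (metis R.r_one)
  qed
  then show "a \<in> module_annihilator L" using ab unfolding module_annihilator_def by blast
qed

text \<open>Annihilating \<open>R / L\<close> amounts to annihilating the finitely many vectors of
  \<open>F\<close>, and each vector costs finite codimension by
  \<open>cofinite_colon\<close>.\<close>

lemma cofinite_module_annihilator:
  assumes S: "generates S" and L: "left_ideal L R" and cof: "cofinite L"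
  shows "cofinite (module_annihilator L)"
proof -
  note Ls = left_ideal_submodule[OF L]
  have Sc: "S \<subseteq> carrier R" "finite S" using S unfolding generates_def by auto
  obtain F where F: "finite F" "F \<subseteq> carrier R" "carrier R \<subseteq> sp (L \<union> F)" using cof unfolding cofinite_def by blast
  let ?A = "\<lambda>W. {r \<in> carrier R. \<forall>w\<in>W. r \<otimes>\<^bsub>R\<^esub> w \<in> L}"
  have sm: "submodule K (?A W) R" if "W \<subseteq> carrier R" for W
  proof (rule submoduleI)
    show "\<zero>\<^bsub>R\<^esub> \<in> ?A W" using that submodule.zero_closed[OF Ls] by (auto simp: subset_iff)
  qed (use that in \<open>auto simp: subset_iff R.l_distr smult_mult_left submodule.m_closed[OF Ls] submodule.smult_closed[OF Ls]\<close>)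
  have "cofinite (?A W)" if "finite W" "W \<subseteq> carrier R" for W
    using that
  proof (induction W rule: finite_induct)
    case empty
    have "carrier R \<subseteq> sp (?A {} \<union> {})" using V.in_own_span[of "carrier R"] by auto
    then show ?case unfolding cofinite_def by blast
  next
    case (insert w W)
    then have "cofinite {r \<in> ?A W. r \<otimes>\<^bsub>R\<^esub> w \<in> L}" using cofinite_colon[OF sm _ Ls cof] by simp
    moreover have "{r \<in> ?A W. r \<otimes>\<^bsub>R\<^esub> w \<in> L} = ?A (insert w W)" by auto
    ultimately show ?case by simp
  qed
  then have "cofinite (?A F)" using F by blast
  moreover have "?A F \<subseteq> module_annihilator L"
  proof
    fix r assume r: "r \<in> ?A F"
    have "r \<otimes>\<^bsub>R\<^esub> s \<in> L" if "s \<in> carrier R" for s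
    proof (rule span_lmult[OF _ _ _ Ls])
      show "s \<in> sp (L \<union> F)" "L \<union> F \<subseteq> carrier R" "r \<in> carrier R"
        using F left_ideal_closed(1)[OF L] that r by auto
      show "r \<otimes>\<^bsub>R\<^esub> y \<in> L" if "y \<in> L \<union> F" for y
        using that r left_ideal_closed(4)[OF L] by auto
    qed
    then show "r \<in> module_annihilator L" using r unfolding module_annihilator_def by blast
  qed
  ultimately show ?thesis unfolding cofinite_def
    by (meson Un_mono order_refl order_trans span_mono)
qed

text \<open>Right multiplication by \<open>r\<close> sends \<open>sp T\<close> into
  \<open>sp L\<close> and takes \<open>u e\<close> back to \<open>u\<close> modulo
  \<open>sp L\<close>. Hence a relation among the \<open>u e\<close> modulo \<open>T\<close> would
  give one among the \<open>u\<close> modulo \<open>L\<close>.\<close>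

lemma indep_shift:
  assumes "indep L us" "set us \<subseteq> carrier R" "L \<subseteq> carrier R" "T \<subseteq> carrier R"
    and er: "e \<in> carrier R" "r \<in> carrier R"
    and T: "\<And>t. t \<in> T \<Longrightarrow> t \<otimes>\<^bsub>R\<^esub> r \<in> sp L"
    and us: "\<And>u. u \<in> set us \<Longrightarrow> eqm (sp L) (u \<otimes>\<^bsub>R\<^esub> e \<otimes>\<^bsub>R\<^esub> r) u"
  shows "indep T (map (\<lambda>u. u \<otimes>\<^bsub>R\<^esub> e) us)"
  using assms(1-4) T us
proof (induction us arbitrary: L T)
  case (Cons u us)
  have u: "u \<in> carrier R" using Cons.prems by simp
  have sL: "submodule K (sp L) R" using V.span_is_submodule Cons.prems by blast
  have uer: "eqm (sp L) (u \<otimes>\<^bsub>R\<^esub> e \<otimes>\<^bsub>R\<^esub> r) u" using Cons.prems by simp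
  have "u \<otimes>\<^bsub>R\<^esub> e \<notin> sp T"
  proof
    assume "u \<otimes>\<^bsub>R\<^esub> e \<in> sp T"
    then have "u \<otimes>\<^bsub>R\<^esub> e \<otimes>\<^bsub>R\<^esub> r \<in> sp L" using span_rmult[OF _ Cons.prems(4) er(2) sL Cons.prems(5)] by blast
    then have "u \<in> sp L" using eqm_mem[OF sL eqm_sym[OF sL uer]] by blast
    then show False using Cons.prems(1) by simp
  qed
  moreover have "indep (insert (u \<otimes>\<^bsub>R\<^esub> e) T) (map (\<lambda>u. u \<otimes>\<^bsub>R\<^esub> e) us)"
  proof (rule Cons.IH[of "insert u L"])
    have uL: "insert u L \<subseteq> carrier R" using u Cons.prems by simp
    have mono: "sp L \<subseteq> sp (insert u L)" by (rule span_mono) blast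
    have sm: "submodule K (sp (insert u L)) R" using V.span_is_submodule[OF uL] .
    show "t \<otimes>\<^bsub>R\<^esub> r \<in> sp (insert u L)" if "t \<in> insert (u \<otimes>\<^bsub>R\<^esub> e) T" for t
    proof (cases "t = u \<otimes>\<^bsub>R\<^esub> e")
      case True
      have "eqm (sp (insert u L)) (u \<otimes>\<^bsub>R\<^esub> e \<otimes>\<^bsub>R\<^esub> r) u" using uer mono unfolding eqm_def by blast
      then show ?thesis using eqm_mem[OF sm] span_base[OF uL] True by blast
    next
      case False
      then show ?thesis using that Cons.prems(5) mono by blast
    qed
    show "eqm (sp (insert u L)) (x \<otimes>\<^bsub>R\<^esub> e \<otimes>\<^bsub>R\<^esub> r) x" if "x \<in> set us" for x
      using Cons.prems(6)[of x] that mono unfolding eqm_def by auto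
  qed (use Cons.prems u er in auto)
  ultimately show ?case by simp
qed simp

text \<open>If \<open>R / L\<close> is infinite dimensional, density yields arbitrarily many independent vectors in it,
  and each contributes at least \<open>n + 1\<close> dimensions to the growth of \<open>R / ann(R / L)\<close>.\<close>

lemma density_blocks:
  assumes ac: "algebraically_closed K" and unc: "uncountable (carrier K)" and S: "generates S"
    and L: "maximal_left_ideal L R"
    and rs: "indep L rs" "set rs \<subseteq> carrier R"
  shows "\<exists>N. \<forall>n us T. set us \<subseteq> words R S n \<and> indep L us \<and> T \<subseteq> carrier R \<and>
      (\<forall>t\<in>T. \<forall>r\<in>set rs. t \<otimes>\<^bsub>R\<^esub> r \<in> L) \<longrightarrow>
      (\<exists>hs. set hs \<subseteq> sp (words R S (n + N)) \<and> indep T hs \<and> length hs = length rs * length us)"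
  using rs
proof (induction rs rule: rev_induct)
  case Nil
  show ?case by (intro exI[of _ 0] allI impI exI[of _ "[]"]) auto
next
  case (snoc r rs)
  note LD = maximal_left_idealD[OF L]
  have Sc: "S \<subseteq> carrier R" "finite S" using S unfolding generates_def by auto
  have W: "words R S m \<subseteq> carrier R" for m using words_closed[OF Sc(1)] .
  have Lc: "L \<subseteq> carrier R" using left_ideal_closed(1)[OF LD(1)] .
  have spL: "sp L = L" using span_of_submodule[OF LD(2)] .
  have r: "r \<in> carrier R" "r \<notin> sp (L \<union> set rs)" and rsc: "set rs \<subseteq> carrier R"
    using snoc.prems by (auto simp: indep_append)
  have "indep L rs" using snoc.prems by (simp add: indep_append)
  from snoc.IH[OF this rsc]
  obtain N where N: "\<forall>n us T. set us \<subseteq> words R S n \<and> indep L us \<and> T \<subseteq> carrier R \<and>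
      (\<forall>t\<in>T. \<forall>r\<in>set rs. t \<otimes>\<^bsub>R\<^esub> r \<in> L) \<longrightarrow>
      (\<exists>hs. set hs \<subseteq> sp (words R S (n + N)) \<and> indep T hs \<and> length hs = length rs * length us)"
    by (elim exE)
  obtain s where s: "s \<in> carrier R" "\<And>f. f \<in> set rs \<Longrightarrow> s \<otimes>\<^bsub>R\<^esub> f \<in> L" "s \<otimes>\<^bsub>R\<^esub> r \<notin> L"
    using density[OF ac unc S L _ rsc r] by auto
  obtain t where t: "t \<in> carrier R" "eqm L (t \<otimes>\<^bsub>R\<^esub> (s \<otimes>\<^bsub>R\<^esub> r)) \<one>\<^bsub>R\<^esub>"
    using maximal_left_ideal_inverse[OF L _ s(3)] s(1) r by auto
  \<comment> \<open>Modulo \<open>L\<close>, \<open>e\<close> kills the earlier vectors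
    \<open>rs\<close> and sends \<open>r\<close> to 1. So the block \<open>us e\<close> is
    independent modulo \<open>T\<close>, and \<open>T\<close> enlarged by this block still kills
    \<open>rs\<close>, as the induction hypothesis requires.\<close>
  define e where "e = t \<otimes>\<^bsub>R\<^esub> s"
  have ec: "e \<in> carrier R" using t s e_def by simp
  have e_rs: "e \<otimes>\<^bsub>R\<^esub> f \<in> L" if "f \<in> set rs" for f
  proof -
    have "f \<in> carrier R" using that rsc by blast
    then show ?thesis unfolding e_def
      using left_ideal_closed(4)[OF LD(1) t(1) s(2)[OF that]] t s by (simp add: R.m_assoc)
  qed
  have er: "eqm L (e \<otimes>\<^bsub>R\<^esub> r) \<one>\<^bsub>R\<^esub>" unfolding e_def using t s r by (simp add: R.m_assoc)
  obtain Ne where Ne: "e \<in> sp (words R S Ne)" using S ec unfolding generates_def by blast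
  show ?case
  \<comment> \<open>The shift in word length depends only on the elements \<open>e\<close>, not on
    \<open>n\<close>, \<open>us\<close> or \<open>T\<close>; the final count depends on this
    uniformity.\<close>
  proof (intro exI[of _ "N + Ne"] allI impI, elim conjE)
    fix n us T
    assume us: "set us \<subseteq> words R S n" "indep L us" and T: "T \<subseteq> carrier R"
      and kill: "\<forall>t\<in>T. \<forall>r\<in>set (rs @ [r]). t \<otimes>\<^bsub>R\<^esub> r \<in> L"
    let ?b = "map (\<lambda>u. u \<otimes>\<^bsub>R\<^esub> e) us"
    have usc: "set us \<subseteq> carrier R" using us(1) W by blast
    have bc: "set ?b \<subseteq> carrier R" using usc ec by auto
    have "indep T ?b"
    proof (rule indep_shift[OF us(2) usc Lc T ec r(1)])
      show "t \<otimes>\<^bsub>R\<^esub> r \<in> sp L" if "t \<in> T" for t using kill that spL by simp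
      show "eqm (sp L) (u \<otimes>\<^bsub>R\<^esub> e \<otimes>\<^bsub>R\<^esub> r) u" if "u \<in> set us" for u
      proof -
        have u: "u \<in> carrier R" using that usc by blast
        then show ?thesis using eqm_lmult[OF LD(1) er u] ec r(1) unfolding spL by (simp add: R.m_assoc)
      qed
    qed
    have "\<exists>hs. set hs \<subseteq> sp (words R S (n + N)) \<and> indep (T \<union> set ?b) hs \<and> length hs = length rs * length us"
    proof (rule N[rule_format], intro conjI us)
      show "T \<union> set ?b \<subseteq> carrier R" using T bc by blast
      show "\<forall>t\<in>T \<union> set ?b. \<forall>f\<in>set rs. t \<otimes>\<^bsub>R\<^esub> f \<in> L"
      proof (intro ballI)
        fix x f assume x: "x \<in> T \<union> set ?b" and f: "f \<in> set rs"
        have fc: "f \<in> carrier R" using f rsc by blast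
        from x show "x \<otimes>\<^bsub>R\<^esub> f \<in> L"
        proof
          assume "x \<in> set ?b"
          then obtain u where u: "u \<in> carrier R" "x = u \<otimes>\<^bsub>R\<^esub> e" using usc by auto
          then show ?thesis using left_ideal_closed(4)[OF LD(1) u(1) e_rs[OF f]] ec fc by (simp add: R.m_assoc)
        qed (use kill f in simp)
      qed
    qed
    then obtain hs where hs: "set hs \<subseteq> sp (words R S (n + N))" "indep (T \<union> set ?b) hs"
      "length hs = length rs * length us" by blast
    have "indep T (?b @ hs)" using \<open>indep T ?b\<close> hs(2) by (simp add: indep_append)
    moreover have "set (?b @ hs) \<subseteq> sp (words R S (n + (N + Ne)))"
    proof -
      have m: "sp (words R S i) \<subseteq> sp (words R S (n + (N + Ne)))" if "i \<le> n + (N + Ne)" for i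
        using that by (intro span_mono words_mono) auto
      have "u \<otimes>\<^bsub>R\<^esub> e \<in> sp (words R S (n + Ne))" if "u \<in> set us" for u
        using span_words_mult[OF Sc(1) span_base[OF W] Ne] us(1) that by blast
      then have "set ?b \<subseteq> sp (words R S (n + Ne))" by auto
      then show ?thesis using hs(1) m[of "n + Ne"] m[of "n + N"] by auto
    qed
    ultimately show "\<exists>hs. set hs \<subseteq> sp (words R S (n + (N + Ne))) \<and> indep T hs \<and>
        length hs = length (rs @ [r]) * length us"
      using hs(3) by (intro exI[of _ "?b @ hs"]) auto
  qed
qed

theorem primitive_linear_growth_cofinite:
  assumes ac: "algebraically_closed K" and unc: "uncountable (carrier K)" and S: "generates S"
    and L: "maximal_left_ideal L R" and lin: "linear_growth (module_annihilator L) S"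
  shows "cofinite (module_annihilator L)"
proof (rule ccontr)
  note LD = maximal_left_idealD[OF L]
  let ?M = "module_annihilator L"
  assume "\<not> cofinite ?M"
  then have ncof: "\<not> cofinite L" using cofinite_module_annihilator[OF S LD(1)] by blast
  have Sc: "S \<subseteq> carrier R" "finite S" using S unfolding generates_def by auto
  have W: "words R S m \<subseteq> carrier R" for m using words_closed[OF Sc(1)] .
  have Lc: "L \<subseteq> carrier R" using left_ideal_closed(1)[OF LD(1)] .
  have Mc: "?M \<subseteq> carrier R" unfolding module_annihilator_def by blast
  obtain B where B: "\<And>n. \<exists>G. finite G \<and> G \<subseteq> words R S n \<and> card G \<le> B * (n + 1) \<and> words R S n \<subseteq> sp (?M \<union> G)"
    using lin unfolding linear_growth_def by blast
  obtain rs where rs: "length rs = B + 1" "set rs \<subseteq> carrier R" "indep L rs"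
    using not_cofinite_indep[OF ncof Lc, of "B + 1"] by blast
  from density_blocks[OF ac unc S L rs(3,2)]
  obtain N where N: "\<forall>n us T. set us \<subseteq> words R S n \<and> indep L us \<and> T \<subseteq> carrier R \<and>
      (\<forall>t\<in>T. \<forall>r\<in>set rs. t \<otimes>\<^bsub>R\<^esub> r \<in> L) \<longrightarrow>
      (\<exists>hs. set hs \<subseteq> sp (words R S (n + N)) \<and> indep T hs \<and> length hs = length rs * length us)"
    by (elim exE)
  \<comment> \<open>\<open>(B + 1) * (n + 1)\<close> exceeds \<open>B * (n + N + 1)\<close> by
    \<open>n + 1 - B * N\<close>, which is 1 for this choice of \<open>n\<close>.\<close>
  define n where "n = B * N"
  have "\<not> carrier R \<subseteq> sp (L \<union> words R S n)"
  proof
    assume "carrier R \<subseteq> sp (L \<union> words R S n)"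
    then show False using ncof finite_words[OF Sc(2), of R n] W[of n] unfolding cofinite_def by metis
  qed
  then obtain us where us: "length us = n + 1" "set us \<subseteq> words R S n" "indep L us"
    using strict_growth[OF S LD(1)] by blast
  have "\<exists>hs. set hs \<subseteq> sp (words R S (n + N)) \<and> indep ?M hs \<and> length hs = length rs * length us"
    by (rule N[rule_format], intro conjI us(2,3) Mc) (use rs(2) in \<open>auto simp: module_annihilator_def\<close>)
  then obtain hs where hs: "set hs \<subseteq> sp (words R S (n + N))" "indep ?M hs" "length hs = (B + 1) * (n + 1)"
    using rs us by auto
  obtain G where G: "finite G" "G \<subseteq> words R S (n + N)" "card G \<le> B * (n + N + 1)"
    "words R S (n + N) \<subseteq> sp (?M \<union> G)" using B by blast
  have MG: "?M \<union> G \<subseteq> carrier R" using Mc G(2) W by blast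
  have "set hs \<subseteq> sp (?M \<union> G)" using hs(1) span_subsetI[OF G(4) MG] by blast
  then have "length hs \<le> card G" using indep_length_le[OF G(1) _ hs(2) Mc] MG by blast
  then have "(B + 1) * (n + 1) \<le> B * (n + N + 1)" using hs(3) G(3) by simp
  then show False unfolding n_def by (simp add: algebra_simps)
qed

section \<open>Simple modules and primitive ideals\<close>

lemma coset_eq_iff:
  assumes L: "submodule K L R" and xy: "x \<in> carrier R" "y \<in> carrier R"
  shows "L +>\<^bsub>R\<^esub> x = L +>\<^bsub>R\<^esub> y \<longleftrightarrow> eqm L x y"
proof -
  have Lc: "L \<subseteq> carrier R" using L submodule.subset by blast
  have mem: "z \<in> L +>\<^bsub>R\<^esub> u \<longleftrightarrow> eqm L z u" if u: "u \<in> carrier R" for z u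
  proof
    assume "z \<in> L +>\<^bsub>R\<^esub> u"
    then obtain l where l: "l \<in> L" "z = l \<oplus>\<^bsub>R\<^esub> u" unfolding a_r_coset_def' by blast
    then have "l \<in> carrier R" using Lc by blast
    then show "eqm L z u" unfolding eqm_def using l u by (simp add: a_minus_def V.M.a_assoc V.M.r_neg)
  next
    assume z: "eqm L z u"
    then have "z = (z \<ominus>\<^bsub>R\<^esub> u) \<oplus>\<^bsub>R\<^esub> u"
      using eqm_carrier[OF z] by (simp add: a_minus_def V.M.a_assoc V.M.l_neg)
    then show "z \<in> L +>\<^bsub>R\<^esub> u" using z unfolding a_r_coset_def' eqm_def by blast
  qed
  show ?thesis
  proof
    assume "L +>\<^bsub>R\<^esub> x = L +>\<^bsub>R\<^esub> y"
    then show "eqm L x y" using mem[OF xy(1)] mem[OF xy(2)] eqm_refl[OF L xy(1)] by blast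
  next
    assume e: "eqm L x y"
    show "L +>\<^bsub>R\<^esub> x = L +>\<^bsub>R\<^esub> y"
      using mem[OF xy(1)] mem[OF xy(2)] eqm_trans[OF L _ e] eqm_trans[OF L _ eqm_sym[OF L e]] by blast
  qed
qed

lemma coset_self: "submodule K L R \<Longrightarrow> x \<in> carrier R \<Longrightarrow> x \<in> L +>\<^bsub>R\<^esub> x"
  unfolding a_r_coset_def' using submodule.zero_closed by force

lemma coset_mem:
  assumes L: "submodule K L R" and x: "x \<in> carrier R" and y: "y \<in> L +>\<^bsub>R\<^esub> x"
  shows "eqm L y x"
proof -
  obtain l where l: "l \<in> L" "y = l \<oplus>\<^bsub>R\<^esub> x" using y unfolding a_r_coset_def' by blast
  then have "l \<in> carrier R" using submodule.subset[OF L] by blast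
  then show ?thesis unfolding eqm_def using l x by (simp add: a_minus_def V.M.a_assoc V.M.r_neg)
qed

text \<open>The actions on cosets are written as unions over representatives; when \<open>f\<close>
  respects the congruence, all members of the union coincide.\<close>

lemma coset_map:
  assumes L: "submodule K L R" and x: "x \<in> carrier R"
    and f: "\<And>y z. eqm L y z \<Longrightarrow> eqm L (f y) (f z)"
  shows "(\<Union>y\<in>L +>\<^bsub>R\<^esub> x. L +>\<^bsub>R\<^esub> f y) = L +>\<^bsub>R\<^esub> f x"
proof -
  have "L +>\<^bsub>R\<^esub> f y = L +>\<^bsub>R\<^esub> f x" if "y \<in> L +>\<^bsub>R\<^esub> x" for y
    using f[OF coset_mem[OF L x that]] coset_eq_iff[OF L] eqm_carrier by blast
  then show ?thesis using coset_self[OF L x] by blast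
qed

definition quotient_module :: "'a set \<Rightarrow> ('a, 'a set) module" where
  "quotient_module L = \<lparr>carrier = a_rcosets\<^bsub>R\<^esub> L, monoid.mult = set_add R, one = L, zero = L,
     add = set_add R, smult = (\<lambda>r C. \<Union>x\<in>C. L +>\<^bsub>R\<^esub> (r \<otimes>\<^bsub>R\<^esub> x))\<rparr>"

lemma quotient_module_simps:
  assumes L: "left_ideal L R"
  shows "carrier (quotient_module L) = (\<lambda>x. L +>\<^bsub>R\<^esub> x) ` carrier R"
    and "\<zero>\<^bsub>quotient_module L\<^esub> = L +>\<^bsub>R\<^esub> \<zero>\<^bsub>R\<^esub>"
    and "\<And>x y. x \<in> carrier R \<Longrightarrow> y \<in> carrier R \<Longrightarrow>
      (L +>\<^bsub>R\<^esub> x) \<oplus>\<^bsub>quotient_module L\<^esub> (L +>\<^bsub>R\<^esub> y) = L +>\<^bsub>R\<^esub> (x \<oplus>\<^bsub>R\<^esub> y)"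
    and "\<And>r x. r \<in> carrier R \<Longrightarrow> x \<in> carrier R \<Longrightarrow>
      r \<odot>\<^bsub>quotient_module L\<^esub> (L +>\<^bsub>R\<^esub> x) = L +>\<^bsub>R\<^esub> (r \<otimes>\<^bsub>R\<^esub> x)"
    and "abelian_group (quotient_module L)"
proof -
  have as: "additive_subgroup L R" using L unfolding left_ideal_def by blast
  interpret A: abelian_subgroup L R by (rule abelian_subgroupI3[OF as V.M.abelian_group_axioms])
  have sm: "submodule K L R" using left_ideal_submodule[OF L] .
  show carr: "carrier (quotient_module L) = (\<lambda>x. L +>\<^bsub>R\<^esub> x) ` carrier R"
    by (auto simp: quotient_module_def A_RCOSETS_def')
  have Lc: "L \<subseteq> carrier R" using left_ideal_closed(1)[OF L] .
  have "L +>\<^bsub>R\<^esub> \<zero>\<^bsub>R\<^esub> = L" unfolding a_r_coset_def' using Lc by (auto simp: subset_iff)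
  then show zero: "\<zero>\<^bsub>quotient_module L\<^esub> = L +>\<^bsub>R\<^esub> \<zero>\<^bsub>R\<^esub>" by (simp add: quotient_module_def)
  show add: "(L +>\<^bsub>R\<^esub> x) \<oplus>\<^bsub>quotient_module L\<^esub> (L +>\<^bsub>R\<^esub> y) = L +>\<^bsub>R\<^esub> (x \<oplus>\<^bsub>R\<^esub> y)"
    if "x \<in> carrier R" "y \<in> carrier R" for x y
    using A.a_rcos_sum[OF that] by (simp add: quotient_module_def)
  show "r \<odot>\<^bsub>quotient_module L\<^esub> (L +>\<^bsub>R\<^esub> x) = L +>\<^bsub>R\<^esub> (r \<otimes>\<^bsub>R\<^esub> x)"
    if "r \<in> carrier R" "x \<in> carrier R" for r x
    using coset_map[OF sm that(2), of "\<lambda>y. r \<otimes>\<^bsub>R\<^esub> y"] eqm_lmult[OF L _ that(1)]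
    by (simp add: quotient_module_def)
  show "abelian_group (quotient_module L)"
  proof (rule abelian_groupI)
    fix x assume "x \<in> carrier (quotient_module L)"
    then obtain a where a: "a \<in> carrier R" "x = L +>\<^bsub>R\<^esub> a" using carr by blast
    then have "(L +>\<^bsub>R\<^esub> (\<ominus>\<^bsub>R\<^esub> a)) \<oplus>\<^bsub>quotient_module L\<^esub> x = \<zero>\<^bsub>quotient_module L\<^esub>"
      using add zero by (simp add: V.M.l_neg)
    then show "\<exists>y\<in>carrier (quotient_module L). y \<oplus>\<^bsub>quotient_module L\<^esub> x = \<zero>\<^bsub>quotient_module L\<^esub>"
      using a carr by blast
  qed (auto simp: carr zero add V.M.a_assoc V.M.a_comm V.M.a_lcomm)
qed

text \<open>Submodules of \<open>R / L\<close> pull back to left ideals containing \<open>L\<close>,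
  so maximality gives simplicity; faithfulness is the vanishing of the annihilator.\<close>

lemma left_primitiveI:
  assumes L: "maximal_left_ideal L R" and M: "module_annihilator L = {\<zero>\<^bsub>R\<^esub>}"
  shows "left_primitive R"
proof -
  note LD = maximal_left_idealD[OF L]
  let ?M = "quotient_module L" and ?\<pi> = "\<lambda>x. L +>\<^bsub>R\<^esub> x"
  note qs = quotient_module_simps[OF LD(1)]
  have eq0: "?\<pi> x = \<zero>\<^bsub>?M\<^esub> \<longleftrightarrow> x \<in> L" if "x \<in> carrier R" for x
    unfolding qs(2) using coset_eq_iff[OF LD(2) that V.M.zero_closed] that
    by (auto simp: eqm_def a_minus_def)
  have lm: "left_module R ?M"
  proof (intro left_module.intro left_module_axioms.intro R.ring_axioms qs(5))
  qed (auto simp: qs(1,3,4) R.l_distr R.r_distr R.m_assoc)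
  have "N = {\<zero>\<^bsub>?M\<^esub>} \<or> N = carrier ?M"
    if N: "additive_subgroup N ?M" "\<forall>r\<in>carrier R. \<forall>m\<in>N. r \<odot>\<^bsub>?M\<^esub> m \<in> N" for N
  proof -
    let ?J = "{x \<in> carrier R. ?\<pi> x \<in> N}"
    have Nc: "N \<subseteq> carrier ?M" and N0: "\<zero>\<^bsub>?M\<^esub> \<in> N"
      using additive_subgroup.a_subset[OF N(1)] additive_subgroup.zero_closed[OF N(1)] by auto
    have "left_ideal ?J R"
    proof (rule left_idealI)
      show "\<zero>\<^bsub>R\<^esub> \<in> ?J" using N0 unfolding qs(2) by simp
      show "x \<oplus>\<^bsub>R\<^esub> y \<in> ?J" if "x \<in> ?J" "y \<in> ?J" for x y
        using that additive_subgroup.a_closed[OF N(1), of "?\<pi> x" "?\<pi> y"] by (simp add: qs(3))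
      show "r \<otimes>\<^bsub>R\<^esub> x \<in> ?J" if r: "r \<in> carrier R" and x: "x \<in> ?J" for r x
      proof -
        have "r \<odot>\<^bsub>?M\<^esub> ?\<pi> x \<in> N" using N(2) r x by blast
        then show ?thesis using r x by (simp add: qs(4))
      qed
    qed blast
    moreover have "L \<subseteq> ?J"
    proof
      fix l assume l: "l \<in> L"
      then have lc: "l \<in> carrier R" using left_ideal_closed(1)[OF LD(1)] by blast
      then have "?\<pi> l = \<zero>\<^bsub>?M\<^esub>" using eq0 l by blast
      then show "l \<in> ?J" using N0 lc by simp
    qed
    ultimately have "?J = L \<or> ?J = carrier R" using L unfolding maximal_left_ideal_def by blast
    then show ?thesis
    proof
      assume J: "?J = L"
      have "m = \<zero>\<^bsub>?M\<^esub>" if m: "m \<in> N" for m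
      proof -
        obtain x where x: "x \<in> carrier R" "m = ?\<pi> x" using m Nc unfolding qs(1) by blast
        then have "x \<in> ?J" using m by blast
        then show ?thesis using J eq0[OF x(1)] x(2) by blast
      qed
      then show ?thesis using N0 by blast
    next
      assume J: "?J = carrier R"
      have "carrier ?M \<subseteq> N" unfolding qs(1) using J by blast
      then show ?thesis using Nc by blast
    qed
  qed
  moreover have "carrier ?M \<noteq> {\<zero>\<^bsub>?M\<^esub>}"
    using eq0[OF R.one_closed] LD(3) R.one_closed unfolding qs(1) by blast
  ultimately have "simple_left_module R ?M" unfolding simple_left_module_def using lm by blast
  moreover have "faithful_left_module R ?M"
    unfolding faithful_left_module_def
  proof (intro conjI lm ballI impI)
    fix r assume r: "r \<in> carrier R" and kill: "\<forall>m\<in>carrier ?M. r \<odot>\<^bsub>?M\<^esub> m = \<zero>\<^bsub>?M\<^esub>"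
    have "r \<otimes>\<^bsub>R\<^esub> s \<in> L" if s: "s \<in> carrier R" for s
    proof -
      have "?\<pi> (r \<otimes>\<^bsub>R\<^esub> s) = \<zero>\<^bsub>?M\<^esub>" using kill r s unfolding qs(1) by (simp add: qs(4))
      then show ?thesis using eq0 r s by simp
    qed
    then have "r \<in> module_annihilator L" using r unfolding module_annihilator_def by blast
    then show "r = \<zero>\<^bsub>R\<^esub>" using M by blast
  qed
  ultimately show ?thesis unfolding left_primitive_def by blast
qed

text \<open>Zorn's lemma applies because properness is tested by the single element 1, so unions of
  chains stay proper.\<close>

lemma ex_maximal_left_ideal:
  assumes J: "left_ideal J R" "\<one>\<^bsub>R\<^esub> \<notin> J"
  shows "\<exists>L. maximal_left_ideal L R \<and> J \<subseteq> L"
proof -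
  let ?A = "{I. left_ideal I R \<and> \<one>\<^bsub>R\<^esub> \<notin> I \<and> J \<subseteq> I}"
  have "\<exists>L\<in>?A. \<forall>I\<in>?A. L \<subseteq> I \<longrightarrow> I = L"
  proof (rule subset_Zorn_nonempty)
    show "?A \<noteq> {}" using J by blast
    fix C assume C: "C \<noteq> {}" "subset.chain ?A C"
    have CA: "I \<in> ?A" if "I \<in> C" for I using C(2) that unfolding subset.chain_def by blast
    have "left_ideal (\<Union>C) R"
    proof (rule left_idealI)
      show "\<Union>C \<subseteq> carrier R" using CA left_ideal_closed(1) by blast
      show "\<zero>\<^bsub>R\<^esub> \<in> \<Union>C" using C(1) CA left_ideal_closed(2) by blast
      show "x \<oplus>\<^bsub>R\<^esub> y \<in> \<Union>C" if xy: "x \<in> \<Union>C" "y \<in> \<Union>C" for x y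
      proof -
        from xy obtain I I' where I: "x \<in> I" "I \<in> C" "y \<in> I'" "I' \<in> C" by blast
        have "I \<subseteq> I' \<or> I' \<subseteq> I" using C(2) I unfolding subset.chain_def by blast
        then obtain I'' where I'': "I'' \<in> C" "x \<in> I''" "y \<in> I''" using I by blast
        then have "left_ideal I'' R" using CA by blast
        then have "x \<oplus>\<^bsub>R\<^esub> y \<in> I''" using left_ideal_closed(3) I'' by blast
        then show ?thesis using I''(1) by blast
      qed
      show "r \<otimes>\<^bsub>R\<^esub> x \<in> \<Union>C" if r: "r \<in> carrier R" and x: "x \<in> \<Union>C" for r x
      proof -
        from x obtain I where I: "x \<in> I" "I \<in> C" by blast
        then have "left_ideal I R" using CA by blast
        then have "r \<otimes>\<^bsub>R\<^esub> x \<in> I" using left_ideal_closed(4) r I by blast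
        then show ?thesis using I(2) by blast
      qed
    qed
    then show "\<Union>C \<in> ?A" using C(1) CA by blast
  qed
  then obtain L where L: "L \<in> ?A" and max: "\<forall>I\<in>?A. L \<subseteq> I \<longrightarrow> I = L" by (elim bexE)
  have "maximal_left_ideal L R"
    unfolding maximal_left_ideal_def
  proof (intro conjI allI impI)
    show "left_ideal L R" "L \<noteq> carrier R" using L by auto
    fix I assume I: "left_ideal I R \<and> L \<subseteq> I"
    show "I = L \<or> I = carrier R"
    proof (cases "\<one>\<^bsub>R\<^esub> \<in> I")
      case True
      then show ?thesis using left_ideal_one I by blast
    next
      case False
      then have "I \<in> ?A" using I L by blast
      then show ?thesis using max[rule_format, of I] I by simp
    qed
  qed
  then show ?thesis using L by blast
qed

section \<open>The standard identity\<close>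

lemma finsum_in_submodule:
  assumes N: "submodule K N R" and f: "\<And>i. i \<in> A \<Longrightarrow> f i \<in> N"
  shows "(\<Oplus>\<^bsub>R\<^esub>i\<in>A. f i) \<in> N"
proof (cases "finite A")
  case True
  then show ?thesis using f
  proof (induction A rule: finite_induct)
    case (insert i A)
    have fc: "f j \<in> carrier R" if "j \<in> insert i A" for j
      by (rule subsetD[OF submodule.subset[OF N] insert.prems[OF that]])
    then have "(\<Oplus>\<^bsub>R\<^esub>j\<in>insert i A. f j) = f i \<oplus>\<^bsub>R\<^esub> (\<Oplus>\<^bsub>R\<^esub>j\<in>A. f j)"
      by (intro V.M.finsum_insert[OF insert.hyps] Pi_I) simp_all
    moreover have "f i \<in> N" by (rule insert.prems) simp
    moreover have "(\<Oplus>\<^bsub>R\<^esub>j\<in>A. f j) \<in> N" by (rule insert.IH) (simp add: insert.prems)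
    ultimately show ?case using submodule.m_closed[OF N] by simp
  qed (simp add: submodule.zero_closed[OF N])
qed (simp add: V.M.finsum_infinite submodule.zero_closed[OF N])

definition signK :: "(nat \<Rightarrow> nat) \<Rightarrow> 'k" where
  "signK p = (if evenperm p then \<one>\<^bsub>K\<^esub> else \<ominus>\<^bsub>K\<^esub> \<one>\<^bsub>K\<^esub>)"

text \<open>The standard polynomial of degree \<open>n\<close>. The assignment \<open>\<rho>\<close>
  is a total function as in \<open>PI_algebra\<close>.\<close>

definition std_poly :: "nat \<Rightarrow> (nat \<Rightarrow> 'a) \<Rightarrow> 'a" where
  "std_poly n \<rho> = (\<Oplus>\<^bsub>R\<^esub>p\<in>{p. p permutes {..<n}}. signK p \<odot>\<^bsub>R\<^esub> word_value R (map (\<rho> \<circ> p) [0..<n]))"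

lemma signK_closed: "signK p \<in> carrier K"
  by (simp add: signK_def)

lemma word_value_map_closed:
  "range \<rho> \<subseteq> carrier R \<Longrightarrow> word_value R (map (\<rho> \<circ> p) xs) \<in> carrier R"
  by (rule word_value_closed) auto

text \<open>Composition with the transposition of \<open>i\<close> and \<open>j\<close> pairs even
  with odd permutations, and paired terms cancel. This works in every characteristic, including
  2.\<close>

lemma std_poly_alternating:
  assumes \<rho>: "range \<rho> \<subseteq> carrier R" and ij: "i < j" "j < n" "\<rho> i = \<rho> j"
  shows "std_poly n \<rho> = \<zero>\<^bsub>R\<^esub>"
proof -
  let ?P = "{p. p permutes {..<n}}" and ?t = "Transposition.transpose i j"
  let ?E = "{p \<in> ?P. evenperm p}" and ?O = "{p \<in> ?P. \<not> evenperm p}"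
  let ?f = "\<lambda>p. signK p \<odot>\<^bsub>R\<^esub> word_value R (map (\<rho> \<circ> p) [0..<n])"
  have fin: "finite ?P" by (rule finite_permutations) simp
  have fc: "?f p \<in> carrier R" for p
    by (intro V.smult_closed signK_closed word_value_map_closed[OF \<rho>])
  have t: "?t permutes {..<n}" using ij by (intro permutes_swap_id) auto
  have tt: "?t \<circ> (?t \<circ> p) = p" for p by (simp add: fun_eq_iff)
  have even_t: "evenperm (?t \<circ> p) \<longleftrightarrow> \<not> evenperm p" if "p \<in> ?P" for p
  proof -
    have "permutation p" "permutation ?t" using that t permutes_imp_permutation[of "{..<n}"] by auto
    then show ?thesis using evenperm_comp[of ?t p] ij by (simp add: evenperm_swap)
  qed
  have tP: "?t \<circ> p \<in> ?P" if "p \<in> ?P" for p using that t permutes_compose by blast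
  have O: "?O = (\<lambda>p. ?t \<circ> p) ` ?E"
  proof
    show "?O \<subseteq> (\<lambda>p. ?t \<circ> p) ` ?E"
    proof
      fix p assume p: "p \<in> ?O"
      then have "?t \<circ> p \<in> ?E" using even_t[of p] tP[of p] by blast
      then show "p \<in> (\<lambda>p. ?t \<circ> p) ` ?E" by (rule rev_image_eqI) (simp only: tt)
    qed
    show "(\<lambda>p. ?t \<circ> p) ` ?E \<subseteq> ?O" using even_t tP by blast
  qed
  have inj: "inj_on (\<lambda>p. ?t \<circ> p) ?E" by (rule inj_onI) (metis tt)
  have "\<rho> \<circ> ?t = \<rho>" using ij(3) by (auto simp: fun_eq_iff Transposition.transpose_def)
  then have rt: "\<rho> \<circ> (?t \<circ> p) = \<rho> \<circ> p" for p by (simp add: o_assoc)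
  have ft: "?f (?t \<circ> p) = \<ominus>\<^bsub>R\<^esub> ?f p" if "p \<in> ?E" for p
  proof -
    have "signK (?t \<circ> p) = \<ominus>\<^bsub>K\<^esub> \<one>\<^bsub>K\<^esub>" "signK p = \<one>\<^bsub>K\<^esub>" using that even_t[of p] unfolding signK_def by auto
    then show ?thesis unfolding rt using word_value_map_closed[OF \<rho>, of p] smult_neg_one by simp
  qed
  have "std_poly n \<rho> = (\<Oplus>\<^bsub>R\<^esub>p\<in>?E \<union> ?O. ?f p)"
    unfolding std_poly_def by (rule arg_cong[where f = "finsum R ?f"]) blast
  also have "\<dots> = (\<Oplus>\<^bsub>R\<^esub>p\<in>?E. ?f p) \<oplus>\<^bsub>R\<^esub> (\<Oplus>\<^bsub>R\<^esub>p\<in>?O. ?f p)"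
    using fin fc by (intro V.M.finsum_Un_disjoint) auto
  also have "(\<Oplus>\<^bsub>R\<^esub>p\<in>?O. ?f p) = (\<Oplus>\<^bsub>R\<^esub>p\<in>?E. ?f (?t \<circ> p))"
    unfolding O using fc inj by (intro V.M.finsum_reindex) auto
  also have "(\<Oplus>\<^bsub>R\<^esub>p\<in>?E. ?f p) \<oplus>\<^bsub>R\<^esub> \<dots> = (\<Oplus>\<^bsub>R\<^esub>p\<in>?E. ?f p \<oplus>\<^bsub>R\<^esub> ?f (?t \<circ> p))"
    using fc by (intro V.M.finsum_addf[symmetric]) auto
  also have "\<dots> = (\<Oplus>\<^bsub>R\<^esub>p\<in>?E. \<zero>\<^bsub>R\<^esub>)"
  proof (rule V.M.finsum_cong')
    show "?f p \<oplus>\<^bsub>R\<^esub> ?f (?t \<circ> p) = \<zero>\<^bsub>R\<^esub>" if "p \<in> ?E" for p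
      unfolding ft[OF that] by (rule V.M.r_neg[OF fc])
  qed auto
  also have "\<dots> = \<zero>\<^bsub>R\<^esub>" by (rule V.M.finsum_zero)
  finally show ?thesis .
qed

text \<open>The variable \<open>i\<close> occurs exactly once in each word, which gives linearity in
  that slot.\<close>

lemma word_value_linear_position:
  assumes \<rho>: "range \<rho> \<subseteq> carrier R" and p: "p permutes {..<n}" and i: "i < n"
  shows "\<exists>a\<in>carrier R. \<exists>b\<in>carrier R. \<forall>y\<in>carrier R.
    word_value R (map (\<rho>(i := y) \<circ> p) [0..<n]) = a \<otimes>\<^bsub>R\<^esub> y \<otimes>\<^bsub>R\<^esub> b"
proof -
  obtain k where k: "k < n" "p k = i" using permutes_image[OF p] i by (metis imageE lessThan_iff)
  have inj: "p m \<noteq> i" if "m \<noteq> k" for m using permutes_inj[OF p] k that by (metis injD)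
  let ?a = "word_value R (map (\<rho> \<circ> p) [0..<k])" and ?b = "word_value R (map (\<rho> \<circ> p) [Suc k..<n])"
  have "word_value R (map (\<rho>(i := y) \<circ> p) [0..<n]) = ?a \<otimes>\<^bsub>R\<^esub> y \<otimes>\<^bsub>R\<^esub> ?b" if y: "y \<in> carrier R" for y
  proof -
    have "[0..<n] = [0..<k] @ k # [Suc k..<n]"
      using k(1) upt_add_eq_append[of 0 k "n - k"] by (simp add: upt_conv_Cons)
    moreover have "map (\<rho>(i := y) \<circ> p) [0..<k] = map (\<rho> \<circ> p) [0..<k]"
      "map (\<rho>(i := y) \<circ> p) [Suc k..<n] = map (\<rho> \<circ> p) [Suc k..<n]"
      using inj by (auto intro!: map_cong)
    ultimately have "map (\<rho>(i := y) \<circ> p) [0..<n] = map (\<rho> \<circ> p) [0..<k] @ y # map (\<rho> \<circ> p) [Suc k..<n]"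
      using k(2) by simp
    moreover have "set (map (\<rho> \<circ> p) [0..<k]) \<subseteq> carrier R" "set (y # map (\<rho> \<circ> p) [Suc k..<n]) \<subseteq> carrier R"
      using \<rho> y by auto
    ultimately have "word_value R (map (\<rho>(i := y) \<circ> p) [0..<n]) = ?a \<otimes>\<^bsub>R\<^esub> (y \<otimes>\<^bsub>R\<^esub> ?b)"
      by (simp only: word_value_append word_value_Cons)
    moreover have "?a \<otimes>\<^bsub>R\<^esub> y \<otimes>\<^bsub>R\<^esub> ?b = ?a \<otimes>\<^bsub>R\<^esub> (y \<otimes>\<^bsub>R\<^esub> ?b)"
      by (intro R.m_assoc y word_value_map_closed[OF \<rho>])
    ultimately show ?thesis by (rule trans[OF _ sym])
  qed
  then show ?thesis using word_value_map_closed[OF \<rho>] by blast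
qed

text \<open>Since \<open>n\<close> exceeds the dimension of \<open>R / M\<close>, some
  \<open>\<rho> i\<close> is a combination modulo \<open>M\<close> of earlier values. Slot
  \<open>i\<close> is linear; an earlier value there repeats an argument and gives zero, and an
  element of \<open>M\<close> gives an element of \<open>M\<close>.\<close>

lemma std_poly_in_ideal:
  assumes M: "ideal M R" and F: "finite F" "F \<subseteq> carrier R" "carrier R \<subseteq> sp (M \<union> F)" "card F < n"
    and \<rho>: "range \<rho> \<subseteq> carrier R"
  shows "std_poly n \<rho> \<in> M"
proof -
  have sm: "submodule K M R" and Mc: "M \<subseteq> carrier R" using ideal_submodule[OF M] ideal_carrier[OF M] .
  have "\<not> indep M (map \<rho> [0..<n])"
  proof
    assume "indep M (map \<rho> [0..<n])"
    moreover have "set (map \<rho> [0..<n]) \<subseteq> sp (M \<union> F)" using \<rho> F(3) by auto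
    ultimately have "length (map \<rho> [0..<n]) \<le> card F" using indep_length_le[OF F(1) _ _ Mc F(2)] by blast
    then show False using F(4) by simp
  qed
  then obtain as f bs where *: "map \<rho> [0..<n] = as @ f # bs" "f \<in> sp (M \<union> set as)" by (rule not_indepE)
  define i where "i = length as"
  have "length (map \<rho> [0..<n]) = length (as @ f # bs)" using *(1) by simp
  then have i: "i < n" by (simp add: i_def)
  have "map \<rho> [0..<n] ! i = f" using *(1) by (simp add: i_def)
  then have f: "f = \<rho> i" using i by simp
  have "as = take i (map \<rho> [0..<n])" using *(1) by (simp add: i_def)
  then have as: "set as = \<rho> ` {..<i}" using i by (auto simp: take_map)
  let ?P = "{p. p permutes {..<n}}"
  let ?f = "\<lambda>y p. signK p \<odot>\<^bsub>R\<^esub> word_value R (map (\<rho>(i := y) \<circ> p) [0..<n])"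
  have fin: "finite ?P" by (rule finite_permutations) simp
  have T: "std_poly n (\<rho>(i := y)) = (\<Oplus>\<^bsub>R\<^esub>p\<in>?P. ?f y p)" for y unfolding std_poly_def ..
  have fc: "?f y p \<in> carrier R" if "y \<in> carrier R" for y p
  proof -
    have "range (\<rho>(i := y)) \<subseteq> carrier R" using \<rho> that by (auto simp: image_subset_iff)
    then show ?thesis by (intro V.smult_closed signK_closed word_value_map_closed)
  qed
  have f_add: "?f (y \<oplus>\<^bsub>R\<^esub> z) p = ?f y p \<oplus>\<^bsub>R\<^esub> ?f z p"
    if "y \<in> carrier R" "z \<in> carrier R" "p \<in> ?P" for y z p
  proof -
    have pp: "p permutes {..<n}" using that by simp
    obtain a b where "a \<in> carrier R" "b \<in> carrier R"
      "\<forall>y\<in>carrier R. word_value R (map (\<rho>(i := y) \<circ> p) [0..<n]) = a \<otimes>\<^bsub>R\<^esub> y \<otimes>\<^bsub>R\<^esub> b"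
      using word_value_linear_position[OF \<rho> pp i] by blast
    then show ?thesis using that(1,2) signK_closed by (simp add: R.l_distr R.r_distr V.smult_r_distr)
  qed
  have f_smult: "?f (c \<odot>\<^bsub>R\<^esub> y) p = c \<odot>\<^bsub>R\<^esub> ?f y p"
    if "c \<in> carrier K" "y \<in> carrier R" "p \<in> ?P" for c y p
  proof -
    have pp: "p permutes {..<n}" using that by simp
    obtain a b where "a \<in> carrier R" "b \<in> carrier R"
      "\<forall>y\<in>carrier R. word_value R (map (\<rho>(i := y) \<circ> p) [0..<n]) = a \<otimes>\<^bsub>R\<^esub> y \<otimes>\<^bsub>R\<^esub> b"
      using word_value_linear_position[OF \<rho> pp i] by blast
    then show ?thesis using that(1,2) signK_closed[of p]
      by (simp add: smult_mult_left smult_mult_right V.smult_assoc1[symmetric] V.R.m_comm)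
  qed
  have f_M: "?f y p \<in> M" if "y \<in> M" "p \<in> ?P" for y p
  proof -
    have pp: "p permutes {..<n}" and y: "y \<in> carrier R" using that Mc by auto
    obtain a b where ab: "a \<in> carrier R" "b \<in> carrier R"
      "\<forall>y\<in>carrier R. word_value R (map (\<rho>(i := y) \<circ> p) [0..<n]) = a \<otimes>\<^bsub>R\<^esub> y \<otimes>\<^bsub>R\<^esub> b"
      using word_value_linear_position[OF \<rho> pp i] by blast
    have "a \<otimes>\<^bsub>R\<^esub> y \<otimes>\<^bsub>R\<^esub> b \<in> M"
      by (rule ideal.I_r_closed[OF M ideal.I_l_closed[OF M that(1) ab(1)] ab(2)])
    then show ?thesis using ab(3) y submodule.smult_closed[OF sm signK_closed] by simp
  qed
  let ?N = "{y \<in> carrier R. std_poly n (\<rho>(i := y)) \<in> M}"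
  have "submodule K ?N R"
  proof (rule submoduleI)
    show "\<zero>\<^bsub>R\<^esub> \<in> ?N" using finsum_in_submodule[OF sm, of ?P "?f \<zero>\<^bsub>R\<^esub>"] f_M submodule.zero_closed[OF sm] unfolding T by simp
    show "y \<oplus>\<^bsub>R\<^esub> z \<in> ?N" if yz: "y \<in> ?N" "z \<in> ?N" for y z
    proof -
      have c: "y \<in> carrier R" "z \<in> carrier R" using yz by auto
      have "std_poly n (\<rho>(i := y \<oplus>\<^bsub>R\<^esub> z)) = (\<Oplus>\<^bsub>R\<^esub>p\<in>?P. ?f y p \<oplus>\<^bsub>R\<^esub> ?f z p)"
        unfolding T using f_add[OF c] fc c by (intro V.M.finsum_cong') auto
      also have "\<dots> = std_poly n (\<rho>(i := y)) \<oplus>\<^bsub>R\<^esub> std_poly n (\<rho>(i := z))"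
        unfolding T using fc c by (intro V.M.finsum_addf) auto
      finally show ?thesis using yz c submodule.m_closed[OF sm] by simp
    qed
    show "c \<odot>\<^bsub>R\<^esub> y \<in> ?N" if c: "c \<in> carrier K" and y: "y \<in> ?N" for c y
    proof -
      have yc: "y \<in> carrier R" using y by auto
      have "std_poly n (\<rho>(i := c \<odot>\<^bsub>R\<^esub> y)) = (\<Oplus>\<^bsub>R\<^esub>p\<in>?P. c \<odot>\<^bsub>R\<^esub> ?f y p)"
        unfolding T using f_smult[OF c yc] fc[OF yc] c by (intro V.M.finsum_cong') auto
      also have "\<dots> = c \<odot>\<^bsub>R\<^esub> std_poly n (\<rho>(i := y))"
        unfolding T using fc[OF yc] c fin by (intro V.finsum_smult_ldistr[symmetric]) auto
      finally show ?thesis using y c submodule.smult_closed[OF sm] by simp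
    qed
  qed blast
  moreover have "M \<union> set as \<subseteq> ?N"
  proof
    fix y assume "y \<in> M \<union> set as"
    then show "y \<in> ?N"
    proof
      assume y: "y \<in> M"
      have "(\<Oplus>\<^bsub>R\<^esub>p\<in>?P. ?f y p) \<in> M" by (rule finsum_in_submodule[OF sm f_M[OF y]])
      then show ?thesis using y Mc T by (simp add: subset_iff)
    next
      assume "y \<in> set as"
      then obtain j where j: "j < i" "y = \<rho> j" unfolding as by auto
      have "std_poly n (\<rho>(i := y)) = \<zero>\<^bsub>R\<^esub>"
        by (rule std_poly_alternating[OF _ j(1) i]) (use j \<rho> in auto)
      then show ?thesis using j(2) \<rho> submodule.zero_closed[OF sm] by auto
    qed
  qed
  ultimately have "\<rho> i \<in> ?N" using span_minimal *(2) f by blast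
  then show ?thesis by simp
qed

lemma PI_algebraI_std:
  assumes "\<And>\<rho>. range \<rho> \<subseteq> carrier R \<Longrightarrow> std_poly n \<rho> = \<zero>\<^bsub>R\<^esub>"
  shows "PI_algebra K R"
proof -
  let ?P = "{p. p permutes {..<n}}"
  let ?w = "\<lambda>p :: nat \<Rightarrow> nat. map p [0..<n]"
  \<comment> \<open>Different permutations give different words, so no coefficients cancel and each
    of them is 1 or -1.\<close>
  define f where "f w = (if w \<in> ?w ` ?P then signK (the_inv_into ?P ?w w) else \<zero>\<^bsub>K\<^esub>)" for w
  have inj: "inj_on ?w ?P"
  proof (rule inj_onI)
    fix p q assume pq: "p \<in> ?P" "q \<in> ?P" "?w p = ?w q"
    show "p = q"
    proof
      fix m
      show "p m = q m"
      proof (cases "m < n")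
        case True
        have "?w p ! m = ?w q ! m" by (simp only: pq(3))
        then show ?thesis using True by simp
      next
        case False
        then show ?thesis using pq(1,2) permutes_not_in[of p "{..<n}" m] permutes_not_in[of q "{..<n}" m] by simp
      qed
    qed
  qed
  have fw: "f (?w p) = signK p" if "p \<in> ?P" for p
    using that the_inv_into_f_f[OF inj that] unfolding f_def by auto
  have sg: "signK p \<noteq> \<zero>\<^bsub>K\<^esub>" for p unfolding signK_def by simp
  have supp: "{w. f w \<noteq> \<zero>\<^bsub>K\<^esub>} = ?w ` ?P" using sg fw unfolding f_def by auto
  have fin: "finite ?P" by (rule finite_permutations) simp
  have "(\<Oplus>\<^bsub>R\<^esub>w\<in>?w ` ?P. f w \<odot>\<^bsub>R\<^esub> word_value R (map \<rho> w)) = \<zero>\<^bsub>R\<^esub>" if \<rho>: "range \<rho> \<subseteq> carrier R" for \<rho>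
  proof -
    have c: "f w \<odot>\<^bsub>R\<^esub> word_value R (map \<rho> w) \<in> carrier R" for w
      using word_value_map_closed[OF \<rho>, of id w] signK_closed unfolding f_def by auto
    have "(\<Oplus>\<^bsub>R\<^esub>w\<in>?w ` ?P. f w \<odot>\<^bsub>R\<^esub> word_value R (map \<rho> w))
        = (\<Oplus>\<^bsub>R\<^esub>p\<in>?P. f (?w p) \<odot>\<^bsub>R\<^esub> word_value R (map \<rho> (?w p)))"
      using c inj by (intro V.M.finsum_reindex) auto
    also have "\<dots> = std_poly n \<rho>"
      unfolding std_poly_def
    proof (rule V.M.finsum_cong')
      show "(\<lambda>p. signK p \<odot>\<^bsub>R\<^esub> word_value R (map (\<rho> \<circ> p) [0..<n])) \<in> ?P \<rightarrow> carrier R"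
        by (intro Pi_I V.smult_closed signK_closed word_value_map_closed[OF \<rho>])
    qed (simp_all add: fw)
    finally show ?thesis using assms[OF \<rho>] by simp
  qed
  moreover have "range f \<subseteq> carrier K" using signK_closed unfolding f_def by auto
  moreover have "?w ` ?P \<noteq> {}" using permutes_id by blast
  ultimately show ?thesis unfolding PI_algebra_def
    using supp fin by (intro exI[of _ f]) auto
qed

section \<open>A prime ideal met by infinitely many primitive ideals\<close>

text \<open>\<open>P\<close> is maximal among the ideals all of whose finite subsets lie in infinitely many of the
  \<open>M l\<close>. The bound \<open>d\<close>, uniform in \<open>l\<close>, lets finitely many elements test \<open>a R b \<subseteq> M l\<close>, which makes
  \<open>P\<close> prime.\<close>

lemma ex_prime_in_infinitely_many:
  assumes S: "finite S" "S \<subseteq> carrier R" and inf: "infinite \<Lambda>"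
    and M: "\<And>l. l \<in> \<Lambda> \<Longrightarrow> ideal (M l) R" "\<And>l. l \<in> \<Lambda> \<Longrightarrow> \<one>\<^bsub>R\<^esub> \<notin> M l"
    and pr: "\<And>l a b. l \<in> \<Lambda> \<Longrightarrow> a \<in> carrier R \<Longrightarrow> b \<in> carrier R \<Longrightarrow>
      (\<And>r. r \<in> carrier R \<Longrightarrow> a \<otimes>\<^bsub>R\<^esub> r \<otimes>\<^bsub>R\<^esub> b \<in> M l) \<Longrightarrow> a \<in> M l \<or> b \<in> M l"
    and d: "\<And>l. l \<in> \<Lambda> \<Longrightarrow> carrier R \<subseteq> sp (M l \<union> words R S d)"
  shows "\<exists>P. prime_ideal P R \<and> (\<Inter>l\<in>\<Lambda>. M l) \<subseteq> P \<and> (\<forall>z\<in>P. infinite {l \<in> \<Lambda>. z \<in> M l})"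
proof -
  let ?I = "\<Inter>l\<in>\<Lambda>. M l"
  let ?many = "\<lambda>F. infinite {l \<in> \<Lambda>. F \<subseteq> M l}"
  \<comment> \<open>The condition concerns finite subsets rather than whole ideals: a finite subset
    of the union of a chain already lies in one member, so Zorn's lemma applies.\<close>
  let ?A = "{Q. ideal Q R \<and> ?I \<subseteq> Q \<and> (\<forall>F. finite F \<and> F \<subseteq> Q \<longrightarrow> ?many F)}"
  have ne: "\<Lambda> \<noteq> {}" using inf by auto
  have I: "ideal ?I R"
    using R.i_Intersect[of "M ` \<Lambda>"] M(1) ne by blast
  have "?I \<in> ?A"
  proof -
    have "{l \<in> \<Lambda>. F \<subseteq> M l} = \<Lambda>" if "F \<subseteq> ?I" for F using that by blast
    then show ?thesis using I inf by auto
  qed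
  have "\<exists>P\<in>?A. \<forall>Q\<in>?A. P \<subseteq> Q \<longrightarrow> Q = P"
  proof (rule subset_Zorn_nonempty)
    show "?A \<noteq> {}" using \<open>?I \<in> ?A\<close> by blast
    fix C assume C: "C \<noteq> {}" "subset.chain ?A C"
    have CA: "Q \<in> ?A" if "Q \<in> C" for Q using C(2) that unfolding subset.chain_def by blast
    have Cid: "ideal Q R" if "Q \<in> C" for Q using CA[OF that] by simp
    have Cls: "left_ideal Q R" if "Q \<in> C" for Q using ideal_left_ideal[OF Cid[OF that]] .
    have fin_sub: "\<exists>Q\<in>C. F \<subseteq> Q" if "finite F" "F \<subseteq> \<Union>C" for F
      using that
    proof (induction F rule: finite_induct)
      case (insert x F)
      then obtain Q Q' where Q: "Q \<in> C" "F \<subseteq> Q" "Q' \<in> C" "x \<in> Q'" by auto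
      have "Q \<subseteq> Q' \<or> Q' \<subseteq> Q" using C(2) Q unfolding subset.chain_def by blast
      then show ?case using Q by blast
    qed (use C(1) in blast)
    have "ideal (\<Union>C) R"
    proof (rule idealI[OF R.ring_axioms])
      show "subgroup (\<Union>C) (add_monoid R)"
      proof (rule V.M.add.subgroupI)
        show "\<Union>C \<subseteq> carrier R" using left_ideal_closed(1)[OF Cls] by blast
        show "\<Union>C \<noteq> {}" using left_ideal_closed(2)[OF Cls] C(1) by blast
        show "\<ominus>\<^bsub>R\<^esub> x \<in> \<Union>C" if "x \<in> \<Union>C" for x
          using that submodule_neg[OF left_ideal_submodule[OF Cls]] by blast
        show "x \<oplus>\<^bsub>R\<^esub> y \<in> \<Union>C" if xy: "x \<in> \<Union>C" "y \<in> \<Union>C" for x y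
        proof -
          obtain Q where "Q \<in> C" "{x, y} \<subseteq> Q" using fin_sub[of "{x, y}"] xy by auto
          then show ?thesis using left_ideal_closed(3)[OF Cls] by blast
        qed
      qed
      show "x \<otimes>\<^bsub>R\<^esub> a \<in> \<Union>C" "a \<otimes>\<^bsub>R\<^esub> x \<in> \<Union>C" if a: "a \<in> \<Union>C" and x: "x \<in> carrier R" for a x
      proof -
        from a obtain Q where Q: "Q \<in> C" "a \<in> Q" by blast
        show "x \<otimes>\<^bsub>R\<^esub> a \<in> \<Union>C" using ideal.I_l_closed[OF Cid[OF Q(1)] Q(2) x] Q(1) by blast
        show "a \<otimes>\<^bsub>R\<^esub> x \<in> \<Union>C" using ideal.I_r_closed[OF Cid[OF Q(1)] Q(2) x] Q(1) by blast
      qed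
    qed
    moreover have "?I \<subseteq> \<Union>C" using C(1) CA by blast
    moreover have "?many F" if "finite F \<and> F \<subseteq> \<Union>C" for F
    proof -
      from that have F: "finite F" "F \<subseteq> \<Union>C" by simp_all
      from fin_sub[OF F] obtain Q where "Q \<in> C" "F \<subseteq> Q" by blast
      then show ?thesis using CA[of Q] F(1) by simp
    qed
    ultimately show "\<Union>C \<in> ?A" by blast
  qed
  then obtain P where P: "P \<in> ?A" and max: "\<forall>Q\<in>?A. P \<subseteq> Q \<longrightarrow> Q = P" by (elim bexE)
  have Pid: "ideal P R" and IP: "?I \<subseteq> P" and Pmany: "\<And>F. finite F \<Longrightarrow> F \<subseteq> P \<Longrightarrow> ?many F"
    using P by blast+
  have z: "infinite {l \<in> \<Lambda>. z \<in> M l}" if "z \<in> P" for z using Pmany[of "{z}"] that by simp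
  have "P \<noteq> carrier R"
  proof
    assume "P = carrier R"
    then have "infinite {l \<in> \<Lambda>. \<one>\<^bsub>R\<^esub> \<in> M l}" using z by blast
    moreover have "{l \<in> \<Lambda>. \<one>\<^bsub>R\<^esub> \<in> M l} = {}" using M(2) by blast
    ultimately show False by simp
  qed
  have Pl: "left_ideal P R" using ideal_left_ideal[OF Pid] .
  \<comment> \<open>By maximality an ideal not inside \<open>P\<close>, added to \<open>P\<close>,
    contains a finite set lying in only finitely many of the \<open>M l\<close>.\<close>
  have enlarge: "\<exists>F. finite F \<and> F \<subseteq> A <+>\<^bsub>R\<^esub> P \<and> finite {l \<in> \<Lambda>. F \<subseteq> M l}"
    if A: "ideal A R" and nA: "\<not> A \<subseteq> P" for A
  proof -
    let ?Q = "A <+>\<^bsub>R\<^esub> P"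
    have Q: "ideal ?Q R" by (rule R.add_ideals[OF A Pid])
    note Al = left_ideal_closed[OF ideal_left_ideal[OF A]] and Pc = left_ideal_closed[OF Pl]
    have Qe: "?Q = {a \<oplus>\<^bsub>R\<^esub> p |a p. a \<in> A \<and> p \<in> P}" unfolding set_add_def set_mult_def by auto
    have "A \<subseteq> ?Q"
    proof
      fix a assume a: "a \<in> A"
      then have "a = a \<oplus>\<^bsub>R\<^esub> \<zero>\<^bsub>R\<^esub>" using Al(1) by auto
      then show "a \<in> ?Q" unfolding Qe using a Pc(2) by blast
    qed
    moreover have PQ: "P \<subseteq> ?Q"
    proof
      fix p assume p: "p \<in> P"
      then have "p = \<zero>\<^bsub>R\<^esub> \<oplus>\<^bsub>R\<^esub> p" using Pc(1) by auto
      then show "p \<in> ?Q" unfolding Qe using p Al(2) by blast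
    qed
    ultimately have "?Q \<noteq> P" using nA by blast
    then have "?Q \<notin> ?A" using max[rule_format, of ?Q] PQ by argo
    moreover have "?I \<subseteq> ?Q" using IP PQ by (rule order_trans)
    ultimately have "\<not> (\<forall>F. finite F \<and> F \<subseteq> ?Q \<longrightarrow> ?many F)" using Q by simp
    then show ?thesis by simp
  qed
  have "A \<subseteq> P \<or> B \<subseteq> P" if A: "ideal A R" and B: "ideal B R" and AB: "ideal_prod R A B \<subseteq> P" for A B
  proof (rule ccontr)
    assume "\<not> ?thesis"
    then obtain F G where F: "finite F" "F \<subseteq> A <+>\<^bsub>R\<^esub> P" "finite {l \<in> \<Lambda>. F \<subseteq> M l}"
      and G: "finite G" "G \<subseteq> B <+>\<^bsub>R\<^esub> P" "finite {l \<in> \<Lambda>. G \<subseteq> M l}"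
      using enlarge[OF A] enlarge[OF B] by blast
    let ?W = "words R S d"
    have Wc: "?W \<subseteq> carrier R" and Wf: "finite ?W" using words_closed[OF S(2)] finite_words[OF S(1)] .
    have Ac: "A \<subseteq> carrier R" and Bc: "B \<subseteq> carrier R" and Pc: "P \<subseteq> carrier R"
      using ideal_carrier[OF A] ideal_carrier[OF B] ideal_carrier[OF Pid] .
    \<comment> \<open>These finitely many products lie in \<open>P\<close>, hence in infinitely many
      \<open>M l\<close>. For each such \<open>l\<close> they imply
      \<open>f R g \<subseteq> M l\<close>, because the words in \<open>?W\<close> span
      \<open>R\<close> modulo \<open>M l\<close>.\<close>
    let ?H = "(\<lambda>(f, w, g). f \<otimes>\<^bsub>R\<^esub> w \<otimes>\<^bsub>R\<^esub> g) ` (F \<times> ?W \<times> G)"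
    have Fc: "F \<subseteq> carrier R" using F(2) Ac Pc unfolding set_add_def set_mult_def by fastforce
    have Gc: "G \<subseteq> carrier R" using G(2) Bc Pc unfolding set_add_def set_mult_def by fastforce
    have "f \<otimes>\<^bsub>R\<^esub> w \<otimes>\<^bsub>R\<^esub> g \<in> P" if fwg: "f \<in> F" "w \<in> ?W" "g \<in> G" for f w g
    proof -
      obtain a p where f: "f = a \<oplus>\<^bsub>R\<^esub> p" "a \<in> A" "p \<in> P" using F(2) fwg(1) unfolding set_add_def set_mult_def by auto
      obtain b q where g: "g = b \<oplus>\<^bsub>R\<^esub> q" "b \<in> B" "q \<in> P" using G(2) fwg(3) unfolding set_add_def set_mult_def by auto
      have c: "a \<in> carrier R" "p \<in> carrier R" "b \<in> carrier R" "q \<in> carrier R" "w \<in> carrier R"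
        "g \<in> carrier R" using f g fwg Ac Bc Pc Wc Gc by auto
      have aw: "a \<otimes>\<^bsub>R\<^esub> w \<in> A" using ideal.I_r_closed[OF A f(2) c(5)] .
      have "a \<otimes>\<^bsub>R\<^esub> w \<otimes>\<^bsub>R\<^esub> b \<in> P" using AB ideal_prod.prod[OF aw g(2)] by blast
      moreover have "a \<otimes>\<^bsub>R\<^esub> w \<otimes>\<^bsub>R\<^esub> q \<in> P" using ideal.I_l_closed[OF Pid g(3), of "a \<otimes>\<^bsub>R\<^esub> w"] c by simp
      moreover have "p \<otimes>\<^bsub>R\<^esub> w \<otimes>\<^bsub>R\<^esub> g \<in> P"
        by (rule ideal.I_r_closed[OF Pid ideal.I_r_closed[OF Pid f(3) c(5)] c(6)])
      ultimately have "(a \<otimes>\<^bsub>R\<^esub> w \<otimes>\<^bsub>R\<^esub> b \<oplus>\<^bsub>R\<^esub> a \<otimes>\<^bsub>R\<^esub> w \<otimes>\<^bsub>R\<^esub> q) \<oplus>\<^bsub>R\<^esub> p \<otimes>\<^bsub>R\<^esub> w \<otimes>\<^bsub>R\<^esub> g \<in> P"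
        using left_ideal_closed(3)[OF Pl] by blast
      moreover have "f \<otimes>\<^bsub>R\<^esub> w \<otimes>\<^bsub>R\<^esub> g = (a \<otimes>\<^bsub>R\<^esub> w \<otimes>\<^bsub>R\<^esub> b \<oplus>\<^bsub>R\<^esub> a \<otimes>\<^bsub>R\<^esub> w \<otimes>\<^bsub>R\<^esub> q) \<oplus>\<^bsub>R\<^esub> p \<otimes>\<^bsub>R\<^esub> w \<otimes>\<^bsub>R\<^esub> g"
        unfolding f(1) g(1) using c by (simp add: R.l_distr R.r_distr V.M.a_assoc V.M.a_lcomm)
      ultimately show ?thesis by simp
    qed
    then have "?H \<subseteq> P" by auto
    then have inf_H: "?many ?H" using Pmany F(1) G(1) Wf by simp
    have "{l \<in> \<Lambda>. ?H \<subseteq> M l} \<subseteq> {l \<in> \<Lambda>. F \<subseteq> M l} \<union> {l \<in> \<Lambda>. G \<subseteq> M l}"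
    proof
      fix l assume "l \<in> {l \<in> \<Lambda>. ?H \<subseteq> M l}"
      then have l: "l \<in> \<Lambda>" and H: "?H \<subseteq> M l" by auto
      note Ml = M(1)[OF l]
      have sm: "submodule K (M l) R" using ideal_submodule[OF Ml] .
      have Mc: "M l \<subseteq> carrier R" using ideal_carrier[OF Ml] .
      \<comment> \<open>Valid for all pairs, this puts all of \<open>F\<close> or all of
        \<open>G\<close> into \<open>M l\<close>. Only finitely many \<open>l\<close> allow that, a
        contradiction.\<close>
      have "f \<in> M l \<or> g \<in> M l" if fg: "f \<in> F" "g \<in> G" for f g
      proof (rule pr[OF l])
        show fc: "f \<in> carrier R" and gc: "g \<in> carrier R" using fg Fc Gc by auto
        let ?N = "{x \<in> carrier R. x \<otimes>\<^bsub>R\<^esub> g \<in> M l}"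
        have N: "submodule K ?N R" using submodule_vimage_rmult[OF sm gc] .
        fix r assume r: "r \<in> carrier R"
        have "f \<otimes>\<^bsub>R\<^esub> r \<in> ?N"
        proof (rule span_lmult[OF _ _ fc N])
          show "r \<in> sp (M l \<union> ?W)" using d[OF l] r by blast
          show "M l \<union> ?W \<subseteq> carrier R" using Mc Wc by blast
          fix y assume y: "y \<in> M l \<union> ?W"
          have yc: "y \<in> carrier R" using y Mc Wc by blast
          have "f \<otimes>\<^bsub>R\<^esub> y \<otimes>\<^bsub>R\<^esub> g \<in> M l"
            using y
          proof
            assume "y \<in> M l"
            then show ?thesis using ideal.I_r_closed[OF Ml ideal.I_l_closed[OF Ml _ fc] gc] by blast
          next
            assume "y \<in> ?W"
            then have "f \<otimes>\<^bsub>R\<^esub> y \<otimes>\<^bsub>R\<^esub> g \<in> ?H" using fg by force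
            then show ?thesis using H by blast
          qed
          then show "f \<otimes>\<^bsub>R\<^esub> y \<in> ?N" using fc yc by simp
        qed
        then show "f \<otimes>\<^bsub>R\<^esub> r \<otimes>\<^bsub>R\<^esub> g \<in> M l" by blast
      qed
      then show "l \<in> {l \<in> \<Lambda>. F \<subseteq> M l} \<union> {l \<in> \<Lambda>. G \<subseteq> M l}" using l by blast
    qed
    then show False using inf_H F(3) G(3) finite_subset by blast
  qed
  then have "prime_ideal P R" unfolding prime_ideal_def using Pid \<open>P \<noteq> carrier R\<close> by blast
  then show ?thesis using IP z by blast
qed

end

section \<open>Quotient algebras\<close>

lemma limsup_linear:
  assumes "\<And>n. f n \<le> B * (r * n + 1)"
  shows "limsup (\<lambda>n. ereal (ln (real (f n)) / ln (real n))) \<le> 1"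
proof -
  \<comment> \<open>Increasing both constants by 1 keeps them positive even if \<open>B\<close> or
    \<open>r\<close> is 0.\<close>
  define b c where "b = real B + 1" and "c = real r + 1"
  have bc: "b > 0" "c > 0" by (simp_all add: b_def c_def)
  let ?Y = "\<lambda>n::nat. ln (b * (c * real n + 1)) / ln (real n)"
  have "?Y \<longlonglongrightarrow> 1" using bc by real_asymp
  then have "limsup (\<lambda>n. ereal (?Y n)) = ereal 1" by (intro lim_imp_Limsup) auto
  moreover have "limsup (\<lambda>n. ereal (ln (real (f n)) / ln (real n))) \<le> limsup (\<lambda>n. ereal (?Y n))"
  proof (rule Limsup_mono)
    show "\<forall>\<^sub>F n in sequentially. ereal (ln (real (f n)) / ln (real n)) \<le> ereal (?Y n)"
      using eventually_gt_at_top[of 1]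
    proof eventually_elim
      case (elim n)
      have "real (f n) \<le> real (B * (r * n + 1))" using assms of_nat_le_iff by blast
      also have "\<dots> = real B * (real r * real n + 1)" by (simp add: algebra_simps)
      also have "\<dots> \<le> b * (c * real n + 1)"
        unfolding b_def c_def by (intro mult_mono) (auto simp: algebra_simps)
      finally have le: "real (f n) \<le> b * (c * real n + 1)" .
      \<comment> \<open>This covers \<open>f n = 0\<close>, where \<open>ln 0 = 0\<close> by
        convention.\<close>
      have "1 \<le> b * (c * real n + 1)"
        unfolding b_def c_def by (simp add: algebra_simps)
      then have "ln (real (f n)) \<le> ln (b * (c * real n + 1))"
        using le by (cases "f n = 0") auto
      then show ?case using elim by (simp add: divide_right_mono)
    qed
  qed
  ultimately show ?thesis by (simp add: one_ereal_def)
qed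

lemma limsup_at_least_linear:
  assumes "\<And>n. n + 1 \<le> f n"
  shows "1 \<le> limsup (\<lambda>n. ereal (ln (real (f n)) / ln (real n)))"
proof -
  have ev: "\<forall>\<^sub>F n in sequentially. 1 \<le> ereal (ln (real (f n)) / ln (real n))"
    using eventually_gt_at_top[of 1]
  proof eventually_elim
    case (elim n)
    then have "ln (real n) > 0" "ln (real n) \<le> ln (real (f n))"
      using assms[of n] by auto
    then show ?case by (simp add: one_ereal_def)
  qed
  have "(1 :: ereal) = limsup (\<lambda>n::nat. 1)" by (simp add: Limsup_const)
  also have "\<dots> \<le> limsup (\<lambda>n. ereal (ln (real (f n)) / ln (real n)))" using ev by (rule Limsup_mono)
  finally show ?thesis .
qed

context k_algebra
begin

definition algebraic_mod :: "'a set \<Rightarrow> 'a \<Rightarrow> bool" where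
  "algebraic_mod P x \<longleftrightarrow> (\<exists>q\<in>carrier (poly_ring K). q \<noteq> [] \<and> ev x q \<in> P)"

text \<open>The powers of \<open>x\<close> up to the codimension are dependent modulo
  \<open>P\<close>, and the relation expressing one power by the lower ones is a monic
  polynomial.\<close>

lemma algebraic_mod_cofinite:
  assumes P: "ideal P R" and cof: "cofinite P" and x: "x \<in> carrier R"
  shows "algebraic_mod P x"
proof -
  have sm: "submodule K P R" and Pc: "P \<subseteq> carrier R" using ideal_submodule[OF P] ideal_carrier[OF P] .
  obtain F where F: "finite F" "F \<subseteq> carrier R" "carrier R \<subseteq> sp (P \<union> F)" using cof unfolding cofinite_def by blast
  let ?x = "\<lambda>j::nat. x [^]\<^bsub>R\<^esub> j"
  let ?l = "map ?x [0..<card F + 1]"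
  have xc: "?x j \<in> carrier R" for j using x by simp
  have "\<not> indep P ?l"
  proof
    assume "indep P ?l"
    moreover have "set ?l \<subseteq> sp (P \<union> F)" using F(3) xc by auto
    ultimately have "length ?l \<le> card F" using indep_length_le[OF F(1) _ _ Pc F(2)] by blast
    then show False by simp
  qed
  then obtain as f bs where *: "?l = as @ f # bs" "f \<in> sp (P \<union> set as)" by (rule not_indepE)
  define i where "i = length as"
  have "length ?l = length (as @ f # bs)" using *(1) by simp
  then have i: "i < card F + 1" by (simp add: i_def)
  have "?l ! i = f" unfolding *(1) by (simp add: i_def)
  then have f: "f = ?x i" using i by (simp del: upt_Suc)
  have "as = take i ?l" unfolding *(1) by (simp add: i_def)
  then have as: "set as = ?x ` {..<i}" using i by (auto simp: take_map simp del: upt_Suc)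
  \<comment> \<open>The list has length exactly \<open>i\<close>, so that prepending a coefficient
    gives it degree \<open>i\<close>.\<close>
  have lin: "\<exists>cs. set cs \<subseteq> carrier K \<and> length cs = i \<and> eqm P z (ev x cs)"
    if "z \<in> sp (P \<union> ?x ` {..<i})" for z i
    using that
  proof (induction i arbitrary: z)
    case 0
    then have "z \<in> P" using span_of_submodule[OF sm] by simp
    then show ?case using eqm_zero Pc by (intro exI[of _ "[]"]) auto
  next
    case (Suc i)
    have c: "P \<union> ?x ` {..<i} \<subseteq> carrier R" using Pc xc by auto
    have "z \<in> sp (insert (?x i) (P \<union> ?x ` {..<i}))"
      using Suc.prems by (simp add: lessThan_Suc)
    then obtain a u where au: "a \<in> carrier K" "u \<in> sp (P \<union> ?x ` {..<i})" "z = a \<odot>\<^bsub>R\<^esub> ?x i \<oplus>\<^bsub>R\<^esub> u"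
      using span_insertE[OF _ xc c] by metis
    obtain cs where cs: "set cs \<subseteq> carrier K" "length cs = i" "eqm P u (ev x cs)" using Suc.IH[OF au(2)] by blast
    have "eqm P z (ev x (a # cs))"
      unfolding au(3) ev_Cons[OF au(1) x] cs(2)
      by (intro eqm_add[OF sm _ cs(3)] eqm_refl[OF sm] V.smult_closed au(1) xc)
    then show ?case using cs au by (intro exI[of _ "a # cs"]) auto
  qed
  obtain cs where cs: "set cs \<subseteq> carrier K" "length cs = i" "eqm P (?x i) (ev x cs)"
    using lin *(2) unfolding f as by blast
  let ?ds = "map (\<lambda>c. \<ominus>\<^bsub>K\<^esub> c) cs"
  have neg: "set ds \<subseteq> carrier K \<Longrightarrow> ev x (map (\<lambda>c. \<ominus>\<^bsub>K\<^esub> c) ds) = \<ominus>\<^bsub>R\<^esub> ev x ds" for ds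
  proof (induction ds)
    case (Cons d ds)
    then show ?case using ev_closed[of ds x] x by (simp add: ev_Cons V.smult_l_minus V.M.minus_add)
  qed simp
  have "ev x (\<one>\<^bsub>K\<^esub> # ?ds) = ?x i \<ominus>\<^bsub>R\<^esub> ev x cs"
    using x cs(2) neg[OF cs(1)] by (simp add: ev_Cons a_minus_def)
  then have "ev x (\<one>\<^bsub>K\<^esub> # ?ds) \<in> P" using cs(3) unfolding eqm_def by simp
  moreover have "\<one>\<^bsub>K\<^esub> # ?ds \<in> carrier (poly_ring K)"
    using cs(1) by (auto simp: univ_poly_carrier[symmetric] polynomial_def)
  ultimately show ?thesis unfolding algebraic_mod_def by blast
qed

section \<open>The quotient by a fixed ideal \<open>P\<close>\<close>

context
  fixes P assumes P: "ideal P R"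
begin

abbreviation (input) Q where "Q \<equiv> quotient_algebra R P"
abbreviation (input) \<pi> where "\<pi> x \<equiv> P +>\<^bsub>R\<^esub> x"

lemma quotient_simps:
  shows Q_carrier: "carrier Q = \<pi> ` carrier R"
    and Q_zero: "\<zero>\<^bsub>Q\<^esub> = \<pi> \<zero>\<^bsub>R\<^esub>" and Q_one: "\<one>\<^bsub>Q\<^esub> = \<pi> \<one>\<^bsub>R\<^esub>"
    and Q_add: "\<And>x y. x \<in> carrier R \<Longrightarrow> y \<in> carrier R \<Longrightarrow> \<pi> x \<oplus>\<^bsub>Q\<^esub> \<pi> y = \<pi> (x \<oplus>\<^bsub>R\<^esub> y)"
    and Q_mult: "\<And>x y. x \<in> carrier R \<Longrightarrow> y \<in> carrier R \<Longrightarrow> \<pi> x \<otimes>\<^bsub>Q\<^esub> \<pi> y = \<pi> (x \<otimes>\<^bsub>R\<^esub> y)"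
    and Q_smult: "\<And>c x. c \<in> carrier K \<Longrightarrow> x \<in> carrier R \<Longrightarrow> c \<odot>\<^bsub>Q\<^esub> \<pi> x = \<pi> (c \<odot>\<^bsub>R\<^esub> x)"
proof -
  interpret I: ideal P R by (rule P)
  have sm: "submodule K P R" by (rule ideal_submodule[OF P])
  show "carrier Q = \<pi> ` carrier R" by (auto simp: quotient_algebra_def FactRing_def A_RCOSETS_def')
  have "\<pi> \<zero>\<^bsub>R\<^esub> = P" unfolding a_r_coset_def' using ideal_carrier[OF P] by (auto simp: subset_iff)
  then show "\<zero>\<^bsub>Q\<^esub> = \<pi> \<zero>\<^bsub>R\<^esub>" by (simp add: quotient_algebra_def FactRing_def)
  show "\<one>\<^bsub>Q\<^esub> = \<pi> \<one>\<^bsub>R\<^esub>" by (simp add: quotient_algebra_def FactRing_def)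
  show "\<pi> x \<oplus>\<^bsub>Q\<^esub> \<pi> y = \<pi> (x \<oplus>\<^bsub>R\<^esub> y)" if "x \<in> carrier R" "y \<in> carrier R" for x y
    using I.a_rcos_sum[OF that] by (simp add: quotient_algebra_def FactRing_def)
  show "\<pi> x \<otimes>\<^bsub>Q\<^esub> \<pi> y = \<pi> (x \<otimes>\<^bsub>R\<^esub> y)" if "x \<in> carrier R" "y \<in> carrier R" for x y
    using I.rcoset_mult_add[OF that] by (simp add: quotient_algebra_def FactRing_def)
  show "c \<odot>\<^bsub>Q\<^esub> \<pi> x = \<pi> (c \<odot>\<^bsub>R\<^esub> x)" if "c \<in> carrier K" "x \<in> carrier R" for c x
    using coset_map[OF sm that(2), of "\<lambda>y. c \<odot>\<^bsub>R\<^esub> y"] eqm_smult[OF sm _ that(1)]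
    by (simp add: quotient_algebra_def)
qed

lemmas Q_ops = Q_carrier Q_zero Q_one Q_add Q_mult Q_smult

lemma quotient_k_algebra: "k_algebra K Q"
proof -
  have ag: "abelian_group Q"
  proof (rule abelian_groupI)
    fix x assume "x \<in> carrier Q"
    then obtain a where a: "a \<in> carrier R" "x = \<pi> a" unfolding Q_carrier by blast
    then have "\<pi> (\<ominus>\<^bsub>R\<^esub> a) \<oplus>\<^bsub>Q\<^esub> x = \<zero>\<^bsub>Q\<^esub>" by (simp add: Q_ops V.M.l_neg)
    then show "\<exists>y\<in>carrier Q. y \<oplus>\<^bsub>Q\<^esub> x = \<zero>\<^bsub>Q\<^esub>" using a unfolding Q_carrier by blast
  qed (auto simp: Q_ops V.M.a_assoc V.M.a_comm V.M.a_lcomm)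
  have rg: "ring Q"
  proof (rule ringI[OF ag])
    show "Group.monoid Q" by (rule monoidI) (auto simp: Q_ops R.m_assoc)
  qed (auto simp: Q_ops R.l_distr R.r_distr)
  have md: "Module.module K Q"
    by (rule Module.moduleI[OF V.R.cring_axioms ag])
      (auto simp: Q_ops V.smult_l_distr V.smult_r_distr V.smult_assoc1)
  show ?thesis
    by (intro k_algebra.intro vectorspace.intro k_algebra_axioms.intro md rg V.field_axioms)
      (auto simp: Q_ops smult_mult_left smult_mult_right)
qed

interpretation Q: k_algebra K Q by (rule quotient_k_algebra)

lemma Q_word_value: "set xs \<subseteq> carrier R \<Longrightarrow> word_value Q (map \<pi> xs) = \<pi> (word_value R xs)"
  by (induction xs) (auto simp: word_value_def Q_one Q_mult word_value_closed[unfolded word_value_def])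

lemma Q_words: assumes "S \<subseteq> carrier R" shows "words Q (\<pi> ` S) n = \<pi> ` words R S n"
proof
  show "words Q (\<pi> ` S) n \<subseteq> \<pi> ` words R S n"
  proof
    fix y assume "y \<in> words Q (\<pi> ` S) n"
    then obtain ys where ys: "y = word_value Q ys" "ys \<in> lists (\<pi> ` S)" "length ys \<le> n"
      unfolding words_def by (auto simp: in_lists_conv_set)
    then obtain xs where xs: "ys = map \<pi> xs" "xs \<in> lists S" unfolding lists_image by blast
    then have "set xs \<subseteq> S" by auto
    then have "y = \<pi> (word_value R xs)" "length xs \<le> n" using Q_word_value[of xs] assms ys xs by auto
    then show "y \<in> \<pi> ` words R S n" using \<open>set xs \<subseteq> S\<close> unfolding words_def by blast
  qed
  show "\<pi> ` words R S n \<subseteq> words Q (\<pi> ` S) n"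
  proof
    fix y assume "y \<in> \<pi> ` words R S n"
    then obtain xs where xs: "y = \<pi> (word_value R xs)" "set xs \<subseteq> S" "length xs \<le> n" unfolding words_def by blast
    then have "y = word_value Q (map \<pi> xs)" using Q_word_value[of xs] assms by auto
    moreover have "set (map \<pi> xs) \<subseteq> \<pi> ` S" "length (map \<pi> xs) \<le> n" using xs by auto
    ultimately show "y \<in> words Q (\<pi> ` S) n" unfolding words_def by blast
  qed
qed

lemma Q_submodule_vimage:
  assumes "submodule K N Q" shows "submodule K {x \<in> carrier R. \<pi> x \<in> N} R"
proof (rule submoduleI)
  show "\<zero>\<^bsub>R\<^esub> \<in> {x \<in> carrier R. \<pi> x \<in> N}" using submodule.zero_closed[OF assms] unfolding Q_zero by simp
  show "v \<oplus>\<^bsub>R\<^esub> w \<in> {x \<in> carrier R. \<pi> x \<in> N}"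
    if "v \<in> {x \<in> carrier R. \<pi> x \<in> N}" "w \<in> {x \<in> carrier R. \<pi> x \<in> N}" for v w
    using that submodule.m_closed[OF assms, of "\<pi> v" "\<pi> w"] by (simp add: Q_add)
  show "c \<odot>\<^bsub>R\<^esub> v \<in> {x \<in> carrier R. \<pi> x \<in> N}"
    if "c \<in> carrier K" "v \<in> {x \<in> carrier R. \<pi> x \<in> N}" for c v
    using that submodule.smult_closed[OF assms that(1), of "\<pi> v"] by (simp add: Q_smult)
qed blast

lemma Q_span_image: assumes "A \<subseteq> carrier R" shows "\<pi> ` sp A \<subseteq> Q.sp (\<pi> ` A)"
proof -
  have c: "\<pi> ` A \<subseteq> carrier Q" using assms unfolding Q_carrier by blast
  have "A \<subseteq> {x \<in> carrier R. \<pi> x \<in> Q.sp (\<pi> ` A)}" using assms Q.span_base[OF c] by blast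
  then have "sp A \<subseteq> {x \<in> carrier R. \<pi> x \<in> Q.sp (\<pi> ` A)}"
    by (rule span_minimal[OF _ Q_submodule_vimage[OF Q.V.span_is_submodule[OF c]]])
  then show ?thesis by blast
qed

lemma Q_span_preimage:
  assumes "A \<subseteq> carrier R" "x \<in> carrier R" "\<pi> x \<in> Q.sp (\<pi> ` A)" shows "x \<in> sp (P \<union> A)"
proof -
  have sm: "submodule K P R" and Pc: "P \<subseteq> carrier R" using ideal_submodule[OF P] ideal_carrier[OF P] .
  have PA: "P \<union> A \<subseteq> carrier R" using Pc assms by blast
  have spc: "sp (P \<union> A) \<subseteq> carrier R" using V.span_is_subset2[OF PA] .
  have "submodule K (\<pi> ` sp (P \<union> A)) Q"
  proof (rule Q.submoduleI)
    show "\<pi> ` sp (P \<union> A) \<subseteq> carrier Q" using spc unfolding Q_carrier by blast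
    show "\<zero>\<^bsub>Q\<^esub> \<in> \<pi> ` sp (P \<union> A)" unfolding Q_zero using span_zero[OF PA] by (rule imageI)
    show "v \<oplus>\<^bsub>Q\<^esub> w \<in> \<pi> ` sp (P \<union> A)" if vw: "v \<in> \<pi> ` sp (P \<union> A)" "w \<in> \<pi> ` sp (P \<union> A)" for v w
    proof -
      from vw obtain a b where ab: "a \<in> sp (P \<union> A)" "b \<in> sp (P \<union> A)" "v = \<pi> a" "w = \<pi> b" by blast
      then have "a \<in> carrier R" "b \<in> carrier R" using spc by auto
      then have "v \<oplus>\<^bsub>Q\<^esub> w = \<pi> (a \<oplus>\<^bsub>R\<^esub> b)" using ab by (simp add: Q_add)
      then show ?thesis using span_add[OF PA ab(1,2)] by (rule image_eqI)
    qed
    show "c \<odot>\<^bsub>Q\<^esub> v \<in> \<pi> ` sp (P \<union> A)" if c: "c \<in> carrier K" and v: "v \<in> \<pi> ` sp (P \<union> A)" for c v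
    proof -
      from v obtain a where a: "a \<in> sp (P \<union> A)" "v = \<pi> a" by blast
      then have "a \<in> carrier R" using spc by auto
      then have "c \<odot>\<^bsub>Q\<^esub> v = \<pi> (c \<odot>\<^bsub>R\<^esub> a)" using a c by (simp add: Q_smult)
      then show ?thesis using span_smult[OF PA c a(1)] by (rule image_eqI)
    qed
  qed
  moreover have "\<pi> ` A \<subseteq> \<pi> ` sp (P \<union> A)" using V.in_own_span[OF PA] by blast
  ultimately have "\<pi> x \<in> \<pi> ` sp (P \<union> A)" using Q.span_minimal assms(3) by blast
  then obtain a where a: "a \<in> sp (P \<union> A)" "\<pi> x = \<pi> a" by blast
  then have "eqm P x a" using coset_eq_iff[OF sm assms(2)] spc by blast
  then have "eqm (sp (P \<union> A)) x a" using span_base[OF PA] unfolding eqm_def by blast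
  then show ?thesis using eqm_mem[OF V.span_is_submodule[OF PA] _ a(1)] by blast
qed

lemma algebraic_mod_quotient:
  assumes x: "x \<in> carrier R" and alg: "algebraic_element K Q (\<pi> x)"
  shows "algebraic_mod P x"
proof -
  have sm: "submodule K P R" by (rule ideal_submodule[OF P])
  obtain q where q: "q \<in> carrier (poly_ring K)" "q \<noteq> []" "Q.ev (\<pi> x) q = \<zero>\<^bsub>Q\<^esub>"
    using alg unfolding algebraic_element_def Q.ev_def by (auto simp: univ_poly_zero)
  have \<pi>x: "\<pi> x \<in> carrier Q" using x unfolding Q_carrier by blast
  have "Q.ev (\<pi> x) p = \<pi> (ev x p)" if "set p \<subseteq> carrier K" for p
    using that
  proof (induction p rule: rev_induct)
    case Nil
    then show ?case by (simp add: Q_zero)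
  next
    case (snoc c p)
    then have p: "set p \<subseteq> carrier K" "c \<in> carrier K" by auto
    have e: "ev x p \<in> carrier R" using ev_closed[OF p(1) x] .
    show ?case unfolding Q.ev_snoc[OF p \<pi>x] ev_snoc[OF p x] snoc.IH[OF p(1)]
      using e p x by (simp add: Q_one Q_mult Q_smult Q_add)
  qed
  then have "\<pi> (ev x q) = \<pi> \<zero>\<^bsub>R\<^esub>" using q poly_ring_set[OF q(1)] Q_zero by simp
  then have "eqm P (ev x q) \<zero>\<^bsub>R\<^esub>"
    using coset_eq_iff[OF sm ev_closed[OF poly_ring_set[OF q(1)] x] V.M.zero_closed] by blast
  then have "ev x q \<in> P" using eqm_mem[OF sm] submodule.zero_closed[OF sm] by blast
  then show ?thesis unfolding algebraic_mod_def using q by blast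
qed

text \<open>The hypothesis on \<open>x\<close> requires the exact value 1. Linear growth gives the
  upper bound; infinite dimension gives the lower one, since each word length contributes a new
  dimension.\<close>

lemma GKdim_quotient_eq_1:
  assumes S: "generates S" and lin: "linear_growth P S" and ncof: "\<not> cofinite P"
  shows "GKdim K Q = 1"
proof (rule antisym)
  have Sc: "S \<subseteq> carrier R" "finite S" using S unfolding generates_def by auto
  have W: "words R S m \<subseteq> carrier R" for m using words_closed[OF Sc(1)] .
  have sm: "submodule K P R" and Pc: "P \<subseteq> carrier R" using ideal_submodule[OF P] ideal_carrier[OF P] .
  obtain B where B: "\<And>n. \<exists>G. finite G \<and> G \<subseteq> words R S n \<and> card G \<le> B * (n + 1) \<and> words R S n \<subseteq> sp (P \<union> G)"
    using lin unfolding linear_growth_def by blast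
  show "GKdim K Q \<le> 1"
    unfolding GKdim_def
  proof (rule SUP_least)
    fix V assume "V \<in> {Q.sp T |T. finite T \<and> T \<subseteq> carrier Q}"
    then obtain T where T: "V = Q.sp T" "finite T" "T \<subseteq> \<pi> ` carrier R" unfolding Q_carrier by blast
    obtain T0 where T0: "T0 \<subseteq> carrier R" "finite T0" "T = \<pi> ` T0" using finite_subset_image[OF T(2,3)] by blast
    obtain r where r: "T0 \<subseteq> sp (words R S r)" using generates_subset_words[OF S T0(2,1)] by blast
    have Tc: "T \<subseteq> carrier Q" using T(3) unfolding Q_carrier .
    \<comment> \<open>An arbitrary finite-dimensional subspace is covered by words of some length
      \<open>r\<close>, and products of \<open>n\<close> of its elements by words of length
      \<open>r * n\<close>.\<close>
    have "growth K Q V n \<le> B * (r * n + 1)" for n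
    proof -
      obtain G where G: "finite G" "G \<subseteq> words R S (r * n)" "card G \<le> B * (r * n + 1)"
        "words R S (r * n) \<subseteq> sp (P \<union> G)" using B[of "r * n"] by blast
      have Gc: "G \<subseteq> carrier R" using G(2) W by blast
      have PG: "P \<union> G \<subseteq> carrier R" using Pc Gc by blast
      have \<pi>G: "\<pi> ` G \<subseteq> carrier Q" using Gc unfolding Q_carrier by blast
      have "words R T0 n \<subseteq> sp (words R S (r * n))" using words_of_span[OF Sc(1) r] .
      also have "\<dots> \<subseteq> sp (P \<union> G)" using span_subsetI[OF G(4) PG] .
      finally have "\<pi> ` words R T0 n \<subseteq> \<pi> ` sp (P \<union> G)" by (rule image_mono)
      also have "\<dots> \<subseteq> Q.sp (\<pi> ` (P \<union> G))" by (rule Q_span_image[OF PG])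
      also have "\<dots> \<subseteq> Q.sp (\<pi> ` G)"
      proof (rule Q.span_subsetI[OF _ \<pi>G])
        have "\<pi> p = \<zero>\<^bsub>Q\<^esub>" if "p \<in> P" for p
          using coset_eq_iff[OF sm _ V.M.zero_closed, of p] eqm_zero[of p P] Pc that unfolding Q_zero by blast
        then show "\<pi> ` (P \<union> G) \<subseteq> Q.sp (\<pi> ` G)" using Q.span_zero[OF \<pi>G] Q.span_base[OF \<pi>G] by auto
      qed
      finally have "words Q T n \<subseteq> Q.sp (\<pi> ` G)" using Q_words[OF T0(1)] T0(3) by simp
      then have "growth K Q V n \<le> card (\<pi> ` G)"
        unfolding T(1) using Q.growth_le[OF Tc T(2) _ _ \<pi>G] G(1) by blast
      also have "\<dots> \<le> card G" by (rule card_image_le[OF G(1)])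
      finally show ?thesis using G(3) by simp
    qed
    then show "limsup (\<lambda>n. ereal (ln (real (growth K Q V n)) / ln (real n))) \<le> 1" by (rule limsup_linear)
  qed
  have \<pi>S: "\<pi> ` S \<subseteq> carrier Q" "finite (\<pi> ` S)" using Sc unfolding Q_carrier by auto
  have "Q.generates (\<pi> ` S)"
    unfolding Q.generates_def
  proof (intro conjI \<pi>S ballI)
    fix y assume "y \<in> carrier Q"
    then obtain x where x: "x \<in> carrier R" "y = \<pi> x" unfolding Q_carrier by blast
    then obtain n where "x \<in> sp (words R S n)" using S unfolding generates_def by blast
    then have "y \<in> Q.sp (words Q (\<pi> ` S) n)" unfolding Q_words[OF Sc(1)] x(2) using Q_span_image[OF W] by blast
    then show "\<exists>n. y \<in> Q.sp (words Q (\<pi> ` S) n)" by blast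
  qed
  moreover have z: "left_ideal {\<zero>\<^bsub>Q\<^esub>} Q" by (rule Q.left_idealI) auto
  moreover have "\<not> carrier Q \<subseteq> Q.sp ({\<zero>\<^bsub>Q\<^esub>} \<union> words Q (\<pi> ` S) n)" for n
  proof
    assume sub: "carrier Q \<subseteq> Q.sp ({\<zero>\<^bsub>Q\<^esub>} \<union> words Q (\<pi> ` S) n)"
    let ?A = "insert \<zero>\<^bsub>R\<^esub> (words R S n)"
    have A: "?A \<subseteq> carrier R" "finite ?A" using W finite_words[OF Sc(2)] by auto
    have "{\<zero>\<^bsub>Q\<^esub>} \<union> words Q (\<pi> ` S) n = \<pi> ` ?A" unfolding Q_words[OF Sc(1)] Q_zero by simp
    then have "\<pi> x \<in> Q.sp (\<pi> ` ?A)" if "x \<in> carrier R" for x using sub that unfolding Q_carrier by auto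
    then have "carrier R \<subseteq> sp (P \<union> ?A)" using Q_span_preimage[OF A(1)] by blast
    then show False using ncof A unfolding cofinite_def by blast
  qed
  ultimately have us: "\<exists>us. length us = n + 1 \<and> set us \<subseteq> words Q (\<pi> ` S) n \<and> Q.indep {\<zero>\<^bsub>Q\<^esub>} us" for n
    using Q.strict_growth by blast
  have "n + 1 \<le> growth K Q (Q.sp (\<pi> ` S)) n" for n
  proof -
    obtain us where u: "length us = n + 1" "set us \<subseteq> words Q (\<pi> ` S) n" "Q.indep {\<zero>\<^bsub>Q\<^esub>} us"
      using us by blast
    have c: "words Q (\<pi> ` S) n \<subseteq> carrier Q" using Q.words_closed[OF \<pi>S(1)] .
    have "Q.indep {} us" by (rule Q.indep_antimono[OF u(3)]) (use u(2) c in auto)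
    moreover have "set us \<subseteq> Q.sp (words Q (\<pi> ` S) n)" using u(2) Q.V.in_own_span[OF c] by blast
    ultimately show ?thesis using Q.growth_ge[OF \<pi>S] u(1) by metis
  qed
  then have "1 \<le> limsup (\<lambda>n. ereal (ln (real (growth K Q (Q.sp (\<pi> ` S)) n)) / ln (real n)))"
    by (rule limsup_at_least_linear)
  also have "\<dots> \<le> GKdim K Q" unfolding GKdim_def by (rule SUP_upper) (use \<pi>S in blast)
  finally show "1 \<le> GKdim K Q" .
qed

end

section \<open>Primitivity\<close>

lemma generates_insert:
  assumes "generates S" "c \<in> carrier R" shows "generates (insert c S)"
  unfolding generates_def
proof (intro conjI ballI)
  fix x assume "x \<in> carrier R"
  then obtain n where "x \<in> sp (words R S n)" using assms(1) unfolding generates_def by blast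
  moreover have "sp (words R S n) \<subseteq> sp (words R (insert c S) n)" by (intro span_mono words_mono) auto
  ultimately show "\<exists>n. x \<in> sp (words R (insert c S) n)" by blast
qed (use assms in \<open>auto simp: generates_def\<close>)

text \<open>The generating set depends on \<open>M\<close>, since it must contain a regular element
  of \<open>M\<close>. This is harmless: the conclusions drawn from linear growth, finite
  codimension and GK dimension 1, do not mention generators.\<close>

lemma ideal_linear_growth:
  assumes GK: "GKdim K R < 3" and pr: "prime_ring R" and go: "left_goldie R"
    and S: "generates S" and M: "ideal M R" "M \<noteq> {\<zero>\<^bsub>R\<^esub>}"
  shows "\<exists>S'. generates S' \<and> linear_growth M S'"
proof -
  obtain c where c: "c \<in> M" "\<And>r. r \<in> carrier R \<Longrightarrow> r \<otimes>\<^bsub>R\<^esub> c = \<zero>\<^bsub>R\<^esub> \<Longrightarrow> r = \<zero>\<^bsub>R\<^esub>"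
    using R.prime_goldie_regular[OF pr go M] by blast
  have "c \<in> carrier R" using c(1) ideal_carrier[OF M(1)] by blast
  then have "generates (insert c S)" by (rule generates_insert[OF S])
  moreover have "linear_growth M (insert c S)"
    using S unfolding generates_def by (intro linear_growth_mod_regular[OF GK _ _ M(1) c]) auto
  ultimately show ?thesis by blast
qed

text \<open>Division puts the factor \<open>x - \<mu>\<close> on the right, so a left ideal absorbs
  its multiples and \<open>q(x) = q(\<mu>)\<close> modulo \<open>L\<close>; a nonzero scalar in
  \<open>L\<close> would put 1 there.\<close>

lemma root_of_algebraic_mod:
  assumes L: "left_ideal L R" "\<one>\<^bsub>R\<^esub> \<notin> L" and x: "x \<in> carrier R" and \<mu>: "\<mu> \<in> carrier K"
    and xL: "x \<ominus>\<^bsub>R\<^esub> \<mu> \<odot>\<^bsub>R\<^esub> \<one>\<^bsub>R\<^esub> \<in> L" and q: "q \<in> carrier (poly_ring K)" "q \<noteq> []" "ev x q \<in> L"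
  shows "V.is_root q \<mu>"
proof -
  have sm: "submodule K L R" by (rule left_ideal_submodule[OF L(1)])
  have qK: "set q \<subseteq> carrier K" by (rule poly_ring_set[OF q(1)])
  let ?r = "V.eval q \<mu>" and ?x = "x \<ominus>\<^bsub>R\<^esub> \<mu> \<odot>\<^bsub>R\<^esub> \<one>\<^bsub>R\<^esub>"
  have r: "?r \<in> carrier K" using V.eval_in_carrier[OF qK \<mu>] .
  have xc: "?x \<in> carrier R" using x \<mu> by simp
  obtain s where s: "set s \<subseteq> carrier K" "ev x q = ev x s \<otimes>\<^bsub>R\<^esub> ?x \<oplus>\<^bsub>R\<^esub> ?r \<odot>\<^bsub>R\<^esub> \<one>\<^bsub>R\<^esub>"
    using polyf_divide_linear[OF qK \<mu> x] by blast
  have sc: "ev x s \<in> carrier R" using ev_closed[OF s(1) x] .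
  have "ev x s \<otimes>\<^bsub>R\<^esub> ?x \<in> L" using left_ideal_closed(4)[OF L(1) sc xL] .
  then have "ev x q \<ominus>\<^bsub>R\<^esub> ev x s \<otimes>\<^bsub>R\<^esub> ?x \<in> L" by (rule submodule_minus[OF sm q(3)])
  moreover have "ev x q \<ominus>\<^bsub>R\<^esub> ev x s \<otimes>\<^bsub>R\<^esub> ?x = ?r \<odot>\<^bsub>R\<^esub> \<one>\<^bsub>R\<^esub>"
  proof -
    have "a \<oplus>\<^bsub>R\<^esub> b \<ominus>\<^bsub>R\<^esub> a = b" if "a \<in> carrier R" "b \<in> carrier R" for a b
      using that by (simp add: a_minus_def V.M.a_assoc V.M.a_comm V.M.r_neg1 V.M.r_neg2)
    then show ?thesis unfolding s(2) using sc xc r by simp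
  qed
  ultimately have rL: "?r \<odot>\<^bsub>R\<^esub> \<one>\<^bsub>R\<^esub> \<in> L" by simp
  have "?r = \<zero>\<^bsub>K\<^esub>"
  proof (rule ccontr)
    assume "?r \<noteq> \<zero>\<^bsub>K\<^esub>"
    then have i: "inv\<^bsub>K\<^esub> ?r \<in> carrier K" "inv\<^bsub>K\<^esub> ?r \<otimes>\<^bsub>K\<^esub> ?r = \<one>\<^bsub>K\<^esub>" using r by (auto simp: V.field_Units)
    then have "inv\<^bsub>K\<^esub> ?r \<odot>\<^bsub>R\<^esub> (?r \<odot>\<^bsub>R\<^esub> \<one>\<^bsub>R\<^esub>) \<in> L" using submodule.smult_closed[OF sm i(1) rL] by simp
    then show False using i r L(2) by (simp add: V.smult_assoc1[symmetric])
  qed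
  then show ?thesis unfolding V.is_root_def using \<mu> q(2) by blast
qed

text \<open>For \<open>\<mu>\<close> outside the set, \<open>x - \<mu>\<close> has a left inverse,
  as otherwise \<open>R (x - \<mu>)\<close> would extend to a maximal left ideal. Were the set
  countable, uncountably many such inverses would make \<open>x\<close> algebraic by
  \<open>dixmier\<close> with \<open>L = 0\<close>.\<close>

lemma uncountably_many_maximal:
  assumes unc: "uncountable (carrier K)" and S: "generates S"
    and x: "x \<in> carrier R" "\<not> algebraic_element K R x"
  shows "uncountable {\<mu> \<in> carrier K. \<exists>L. maximal_left_ideal L R \<and> x \<ominus>\<^bsub>R\<^esub> \<mu> \<odot>\<^bsub>R\<^esub> \<one>\<^bsub>R\<^esub> \<in> L}"
    (is "uncountable ?\<Lambda>")
proof
  assume c: "countable ?\<Lambda>"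
  let ?x = "\<lambda>\<mu>. x \<ominus>\<^bsub>R\<^esub> \<mu> \<odot>\<^bsub>R\<^esub> \<one>\<^bsub>R\<^esub>"
  have Z: "left_ideal {\<zero>\<^bsub>R\<^esub>} R" by (rule left_idealI) auto
  have inv: "\<exists>y\<in>carrier R. eqm {\<zero>\<^bsub>R\<^esub>} (y \<otimes>\<^bsub>R\<^esub> ?x \<mu>) \<one>\<^bsub>R\<^esub>" if m: "\<mu> \<in> carrier K - ?\<Lambda>" for \<mu>
  proof (rule ccontr)
    assume no: "\<not> ?thesis"
    have xc: "?x \<mu> \<in> carrier R" using m x by simp
    let ?J = "{l \<oplus>\<^bsub>R\<^esub> r \<otimes>\<^bsub>R\<^esub> ?x \<mu> |l r. l \<in> {\<zero>\<^bsub>R\<^esub>} \<and> r \<in> carrier R}"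
    have J: "left_ideal ?J R" by (rule left_ideal_join[OF Z xc])
    have "\<one>\<^bsub>R\<^esub> \<notin> ?J"
    proof
      assume "\<one>\<^bsub>R\<^esub> \<in> ?J"
      then obtain r where r: "r \<in> carrier R" "\<one>\<^bsub>R\<^esub> = r \<otimes>\<^bsub>R\<^esub> ?x \<mu>" using xc by auto
      have "eqm {\<zero>\<^bsub>R\<^esub>} (r \<otimes>\<^bsub>R\<^esub> ?x \<mu>) \<one>\<^bsub>R\<^esub>"
        unfolding r(2)[symmetric] using eqm_refl[OF left_ideal_submodule[OF Z] R.one_closed] .
      then show False using no r(1) by blast
    qed
    then obtain L where L: "maximal_left_ideal L R" "?J \<subseteq> L" using ex_maximal_left_ideal[OF J] by blast
    have "?x \<mu> = \<zero>\<^bsub>R\<^esub> \<oplus>\<^bsub>R\<^esub> \<one>\<^bsub>R\<^esub> \<otimes>\<^bsub>R\<^esub> ?x \<mu>" using xc by simp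
    then have "?x \<mu> \<in> ?J" using R.one_closed by blast
    then show False using L m by blast
  qed
  have u: "uncountable (carrier K - ?\<Lambda>)" by (rule uncountable_minus_countable[OF unc c])
  have "\<exists>\<phi> w. polyf x \<phi> w \<and> w \<in> {\<zero>\<^bsub>R\<^esub>} \<and> (\<exists>t\<in>carrier K. \<phi> t \<noteq> \<zero>\<^bsub>K\<^esub>)"
  proof (rule dixmier[OF S u _ Z x(1) _ inv])
    show "l \<otimes>\<^bsub>R\<^esub> x \<in> {\<zero>\<^bsub>R\<^esub>}" if "l \<in> {\<zero>\<^bsub>R\<^esub>}" for l using that x(1) by simp
  qed blast
  then show False using algebraic_elementI[OF _ x(1)] x(2) by blast
qed

lemma not_left_primitive_algebraic_mod:
  assumes ac: "algebraically_closed K" and unc: "uncountable (carrier K)"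
    and S: "generates S" and pr: "prime_ring R" and go: "left_goldie R"
    and nPI: "\<not> PI_algebra K R" and GK: "GKdim K R < 3" and np: "\<not> left_primitive R"
    and x: "x \<in> carrier R" "\<not> algebraic_element K R x"
    and alg: "\<And>P. prime_ideal P R \<Longrightarrow> GKdim K (quotient_algebra R P) = 1 \<Longrightarrow>
      algebraic_element K (quotient_algebra R P) (P +>\<^bsub>R\<^esub> x)"
  shows False
proof -
  have Sc: "finite S" "S \<subseteq> carrier R" using S unfolding generates_def by auto
  let ?x = "\<lambda>\<mu>. x \<ominus>\<^bsub>R\<^esub> \<mu> \<odot>\<^bsub>R\<^esub> \<one>\<^bsub>R\<^esub>"
  let ?\<Lambda> = "{\<mu> \<in> carrier K. \<exists>L. maximal_left_ideal L R \<and> ?x \<mu> \<in> L}"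
  have unc\<Lambda>: "uncountable ?\<Lambda>" by (rule uncountably_many_maximal[OF unc S x])
  have "\<forall>\<mu>\<in>?\<Lambda>. \<exists>L. maximal_left_ideal L R \<and> ?x \<mu> \<in> L" by blast
  from bchoice[OF this] obtain L where L: "\<And>\<mu>. \<mu> \<in> ?\<Lambda> \<Longrightarrow> maximal_left_ideal (L \<mu>) R"
    "\<And>\<mu>. \<mu> \<in> ?\<Lambda> \<Longrightarrow> ?x \<mu> \<in> L \<mu>" by blast
  let ?M = "\<lambda>\<mu>. module_annihilator (L \<mu>)"
  have Mid: "ideal (?M \<mu>) R" and annL: "?M \<mu> \<subseteq> L \<mu>" if "\<mu> \<in> ?\<Lambda>" for \<mu>
    using module_annihilator_ideal module_annihilator_subset maximal_left_idealD(1)[OF L(1)[OF that]] by auto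
  have M1: "\<one>\<^bsub>R\<^esub> \<notin> ?M \<mu>" if "\<mu> \<in> ?\<Lambda>" for \<mu>
    using maximal_left_idealD(3)[OF L(1)[OF that]] annL[OF that] by blast
  have cof: "cofinite (?M \<mu>)" if m: "\<mu> \<in> ?\<Lambda>" for \<mu>
  proof -
    have "?M \<mu> \<noteq> {\<zero>\<^bsub>R\<^esub>}" using left_primitiveI[OF L(1)[OF m]] np by blast
    then obtain S' where "generates S'" "linear_growth (?M \<mu>) S'"
      using ideal_linear_growth[OF GK pr go S Mid[OF m]] by blast
    then show ?thesis using primitive_linear_growth_cofinite[OF ac unc _ L(1)[OF m]] by blast
  qed
  let ?cod = "\<lambda>\<mu> d. \<exists>F. finite F \<and> F \<subseteq> carrier R \<and> carrier R \<subseteq> sp (?M \<mu> \<union> F) \<and> card F = d"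
  have "\<exists>d. infinite {\<mu> \<in> ?\<Lambda>. ?cod \<mu> d}"
  proof (rule ccontr)
    assume "\<nexists>d. infinite {\<mu> \<in> ?\<Lambda>. ?cod \<mu> d}"
    then have "countable (\<Union>d. {\<mu> \<in> ?\<Lambda>. ?cod \<mu> d})" by (intro countable_UN) (auto intro: countable_finite)
    moreover have "?\<Lambda> \<subseteq> (\<Union>d. {\<mu> \<in> ?\<Lambda>. ?cod \<mu> d})"
    proof
      fix \<mu> assume m: "\<mu> \<in> ?\<Lambda>"
      then obtain F where "finite F" "F \<subseteq> carrier R" "carrier R \<subseteq> sp (?M \<mu> \<union> F)"
        using cof[OF m] unfolding cofinite_def by blast
      then have "?cod \<mu> (card F)" by blast
      then show "\<mu> \<in> (\<Union>d. {\<mu> \<in> ?\<Lambda>. ?cod \<mu> d})" using m by blast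
    qed
    ultimately have "countable ?\<Lambda>" by (rule countable_subset[rotated])
    then show False using unc\<Lambda> by simp
  qed
  then obtain d where "infinite {\<mu> \<in> ?\<Lambda>. ?cod \<mu> d}" by (elim exE)
  define \<Delta> where "\<Delta> = {\<mu> \<in> ?\<Lambda>. ?cod \<mu> d}"
  have \<Delta>: "infinite \<Delta>" "\<Delta> \<subseteq> ?\<Lambda>" "\<And>\<mu>. \<mu> \<in> \<Delta> \<Longrightarrow> ?cod \<mu> d"
    unfolding \<Delta>_def by (fact, blast, simp)
  \<comment> \<open>The spanning sets of size \<open>d\<close> vary with \<open>\<mu>\<close>. Words
    of length at most \<open>d\<close> are a common substitute: otherwise
    \<open>strict_growth\<close> would give \<open>d + 1\<close> independent elements in dimension
    at most \<open>d\<close>.\<close>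
  have spans: "carrier R \<subseteq> sp (?M \<mu> \<union> words R S d)" if m: "\<mu> \<in> \<Delta>" for \<mu>
  proof (rule ccontr)
    have m': "\<mu> \<in> ?\<Lambda>" using m \<Delta>(2) by blast
    assume "\<not> ?thesis"
    then obtain us where us: "length us = d + 1" "set us \<subseteq> words R S d" "indep (?M \<mu>) us"
      using strict_growth[OF S ideal_left_ideal[OF Mid[OF m']]] by blast
    obtain F where F: "finite F" "F \<subseteq> carrier R" "carrier R \<subseteq> sp (?M \<mu> \<union> F)" "card F = d" using \<Delta>(3)[OF m] by blast
    have "set us \<subseteq> sp (?M \<mu> \<union> F)" using us(2) words_closed[OF Sc(2), of d] F(3) by blast
    then have "length us \<le> card F" using indep_length_le[OF F(1) _ us(3) ideal_carrier[OF Mid[OF m']] F(2)] by blast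
    then show False using us(1) F(4) by simp
  qed
  \<comment> \<open>A zero intersection would embed \<open>R\<close> into a product of algebras of
    dimension at most \<open>d\<close>, which all satisfy the standard identity of degree
    \<open>d + 1\<close>.\<close>
  have "(\<Inter>\<mu>\<in>\<Delta>. ?M \<mu>) \<noteq> {\<zero>\<^bsub>R\<^esub>}"
  proof
    assume I0: "(\<Inter>\<mu>\<in>\<Delta>. ?M \<mu>) = {\<zero>\<^bsub>R\<^esub>}"
    have "std_poly (d + 1) \<rho> = \<zero>\<^bsub>R\<^esub>" if \<rho>: "range \<rho> \<subseteq> carrier R" for \<rho>
    proof -
      have "std_poly (d + 1) \<rho> \<in> ?M \<mu>" if m: "\<mu> \<in> \<Delta>" for \<mu>
      proof -
        obtain F where F: "finite F" "F \<subseteq> carrier R" "carrier R \<subseteq> sp (?M \<mu> \<union> F)" "card F = d"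
          using \<Delta>(3)[OF m] by blast
        show ?thesis
          by (rule std_poly_in_ideal[OF Mid F(1-3) _ \<rho>]) (use F(4) m \<Delta>(2) in auto)
      qed
      then show ?thesis using I0 by blast
    qed
    then show False using PI_algebraI_std nPI by blast
  qed
  moreover have "\<exists>P. prime_ideal P R \<and> (\<Inter>\<mu>\<in>\<Delta>. ?M \<mu>) \<subseteq> P \<and> (\<forall>z\<in>P. infinite {\<mu> \<in> \<Delta>. z \<in> ?M \<mu>})"
  proof (rule ex_prime_in_infinitely_many[OF Sc \<Delta>(1)])
    fix \<mu> assume m: "\<mu> \<in> \<Delta>"
    then have m': "\<mu> \<in> ?\<Lambda>" using \<Delta>(2) by blast
    show "ideal (?M \<mu>) R" "\<one>\<^bsub>R\<^esub> \<notin> ?M \<mu>" using Mid[OF m'] M1[OF m'] .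
    show "carrier R \<subseteq> sp (?M \<mu> \<union> words R S d)" by (rule spans[OF m])
    show "a \<in> ?M \<mu> \<or> b \<in> ?M \<mu>" if "a \<in> carrier R" "b \<in> carrier R"
      "\<And>r. r \<in> carrier R \<Longrightarrow> a \<otimes>\<^bsub>R\<^esub> r \<otimes>\<^bsub>R\<^esub> b \<in> ?M \<mu>" for a b
      by (rule module_annihilator_prime[OF L(1)[OF m'] that])
  qed
  ultimately obtain P where P: "prime_ideal P R" "(\<Inter>\<mu>\<in>\<Delta>. ?M \<mu>) \<subseteq> P" "(\<Inter>\<mu>\<in>\<Delta>. ?M \<mu>) \<noteq> {\<zero>\<^bsub>R\<^esub>}"
    and many: "\<And>z. z \<in> P \<Longrightarrow> infinite {\<mu> \<in> \<Delta>. z \<in> ?M \<mu>}" by blast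
  have Pid: "ideal P R" using P(1) unfolding prime_ideal_def by blast
  have "\<zero>\<^bsub>R\<^esub> \<in> (\<Inter>\<mu>\<in>\<Delta>. ?M \<mu>)"
    using submodule.zero_closed[OF ideal_submodule[OF Mid]] \<Delta>(2) by blast
  then have "P \<noteq> {\<zero>\<^bsub>R\<^esub>}" using P(2,3) by blast
  then obtain S' where S': "generates S'" "linear_growth P S'"
    using ideal_linear_growth[OF GK pr go S Pid] by blast
  have "algebraic_mod P x"
  \<comment> \<open>The hypothesis on \<open>x\<close> covers only GK dimension 1; a
    finite-dimensional quotient has GK dimension 0, but there every element is algebraic.\<close>
  proof (cases "cofinite P")
    case True
    then show ?thesis using algebraic_mod_cofinite[OF Pid _ x(1)] by blast
  next
    case False
    have "GKdim K (quotient_algebra R P) = 1" by (rule GKdim_quotient_eq_1[OF Pid S' False])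
    then show ?thesis using algebraic_mod_quotient[OF Pid x(1) alg[OF P(1)]] by blast
  qed
  then obtain q where q: "q \<in> carrier (poly_ring K)" "q \<noteq> []" "ev x q \<in> P" unfolding algebraic_mod_def by blast
  have "{\<mu> \<in> \<Delta>. ev x q \<in> ?M \<mu>} \<subseteq> {\<mu>. V.is_root q \<mu>}"
  proof
    fix \<mu> assume "\<mu> \<in> {\<mu> \<in> \<Delta>. ev x q \<in> ?M \<mu>}"
    then have m: "\<mu> \<in> ?\<Lambda>" "ev x q \<in> ?M \<mu>" using \<Delta>(2) by auto
    then have "ev x q \<in> L \<mu>" "\<mu> \<in> carrier K" using annL by auto
    then have "V.is_root q \<mu>"
      using root_of_algebraic_mod[OF _ _ x(1) _ L(2)[OF m(1)] q(1,2)] maximal_left_idealD[OF L(1)[OF m(1)]] by blast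
    then show "\<mu> \<in> {\<mu>. V.is_root q \<mu>}" by blast
  qed
  then have "finite {\<mu> \<in> \<Delta>. ev x q \<in> ?M \<mu>}"
    using V.finite_number_of_roots[OF q(1)] by (rule finite_subset)
  then show False using many[OF q(3)] by blast
qed

end

theorem theorem2p6:
  fixes K :: "('k, 'c) ring_scheme" and R :: "('k, 'a, 'b) module_scheme"
  assumes "algebraically_closed K"
    and "uncountable (carrier K)"
    and "k_algebra K R"
    and "affine_algebra K R"
    and "prime_ring R"
    and "goldie R"
    and "\<not> simple_ring R"
    and "\<not> PI_algebra K R"
    and "GKdim K R < 3"
    and "\<exists>x\<in>carrier R. \<not> algebraic_element K R x \<and>
      (\<forall>P. prime_ideal P R \<and> GKdim K (quotient_algebra R P) = 1
        \<longrightarrow> algebraic_element K (quotient_algebra R P) (P +>\<^bsub>R\<^esub> x))"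
  shows "left_primitive R"
proof (rule ccontr)
  assume np: "\<not> left_primitive R"
  interpret k_algebra K R by fact
  obtain S where S: "generates S" using affine_generates assms(4) by blast
  have go: "left_goldie R" using assms(6) unfolding goldie_def by blast
  obtain x where x: "x \<in> carrier R" "\<not> algebraic_element K R x"
    and alg: "\<And>P. prime_ideal P R \<Longrightarrow> GKdim K (quotient_algebra R P) = 1 \<Longrightarrow>
      algebraic_element K (quotient_algebra R P) (P +>\<^bsub>R\<^esub> x)"
    using assms(10) by blast
  show False
    by (rule not_left_primitive_algebraic_mod[OF assms(1,2) S assms(5) go assms(8,9) np x alg])
qed

end
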